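(* Let $k\in\{0,1,2,\dots\}$, let $\rho\in\mathbb{C}$ with $|\rho|<1$, and let $a,b,c,d,h$ be complex parameters with positive real parts, such that the non-real parameters occur in conjugate pairs among $a,b,c,d$ and also among $a,b,c,h$. Put $$w(x)=\left|\frac{\Gamma(a+ix)\Gamma(b+ix)\Gamma(c+ix)\Gamma(h+ix)}{\Gamma(2ix)}\right|^2,\qquad x\in(0,\infty).$$ Then $$ \int_0^\infty (1-\rho)^{1-a-b-c-d}\ {}_4F_3\!\left(\begin{matrix}\tfrac12(a+b+c+d-1),\ \tfrac12(a+b+c+d),\ a+ix,\ a-ix\\ a+b,\ a+c,\ a+d\end{matrix};-\frac{4\rho}{(1-\rho)^2}\right)W_k(x^2;a,b,c,h)\,w(x)\,dx $$ $$ =\frac{2\pi\,\Gamma(a+b)\Gamma(a+c)\Gamma(k+a+h)\Gamma(k+b+c)\Gamma(k+b+h)\Gamma(k+c+h)\,(k+a+b+c+d-1)_k\,(a+b+c+d-1)_k}{\Gamma(2k+a+b+c+h)\,(a+d)_k} $$ $$ \times\ {}_3F_2\!\left(\begin{matrix}2k+a+b+c+d-1,\ d-h,\ k+b+c\\ 2k+a+b+c+h,\ a+d+k\end{matrix};\rho\right)\rho^k. $$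
   Context: The Pochhammer symbol is $(z)_n=\prod_{i=1}^n(z+i-1)$ (so $(z)_0=1$). The generalized hypergeometric function is ${}_pF_q(a_1,\dots,a_p;b_1,\dots,b_q;z)=\sum_{n\ge0}\frac{(a_1)_n\cdots(a_p)_n}{(b_1)_n\cdots(b_q)_n}\frac{z^n}{n!}$; for $p=q+1$ it is continued analytically from $|z|<1$ to $\mathbb{C}\setminus[1,\infty)$. The map $\rho\mapsto-4\rho/(1-\rho)^2$ sends the unit disk bijectively onto $\mathbb{C}\setminus[1,\infty)$. Powers of $1-\rho$ are taken with the principal branch. The Wilson polynomials are $$W_n(x^2;a,b,c,d)=(a+b)_n(a+c)_n(a+d)_n\ {}_4F_3\!\left(\begin{matrix}-n,\ n+a+b+c+d-1,\ a+ix,\ a-ix\\ a+b,\ a+c,\ a+d\end{matrix};1\right).$$ *)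

theory Defs
  imports "HOL-Complex_Analysis.Complex_Analysis" "HOL-Library.Multiset"
begin

definition hypergeometric_series :: "complex list \<Rightarrow> complex list \<Rightarrow> complex \<Rightarrow> complex" where
  "hypergeometric_series as bs z =
     (\<Sum>n. (\<Prod>a\<leftarrow>as. pochhammer a n) / (\<Prod>b\<leftarrow>bs. pochhammer b n) * z ^ n / fact n)"

definition cut_plane :: "complex set" where
  "cut_plane = - (complex_of_real ` {1..})"

definition is_hypergeometric_continuation ::
    "complex list \<Rightarrow> complex list \<Rightarrow> (complex \<Rightarrow> complex) \<Rightarrow> bool" where
  "is_hypergeometric_continuation as bs f \<longleftrightarrow>
     f holomorphic_on cut_plane \<and> (\<forall>z\<in>ball 0 1. f z = hypergeometric_series as bs z)"

(* For p = q + 1, the value outside the unit disk and off the cut is that of the analytic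
   continuation, which is unique there (hypergeometric_eq_continuation below).
   Everywhere else, in particular for a terminating series at the point 1, it is the sum of the
   series. *)
definition hypergeometric :: "complex list \<Rightarrow> complex list \<Rightarrow> complex \<Rightarrow> complex" where
  "hypergeometric as bs z =
     (if length as = length bs + 1 \<and> z \<in> cut_plane - ball 0 1
      then (THE w. \<exists>f. is_hypergeometric_continuation as bs f \<and> w = f z)
      else hypergeometric_series as bs z)"

lemma open_cut_plane: "open cut_plane"
proof -
  have "complex_of_real ` {1..} = {z. Re z \<ge> 1} \<inter> {z. Im z = 0}"
    by (auto simp: image_iff complex_eq_iff)
  moreover have "closed ({z. Re z \<ge> 1} \<inter> {z. Im z = 0})"
    by (intro closed_Int closed_halfspace_Re_ge closed_halfspace_Im_eq)
  ultimately show ?thesis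
    by (metis cut_plane_def open_Compl)
qed

lemma ball_subset_cut_plane: "ball 0 1 \<subseteq> cut_plane"
  by (auto simp: cut_plane_def)

lemma connected_cut_plane: "connected cut_plane"
proof -
  have "starlike cut_plane"
    unfolding starlike_def
  proof (intro bexI ballI subsetI)
    show "0 \<in> cut_plane"
      by (auto simp: cut_plane_def)
  next
    fix z w assume z: "z \<in> cut_plane" and "w \<in> closed_segment 0 z"
    then obtain u :: real where u: "0 \<le> u" "u \<le> 1" "w = of_real u * z"
      by (auto simp: in_segment scaleR_conv_of_real)
    show "w \<in> cut_plane"
    proof (rule ccontr)
      assume "w \<notin> cut_plane"
      then obtain t where t: "t \<ge> 1" "w = of_real t"
        by (auto simp: cut_plane_def)
      with u have "u \<noteq> 0"
        by auto
      with u t have "z = of_real (t / u)"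
        by (simp add: field_simps)
      moreover have "t / u \<ge> 1"
        using u t \<open>u \<noteq> 0\<close> by (simp add: field_simps)
      ultimately have "z \<in> complex_of_real ` {1..}"
        by (metis atLeast_iff image_eqI)
      then show False
        using z by (simp add: cut_plane_def)
    qed
  qed
  then show ?thesis
    by (intro path_connected_imp_connected starlike_imp_path_connected)
qed

lemma hypergeometric_eq_continuation:
  assumes "length as = length bs + 1" "is_hypergeometric_continuation as bs f" "z \<in> cut_plane"
  shows "hypergeometric as bs z = f z"
proof (cases "z \<in> ball 0 1")
  case True
  then show ?thesis
    using assms by (auto simp: hypergeometric_def is_hypergeometric_continuation_def)
next
  case False
  have "g z = f z" if "is_hypergeometric_continuation as bs g" for g
  proof (rule analytic_continuation_open[of "ball 0 1" cut_plane g f])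
    show "g w = f w" if "w \<in> ball 0 1" for w
      using \<open>is_hypergeometric_continuation as bs g\<close> assms(2) that
      by (simp add: is_hypergeometric_continuation_def)
  qed (use that assms open_cut_plane connected_cut_plane ball_subset_cut_plane
       in \<open>simp_all add: is_hypergeometric_continuation_def\<close>)
  then have "(THE w. \<exists>f. is_hypergeometric_continuation as bs f \<and> w = f z) = f z"
    using assms(2) by (intro the_equality) blast+
  then show ?thesis
    using assms False by (simp add: hypergeometric_def)
qed

(* wilson n x a b c d is W_n(x^2; a, b, c, d): the argument is x, not x^2. *)
definition wilson ::
    "nat \<Rightarrow> complex \<Rightarrow> complex \<Rightarrow> complex \<Rightarrow> complex \<Rightarrow> complex \<Rightarrow> complex" where
  "wilson n x a b c d =
     pochhammer (a + b) n * pochhammer (a + c) n * pochhammer (a + d) n *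
     hypergeometric [- of_nat n, of_nat n + a + b + c + d - 1, a + \<i> * x, a - \<i> * x]
       [a + b, a + c, a + d] 1"

definition wilson_weight :: "complex \<Rightarrow> complex \<Rightarrow> complex \<Rightarrow> complex \<Rightarrow> real \<Rightarrow> real" where
  "wilson_weight a b c h x =
     (norm (Gamma (a + \<i> * x) * Gamma (b + \<i> * x) * Gamma (c + \<i> * x) * Gamma (h + \<i> * x) /
            Gamma (2 * \<i> * x)))\<^sup>2"

definition nonreal_in_conjugate_pairs :: "complex multiset \<Rightarrow> bool" where
  "nonreal_in_conjugate_pairs M \<longleftrightarrow> image_mset cnj M = M"

end

theory Submission
  imports Defs "HOL-Probability.Sinc_Integral"
begin

text \<open>
  Write \<open>s = a + b + c + d\<close> and \<open>p\<^sub>n = W\<^sub>n(x\<^sup>2;a,b,c,d) / ((a+b)\<^sub>n (a+c)\<^sub>n (a+d)\<^sub>n)\<close>. For small \<open>\<rho>\<close>,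
  rearranging a double series shows that the prefactor times the \<open>\<^sub>4F\<^sub>3\<close> is the generating function
  \<open>\<Sum>\<^sub>n (s-1)\<^sub>n / n! p\<^sub>n \<rho>\<^sup>n\<close>. Composed with the inverse of \<open>\<rho> \<mapsto> -4\<rho>/(1-\<rho>)\<^sup>2\<close>, this series also
  provides the continuation of the \<open>\<^sub>4F\<^sub>3\<close> to the cut plane wherever it converges on the whole disk, which
  is the case for almost every \<open>x\<close>: the integrals of \<open>|p\<^sub>n|\<^sup>2\<close> against the weight \<open>w\<^sub>d\<close> with parameters
  \<open>a,b,c,d\<close> are explicit and of polynomial growth in \<open>n\<close>. Together with the inequality
  \<open>|p\<^sub>n W\<^sub>k| w \<le> |p\<^sub>n|\<^sup>2 w\<^sub>d + |W\<^sub>k|\<^sup>2 w\<^sup>2 / w\<^sub>d\<close> this justifies integrating term by term.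

  Each term is evaluated by expanding \<open>p\<^sub>n\<close> in \<open>(a+ix)\<^sub>j (a-ix)\<^sub>j\<close> and \<open>W\<^sub>k\<close>, by its symmetry in \<open>a\<close> and \<open>b\<close>,
  in \<open>(b+ix)\<^sub>j (b-ix)\<^sub>j\<close>: these factors only shift parameters of the weight, so that the Wilson integral and
  Saalschuetz's theorem, applied twice, give the \<open>n\<close>-th term of the right-hand side.

  The Wilson integral itself follows from a contour shift, which relates the parameters \<open>a + 1\<close> and \<open>a\<close>,
  and from letting \<open>a + n\<close> tend to infinity.
\<close>

section \<open>Decay of the Gamma function on vertical lines\<close>

text \<open>The obstacle is the continued 4F3: its value is usable only once a continuation is
  exhibited, and for a fixed x convergence of the generating function on the whole disk would need
  the asymptotics of p_n(x). Square integrals replace these asymptotics, at the price of a null set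
  that the final integral does not see. This is where the conjugate pairs enter: they turn the
  kernel into a nonnegative weight, so that integrating W_n times its conjugate gives a squared
  norm. Of the Gamma function on vertical lines only the exponential rate pi/2 is used. Every bound
  gives up a small multiple of pi in the exponent, which absorbs all powers of x; the rational
  multiples of pi below are chosen so that the total remains negative. The quotient w^2 / w_d is
  harmless because exchanging d for h does not change the exponential rate. The kernel lives on the
  whole real line, as the contour shift does; evenness in x accounts for 4 pi there and 2 pi in the
  result.\<close>

lemma norm_pochhammer_ratio_mono:
  assumes "0 < s" "s \<le> s'"
  shows "pochhammer s n * norm (pochhammer (Complex s' t) n)
         \<le> pochhammer s' n * norm (pochhammer (Complex s t) n)"
proof -
  \<comment> \<open>Factor by factor, |s + k + it| / (s + k) = sqrt(1 + t^2 / (s + k)^2) decreases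
    in s.\<close>
  have "(s + real k) * norm (Complex s' t + of_nat k) \<le> (s' + real k) * norm (Complex s t + of_nat k)" for k
  proof (rule power2_le_imp_le)
    have "(s + real k)^2 \<le> (s' + real k)^2"
      using assms by (intro power_mono) auto
    then have "(s + real k)^2 * t^2 \<le> (s' + real k)^2 * t^2"
      by (rule mult_right_mono) simp
    then show "((s + real k) * norm (Complex s' t + of_nat k))\<^sup>2 \<le> ((s' + real k) * norm (Complex s t + of_nat k))\<^sup>2"
      by (simp add: power_mult_distrib cmod_power2) (simp add: algebra_simps)
  qed (use assms in simp)
  then have "(\<Prod>k<n. (s + real k) * norm (Complex s' t + of_nat k)) \<le> (\<Prod>k<n. (s' + real k) * norm (Complex s t + of_nat k))"
    using assms by (intro prod_mono) auto
  then show ?thesis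
    by (simp add: pochhammer_prod prod.distrib prod_norm atLeast0LessThan)
qed

text \<open>In Euler's limit formula the powers of n cancel from |Gamma(s + it)| / Gamma(s), which
  leaves quotients of Pochhammer symbols. The lemma carries bounds from one vertical line to
  another: upper bounds to the left, lower bounds to the right.\<close>

lemma norm_Gamma_ratio_mono:
  assumes "0 < s" "s \<le> s'"
  shows "norm (Gamma (Complex s t)) / Gamma s \<le> norm (Gamma (Complex s' t)) / Gamma s'"
proof (rule LIMSEQ_le)
  show "(\<lambda>n. norm (Gamma_series (Complex s t) n) / Gamma_series s n)
          \<longlonglongrightarrow> norm (Gamma (Complex s t)) / Gamma s"
       "(\<lambda>n. norm (Gamma_series (Complex s' t) n) / Gamma_series s' n)
          \<longlonglongrightarrow> norm (Gamma (Complex s' t)) / Gamma s'"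
    using assms by (auto intro!: tendsto_intros simp: Gamma_eq_zero_iff nonpos_Ints_def)
  have eq: "norm (Gamma_series (Complex r t) n) / Gamma_series r n
              = pochhammer r (n+1) / norm (pochhammer (Complex r t) (n+1))" if "r > 0" for r n
    using pochhammer_pos[OF that, of "n+1"]
    by (simp add: Gamma_series_def norm_mult norm_divide field_simps)
  have nz: "pochhammer (Complex r t) n \<noteq> 0" if "r > 0" for r n
    using that by (simp add: pochhammer_eq_0_iff) (auto simp: complex_eq_iff)
  show "\<exists>N. \<forall>n\<ge>N. norm (Gamma_series (Complex s t) n) / Gamma_series s n
                  \<le> norm (Gamma_series (Complex s' t) n) / Gamma_series s' n"
    unfolding eq[OF assms(1)] eq[OF less_le_trans[OF assms]]
    using norm_pochhammer_ratio_mono[OF assms] nz[OF assms(1)] nz[OF less_le_trans[OF assms]]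
    by (simp add: field_simps)
qed

lemma norm_Gamma_le_Gamma_Re:
  assumes "Re z > 0"
  shows "norm (Gamma z) \<le> Gamma (Re z)"
proof -
  have "norm (Gamma_series z n) \<le> Gamma_series (Re z) n" for n
  proof -
    have "pochhammer (Re z) m \<le> norm (pochhammer z m)" for m
      unfolding pochhammer_prod prod_norm[symmetric] using assms
      by (intro prod_mono) (auto intro!: order_trans[OF _ abs_Re_le_cmod])
    from this[of "n+1"] show ?thesis
      using pochhammer_pos[OF assms, of "n+1"]
      by (auto simp: Gamma_series_def norm_mult norm_divide intro!: divide_left_mono mult_pos_pos)
  qed
  then show ?thesis
    by (intro LIMSEQ_le[OF tendsto_norm[OF Gamma_series_LIMSEQ] Gamma_series_LIMSEQ]) blast
qed

text \<open>On this line the reflection formula pairs Gamma(1 + it) with its own conjugate Gamma(1 -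
  it), so the modulus is elementary. All exponential rates originate here, and at 2x it evaluates 1
  / |Gamma(2ix)|^2.\<close>

lemma norm_Gamma_Complex_1:
  assumes "t \<noteq> 0"
  shows "(norm (Gamma (Complex 1 t)))\<^sup>2 = pi * t / sinh (pi * t)"
proof -
  let ?z = "\<i> * of_real t :: complex"
  have c: "Complex 1 t = 1 + ?z" by (simp add: complex_eq_iff)
  have "?z \<notin> \<int>\<^sub>\<le>\<^sub>0"
    using assms by (auto simp: nonpos_Ints_def complex_eq_iff)
  then have "Gamma (1 + ?z) * Gamma (1 - ?z) = ?z * (Gamma ?z * Gamma (1 - ?z))"
    using Gamma_plus1[of ?z] by (simp add: add.commute)
  also have "\<dots> = ?z * of_real pi / sin (of_real pi * ?z)"
    using Gamma_reflection_complex[of ?z] by simp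
  also have "sin (of_real pi * ?z) = \<i> * of_real (sinh (pi * t))"
    using sin_i_times[of "of_real (pi * t)"]
    by (simp add: mult_ac sinh_field_def exp_minus flip: exp_of_real)
  finally have "Gamma (1 + ?z) * Gamma (1 - ?z) = of_real (pi * t / sinh (pi * t))"
    by (simp add: field_simps)
  moreover have "Gamma (1 - ?z) = cnj (Gamma (1 + ?z))"
    using cnj_Gamma[of "1 + ?z"] by simp
  ultimately have "of_real ((norm (Gamma (1 + ?z)))\<^sup>2) = (of_real (pi * t / sinh (pi * t)) :: complex)"
    by (metis complex_norm_square)
  then show ?thesis
    unfolding c using of_real_eq_iff by blast
qed

lemma norm_Gamma_Complex_1_bounds:
  shows "exp (- (pi / 2) * \<bar>t\<bar>) \<le> norm (Gamma (Complex 1 t))" (is ?L)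
    and "norm (Gamma (Complex 1 t)) \<le> (1 + 2 * pi * \<bar>t\<bar>) * exp (- (pi / 2) * \<bar>t\<bar>)" (is ?U)
proof -
  have "?L \<and> ?U"
  proof (cases "t = 0")
    case False
    \<comment> \<open>After squaring, both bounds concern e^(-u) sinh u = (1 - e^(-2u)) / 2, which
      has to lie between u / (1 + 2u)^2 and u.\<close>
    define u where "u = pi * \<bar>t\<bar>"
    have u: "u > 0" using False by (simp add: u_def)
    have sq: "(norm (Gamma (Complex 1 t)))\<^sup>2 = u / sinh u"
      unfolding norm_Gamma_Complex_1[OF False] u_def by (cases "t > 0") (auto simp: abs_if)
    have s: "sinh u > 0" using u by simp
    have e: "exp (-u) * exp (-u) = exp (-(2*u))" "exp (-u) * exp u = 1" by (simp_all flip: exp_add)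
    have "1 - exp (-(2*u)) \<le> 2 * u"
      using exp_ge_add_one_self[of "-(2*u)"] by simp
    then have l: "exp (-u) * sinh u \<le> u"
      unfolding sinh_field_def using e by (simp add: algebra_simps)
    have "(1 + 2*u) * exp (-(2*u)) \<le> 1"
      using exp_ge_add_one_self[of "2*u"] by (simp add: exp_minus field_simps)
    then have "u \<le> (1 + 2*u) * ((1 - exp (-(2*u)))/2)"
      by (simp add: field_simps)
    also have "\<dots> = (1 + 2*u) * exp (-u) * sinh u"
    proof -
      have "(1 - exp (-(2*u)))/2 = exp (-u) * sinh u"
        unfolding sinh_field_def using e by (simp add: algebra_simps)
      then show ?thesis by simp
    qed
    also have "\<dots> \<le> (1 + 2*u)^2 * exp (-u) * sinh u"
      using u s by (intro mult_right_mono) (auto simp: power2_eq_square)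
    finally have r: "u \<le> (1 + 2*u)^2 * exp (-u) * sinh u" .
    have h: "exp (-u) = (exp (-u/2))^2"
      by (simp add: power2_eq_square flip: exp_add)
    have "(exp (-u/2))^2 \<le> (norm (Gamma (Complex 1 t)))\<^sup>2"
      unfolding sq h[symmetric] using l s by (simp add: field_simps)
    then have "exp (-u/2) \<le> norm (Gamma (Complex 1 t))"
      by (rule power2_le_imp_le) simp
    moreover have "(norm (Gamma (Complex 1 t)))\<^sup>2 \<le> ((1 + 2*u) * exp (-u/2))^2"
      unfolding sq power_mult_distrib h[symmetric] using r s by (simp add: field_simps)
    then have "norm (Gamma (Complex 1 t)) \<le> (1 + 2*u) * exp (-u/2)"
      by (rule power2_le_imp_le) (use u in simp)
    ultimately show ?thesis by (simp add: u_def mult_ac)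
  qed (simp flip: one_complex.code)
  then show ?L ?U by auto
qed

text \<open>Pays for a linear factor with an arbitrarily small loss e in the exponent.\<close>

lemma abs_le_exp: "e > 0 \<Longrightarrow> \<bar>t::real\<bar> \<le> exp (e * \<bar>t\<bar>) / e"
  using exp_ge_add_one_self[of "e * \<bar>t\<bar>"] by (simp add: pos_le_divide_eq mult.commute del: exp_ge_add_one_self)

text \<open>Each step of the functional equation costs a factor |n + 1 + it|, which half of the
  remaining gap between \<delta> and pi/2 absorbs; hence \<delta> is generalised in the
  induction.\<close>

lemma norm_Gamma_nat_decay:
  "\<delta> < pi / 2 \<Longrightarrow> \<exists>C. \<forall>t. norm (Gamma (Complex (Suc n) t)) \<le> C * exp (- \<delta> * \<bar>t\<bar>)"
proof (induction n arbitrary: \<delta>)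
  case 0
  define e where "e = pi / 2 - \<delta>"
  have e: "e > 0" using 0 by (simp add: e_def)
  have "norm (Gamma (Complex (Suc 0) t)) \<le> (1 + 2 * pi / e) * exp (- \<delta> * \<bar>t\<bar>)" for t
  proof -
    have "1 \<le> exp (e * \<bar>t\<bar>)" using e by simp
    moreover have "2 * pi * \<bar>t\<bar> \<le> 2 * pi * (exp (e * \<bar>t\<bar>) / e)"
      using abs_le_exp[OF e, of t] by (intro mult_left_mono) auto
    ultimately have "1 + 2 * pi * \<bar>t\<bar> \<le> (1 + 2 * pi / e) * exp (e * \<bar>t\<bar>)"
      by (simp only: distrib_right mult_1_left times_divide_eq_left times_divide_eq_right)
    then have "(1 + 2 * pi * \<bar>t\<bar>) * exp (- (pi / 2) * \<bar>t\<bar>) \<le> (1 + 2 * pi / e) * exp (e * \<bar>t\<bar>) * exp (- (pi / 2) * \<bar>t\<bar>)"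
      by (rule mult_right_mono) simp
    also have "\<dots> = (1 + 2 * pi / e) * exp (- \<delta> * \<bar>t\<bar>)"
      by (simp add: e_def algebra_simps flip: exp_add)
    finally show ?thesis
      using norm_Gamma_Complex_1_bounds(2)[of t] by simp
  qed
  then show ?case by blast
next
  case (Suc n)
  define e where "e = (pi / 2 - \<delta>) / 2"
  have e: "e > 0" using Suc.prems by (simp add: e_def)
  have "\<delta> + e < pi / 2" using Suc.prems by (simp add: e_def field_simps)
  from Suc.IH[OF this] obtain C where C: "\<And>t. norm (Gamma (Complex (Suc n) t)) \<le> C * exp (- (\<delta> + e) * \<bar>t\<bar>)" by blast
  have "norm (Gamma (Complex (Suc (Suc n)) t)) \<le> ((real (Suc n) + 1 / e) * C) * exp (- \<delta> * \<bar>t\<bar>)" for t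
  proof -
    have "Complex (Suc n) t \<notin> \<int>\<^sub>\<le>\<^sub>0" by (auto simp: nonpos_Ints_def complex_eq_iff)
    moreover have "Complex (Suc (Suc n)) t = Complex (Suc n) t + 1" by (simp add: complex_eq_iff)
    ultimately have "norm (Gamma (Complex (Suc (Suc n)) t)) = norm (Complex (Suc n) t) * norm (Gamma (Complex (Suc n) t))"
      by (metis Gamma_plus1 norm_mult)
    also have "norm (Complex (Suc n) t) \<le> real (Suc n) + \<bar>t\<bar>"
      using cmod_le[of "Complex (Suc n) t"] by simp
    also have "\<dots> \<le> real (Suc n) * exp (e * \<bar>t\<bar>) + exp (e * \<bar>t\<bar>) / e"
    proof (intro add_mono abs_le_exp e)
      show "real (Suc n) \<le> real (Suc n) * exp (e * \<bar>t\<bar>)" using e by simp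
    qed
    also have "\<dots> = (real (Suc n) + 1 / e) * exp (e * \<bar>t\<bar>)" by (simp add: algebra_simps)
    finally have "norm (Gamma (Complex (Suc (Suc n)) t)) \<le> ((real (Suc n) + 1 / e) * exp (e * \<bar>t\<bar>)) * norm (Gamma (Complex (Suc n) t))"
      by (simp add: mult_right_mono)
    also have "\<dots> \<le> ((real (Suc n) + 1 / e) * exp (e * \<bar>t\<bar>)) * (C * exp (- (\<delta> + e) * \<bar>t\<bar>))"
      using e by (intro mult_left_mono C) auto
    also have "\<dots> = ((real (Suc n) + 1 / e) * C) * (exp (e * \<bar>t\<bar>) * exp (- (\<delta> + e) * \<bar>t\<bar>))" by simp
    also have "exp (e * \<bar>t\<bar>) * exp (- (\<delta> + e) * \<bar>t\<bar>) = exp (- \<delta> * \<bar>t\<bar>)"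
      by (simp add: algebra_simps flip: exp_add)
    finally show ?thesis .
  qed
  then show ?case by blast
qed

text \<open>Every point of the strip is compared with the point at the same height on an integer
  line to its right, and the real Gamma function is bounded on the compact interval. This makes the
  constant uniform.\<close>

lemma norm_Gamma_decay:
  assumes "0 < s0" "\<delta> < pi / 2"
  shows "\<exists>C>0. \<forall>z. s0 \<le> Re z \<and> Re z \<le> s1 \<longrightarrow> norm (Gamma z) \<le> C * exp (- \<delta> * \<bar>Im z\<bar>)"
proof -
  obtain n where n: "s1 \<le> real (Suc n)" using real_arch_simple[of s1] by (meson le_SucI of_nat_mono order_trans le_refl)
  obtain C where C: "\<And>t. norm (Gamma (Complex (Suc n) t)) \<le> C * exp (- \<delta> * \<bar>t\<bar>)"
    using norm_Gamma_nat_decay[OF assms(2)] by blast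
  have C0: "C \<ge> 0" using order_trans[OF norm_ge_zero C[of 0]] by simp
  have "continuous_on {s0..s1} (Gamma :: real \<Rightarrow> real)"
    using assms by (intro continuous_intros) (auto simp: nonpos_Ints_def)
  from compact_imp_bounded[OF compact_continuous_image[OF this]]
  obtain B where B: "\<forall>s\<in>{s0..s1}. norm (Gamma s) \<le> B" "B > 0"
    by (auto simp: bounded_pos)
  have "norm (Gamma z) \<le> (B * C / Gamma (Suc n) + 1) * exp (- \<delta> * \<bar>Im z\<bar>)" if z: "s0 \<le> Re z" "Re z \<le> s1" for z
  proof -
    have p: "Re z > 0" "Gamma (Re z) > 0" using z assms by auto
    have g: "Gamma (real (Suc n)) > 0" by (intro Gamma_real_pos) simp
    have "norm (Gamma (Complex (Re z) (Im z))) / Gamma (Re z) \<le> norm (Gamma (Complex (Suc n) (Im z))) / Gamma (real (Suc n))"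
      using p n z by (intro norm_Gamma_ratio_mono) auto
    then have "norm (Gamma z) \<le> Gamma (Re z) * norm (Gamma (Complex (Suc n) (Im z))) / Gamma (real (Suc n))"
      using p by (simp add: field_simps)
    also have "\<dots> \<le> B * (C * exp (- \<delta> * \<bar>Im z\<bar>)) / Gamma (real (Suc n))"
      using B(1)[rule_format, of "Re z"] z p g B(2) C by (intro divide_right_mono mult_mono) auto
    also have "\<dots> \<le> (B * C / Gamma (Suc n) + 1) * exp (- \<delta> * \<bar>Im z\<bar>)"
      by (simp add: algebra_simps)
    finally show ?thesis .
  qed
  moreover have "B * C / Gamma (Suc n) + 1 > 0"
    using B(2) C0 by (intro add_nonneg_pos divide_nonneg_nonneg mult_nonneg_nonneg) (auto intro: Gamma_real_nonneg)
  ultimately show ?thesis by blast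
qed

text \<open>The imaginary part of z displaces the height by at most |Im z|, which only changes the
  constant.\<close>

lemma norm_Gamma_decay_line:
  assumes "Re z > 0" "\<delta> < pi / 2" "\<delta> \<ge> 0"
  shows "\<exists>C>0. \<forall>x. norm (Gamma (z + \<i> * of_real x)) \<le> C * exp (- \<delta> * \<bar>x\<bar>)
                  \<and> norm (Gamma (z - \<i> * of_real x)) \<le> C * exp (- \<delta> * \<bar>x\<bar>)"
proof -
  obtain C where C: "C > 0" "\<And>w. Re w = Re z \<Longrightarrow> norm (Gamma w) \<le> C * exp (- \<delta> * \<bar>Im w\<bar>)"
    using norm_Gamma_decay[OF assms(1,2), of "Re z"] by auto
  have "norm (Gamma w) \<le> (C * exp (\<delta> * \<bar>Im z\<bar>)) * exp (- \<delta> * \<bar>x\<bar>)" if "Re w = Re z" "\<bar>x\<bar> \<le> \<bar>Im w\<bar> + \<bar>Im z\<bar>" for w x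
  proof -
    have "- \<delta> * \<bar>Im w\<bar> \<le> \<delta> * \<bar>Im z\<bar> + - \<delta> * \<bar>x\<bar>"
      using mult_left_mono[OF that(2) assms(3)] by (simp add: algebra_simps)
    then have "C * exp (- \<delta> * \<bar>Im w\<bar>) \<le> C * exp (\<delta> * \<bar>Im z\<bar> + - \<delta> * \<bar>x\<bar>)"
      using C(1) by (intro mult_left_mono) auto
    with C(2)[OF that(1)] show ?thesis unfolding exp_add mult.assoc by linarith
  qed
  then show ?thesis using C(1) by (intro exI[of _ "C * exp (\<delta> * \<bar>Im z\<bar>)"]) auto
qed

text \<open>Monotonicity carries lower bounds to the right only, so the argument w is first raised
  by 1, past the line Re = 1. Dividing by |w| afterwards uses up the excess e of the rate over
  pi/2.\<close>

lemma norm_Gamma_lower_line: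
  assumes "Re z > 0" "\<delta> > pi / 2"
  shows "\<exists>c>0. \<forall>x. norm (Gamma (z + \<i> * of_real x)) \<ge> c * exp (- \<delta> * \<bar>x\<bar>)"
proof -
  define e where "e = \<delta> - pi / 2"
  have e: "e > 0" using assms by (simp add: e_def)
  define s where "s = Re z"
  define K where "K = s + \<bar>Im z\<bar> + 1 / e"
  have K: "K > 0" using assms e by (simp add: K_def s_def add_pos_nonneg)
  define c where "c = Gamma (s + 1) * exp (- (pi/2) * \<bar>Im z\<bar>) / K"
  have c: "c > 0" using K assms by (simp add: c_def s_def)
  have "norm (Gamma (z + \<i> * of_real x)) \<ge> c * exp (- \<delta> * \<bar>x\<bar>)" for x
  proof -
    let ?w = "z + \<i> * of_real x"
    have "?w \<notin> \<int>\<^sub>\<le>\<^sub>0" "?w \<noteq> 0" using assms by (auto simp: nonpos_Ints_def complex_eq_iff)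
    then have G: "norm (Gamma ?w) = norm (Gamma (?w + 1)) / norm ?w"
      by (simp add: Gamma_plus1 norm_mult)
    have "norm (Gamma (Complex 1 (Im ?w))) / Gamma 1 \<le> norm (Gamma (Complex (s + 1) (Im ?w))) / Gamma (s + 1)"
      using assms by (intro norm_Gamma_ratio_mono) (auto simp: s_def)
    moreover have "Complex (s + 1) (Im ?w) = ?w + 1" by (simp add: complex_eq_iff s_def)
    moreover have "Gamma (s + 1) > 0" using assms by (auto simp: s_def)
    ultimately have "norm (Gamma (Complex 1 (Im ?w))) * Gamma (s + 1) \<le> norm (Gamma (?w + 1))"
      by (simp add: field_simps)
    moreover have "exp (- (pi/2) * \<bar>Im z\<bar>) * exp (- (pi/2) * \<bar>x\<bar>) \<le> exp (- (pi/2) * \<bar>Im ?w\<bar>)"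
      using abs_triangle_ineq[of "Im z" x] mult_left_mono[of "\<bar>Im ?w\<bar>" "\<bar>Im z\<bar> + \<bar>x\<bar>" "pi/2"]
      by (simp add: algebra_simps flip: exp_add)
    ultimately have 1: "exp (- (pi/2) * \<bar>Im z\<bar>) * exp (- (pi/2) * \<bar>x\<bar>) * Gamma (s + 1) \<le> norm (Gamma (?w + 1))"
      using norm_Gamma_Complex_1_bounds(1)[of "Im ?w"] \<open>Gamma (s + 1) > 0\<close>
      by (smt (verit) mult_right_mono)
    have "norm ?w \<le> s + \<bar>Im z\<bar> + \<bar>x\<bar>"
      using cmod_le[of ?w] assms by (simp add: s_def)
    also have "\<dots> \<le> (s + \<bar>Im z\<bar>) * exp (e * \<bar>x\<bar>) + exp (e * \<bar>x\<bar>) / e"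
    proof (intro add_mono abs_le_exp e)
      have "s + \<bar>Im z\<bar> \<ge> 0" using assms by (simp add: s_def)
      then show "s + \<bar>Im z\<bar> \<le> (s + \<bar>Im z\<bar>) * exp (e * \<bar>x\<bar>)" using e by (simp add: mult_le_cancel_left1)
    qed
    also have "\<dots> = K * exp (e * \<bar>x\<bar>)" by (simp add: K_def algebra_simps)
    finally have 2: "norm ?w \<le> K * exp (e * \<bar>x\<bar>)" .
    have "c * exp (- \<delta> * \<bar>x\<bar>) = exp (- (pi/2) * \<bar>Im z\<bar>) * exp (- (pi/2) * \<bar>x\<bar>) * Gamma (s + 1) / (K * exp (e * \<bar>x\<bar>))"
    proof -
      have "exp (- \<delta> * \<bar>x\<bar>) = exp (- (pi/2) * \<bar>x\<bar>) / exp (e * \<bar>x\<bar>)"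
        by (simp add: e_def algebra_simps flip: exp_diff)
      then show ?thesis by (simp add: c_def)
    qed
    also have "\<dots> \<le> norm (Gamma (?w + 1)) / norm ?w"
      using 1 2 K \<open>?w \<noteq> 0\<close> \<open>Gamma (s + 1) > 0\<close> by (intro frac_le) auto
    finally show ?thesis unfolding G .
  qed
  with c show ?thesis by blast
qed

section \<open>Saalschuetz's theorem\<close>

lemma sum_binomial_Suc:
  fixes h :: "nat \<Rightarrow> 'a :: comm_ring_1"
  shows "(\<Sum>j\<le>Suc n. of_nat (Suc n choose j) * h j) = (\<Sum>j\<le>n. of_nat (n choose j) * (h j + h (Suc j)))"
proof -
  have "(\<Sum>j\<le>Suc n. of_nat (Suc n choose j) * h j)
        = h 0 + (\<Sum>j\<le>n. of_nat (n choose Suc j) * h (Suc j)) + (\<Sum>j\<le>n. of_nat (n choose j) * h (Suc j))"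
    unfolding sum.atMost_Suc_shift by (simp add: algebra_simps sum.distrib)
  also have "h 0 + (\<Sum>j\<le>n. of_nat (n choose Suc j) * h (Suc j)) = (\<Sum>j\<le>Suc n. of_nat (n choose j) * h j)"
    unfolding sum.atMost_Suc_shift by simp
  also have "\<dots> = (\<Sum>j\<le>n. of_nat (n choose j) * h j)"
    by (simp add: binomial_eq_0)
  finally show ?thesis
    by (simp add: sum.distrib distrib_left)
qed

text \<open>With denominators cleared, the sum satisfies S(n + 1) = (C - A + n)(C - B + n) S(n),
  because termwise the difference of the two sides telescopes.\<close>

lemma saalschuetz_binomial:
  fixes A B C :: "'a :: field_char_0"
  assumes "pochhammer C n \<noteq> 0"
  shows "(\<Sum>j\<le>n. of_nat (n choose j) * (pochhammer A j * pochhammer B j *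
             pochhammer (C + of_nat j) (n - j) * pochhammer (C - A - B) (n - j)))
         = pochhammer (C - A) n * pochhammer (C - B) n"
  using assms
proof (induction n)
  case (Suc n)
  define E where "E = C - A - B"
  have C0: "C + of_nat j \<noteq> 0" if "j \<le> n" for j
    using Suc.prems that by (auto simp: pochhammer_eq_0_iff add_eq_0_iff2)
  have IH: "(\<Sum>j\<le>n. of_nat (n choose j) * (pochhammer A j * pochhammer B j *
             pochhammer (C + of_nat j) (n - j) * pochhammer E (n - j)))
         = pochhammer (C - A) n * pochhammer (C - B) n"
    unfolding E_def using Suc.prems by (intro Suc.IH) (simp add: pochhammer_Suc)
  define h where "h j = pochhammer A j * pochhammer B j *
             pochhammer (C + of_nat j) (Suc n - j) * pochhammer E (Suc n - j)" for j
  define F where "F j = of_nat (n choose j) * (pochhammer A j * pochhammer B j *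
             pochhammer (C + of_nat j) (n - j) * pochhammer E (n - j))" for j
  \<comment> \<open>The telescoping certificate for the first-order recurrence in \<open>n\<close>, as Zeilberger's algorithm finds it.\<close>
  define G where "G j = of_nat j * (E + of_nat n - of_nat j) * F j" for j
  have G_Suc: "G (Suc j) = (of_nat n - of_nat j) * (A + of_nat j) * (B + of_nat j) * F j / (C + of_nat j)"
    if "j \<le> n" for j
  proof (cases "j = n")
    case False
    with that have "j < n" by simp
    then obtain m where m: "n = Suc (j + m)" using less_imp_Suc_add by blast
    have "of_nat (Suc j) * of_nat (n choose Suc j) = (of_nat (n - j) * of_nat (n choose j) :: 'a)"
      using binomial_absorb_comp[of n j] by (metis binomial_absorption of_nat_mult)
    then have b: "of_nat (Suc j) * of_nat (n choose Suc j) = (of_nat n - of_nat j) * (of_nat (n choose j) :: 'a)"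
      using that by (simp add: of_nat_diff)
    have "G (Suc j) = (of_nat (Suc j) * of_nat (n choose Suc j)) * (E + of_nat m) *
            (pochhammer A (Suc j) * pochhammer B (Suc j) * pochhammer (C + of_nat (Suc j)) m * pochhammer E m)"
      unfolding G_def F_def by (simp add: m mult_ac)
    also have "\<dots> = (of_nat n - of_nat j) * (of_nat (n choose j)) * ((A + of_nat j) * (B + of_nat j)) *
            (pochhammer A j * pochhammer B j * pochhammer (C + of_nat (Suc j)) m * pochhammer E (Suc m))"
      unfolding b by (simp add: pochhammer_Suc)
    also have "pochhammer (C + of_nat (Suc j)) m = pochhammer (C + of_nat j) (Suc m) / (C + of_nat j)"
      using C0[OF that] by (simp add: pochhammer_rec add_ac)
    finally show ?thesis
      using C0[OF that] by (simp add: F_def m mult_ac Suc_diff_le)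
  qed (simp add: G_def F_def)
  have step: "of_nat (n choose j) * (h j + h (Suc j))
              = (C - A + of_nat n) * (C - B + of_nat n) * F j + (G (Suc j) - G j)" if "j \<le> n" for j
  proof -
    define f where "f = of_nat (n choose j) * (pochhammer A j * pochhammer B j * pochhammer E (n - j))"
    define Z where "Z = pochhammer (C + of_nat j) (n - j)"
    define x where "x = (of_nat j :: 'a)"
    define N where "N = (of_nat n :: 'a)"
    have Cx: "C + x \<noteq> 0" using C0[OF that] by (simp add: x_def)
    have Z1: "pochhammer (C + of_nat j) (Suc (n - j)) = Z * (C + N)"
      using that by (simp add: pochhammer_Suc Z_def N_def of_nat_diff)
    have "(C + x) * pochhammer (C + of_nat j + 1) (n - j) = Z * (C + N)"
      using Z1 by (simp add: pochhammer_rec x_def)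
    then have Z2: "pochhammer (C + of_nat (Suc j)) (n - j) = Z * (C + N) / (C + x)"
      using Cx by (simp add: field_simps)
    have h1: "of_nat (n choose j) * h j = f * (Z * (C + N)) * (E + N - x)"
      unfolding h_def Suc_diff_le[OF that] Z1 pochhammer_Suc[of E]
      using that by (simp add: f_def of_nat_diff N_def x_def mult_ac add_diff_eq)
    have h2: "of_nat (n choose j) * h (Suc j) = f * (A + x) * (B + x) * (Z * (C + N) / (C + x))"
      unfolding h_def Z2 diff_Suc_Suc by (simp add: f_def x_def pochhammer_Suc mult_ac)
    have Fj: "F j = f * Z" by (simp add: F_def f_def Z_def mult_ac)
    show ?thesis
      unfolding G_Suc[OF that] distrib_left h1 h2
      unfolding G_def Fj x_def[symmetric] N_def[symmetric]
      using Cx by (simp add: divide_simps) (simp add: E_def algebra_simps)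
  qed
  have "(\<Sum>j\<le>Suc n. of_nat (Suc n choose j) * h j) = (\<Sum>j\<le>n. of_nat (n choose j) * (h j + h (Suc j)))"
    by (rule sum_binomial_Suc)
  also have "\<dots> = (\<Sum>j\<le>n. (C - A + of_nat n) * (C - B + of_nat n) * F j + (G (Suc j) - G j))"
    by (intro sum.cong refl step) simp
  also have "\<dots> = (C - A + of_nat n) * (C - B + of_nat n) * (\<Sum>j\<le>n. F j) + (\<Sum>j\<le>n. G (Suc j) - G j)"
    by (simp add: sum.distrib sum_distrib_left)
  also have "(\<Sum>j\<le>n. G (Suc j) - G j) = G (Suc n) - G 0"
    by (rule sum_Suc_diff'[of 0 "Suc n", simplified atLeast0LessThan lessThan_Suc_atMost]) simp
  \<comment> \<open>The factor j kills the lower end, and n choose n + 1 kills the upper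
    one.\<close>
  also have "G (Suc n) - G 0 = 0"
    by (simp add: G_def F_def)
  also have "(\<Sum>j\<le>n. F j) = pochhammer (C - A) n * pochhammer (C - B) n"
    unfolding F_def by (rule IH)
  finally show ?case
    by (simp add: h_def E_def pochhammer_Suc mult_ac)
qed simp

lemma pochhammer_minus_of_nat:
  "pochhammer (- of_nat n) j = (- 1) ^ j * fact j * (of_nat (n choose j) :: 'a :: field_char_0)"
  by (simp add: binomial_gbinomial gbinomial_pochhammer)

text \<open>\<open>D\<close> is determined by the other parameters; it is a variable so that instances
  need not match one particular way of writing it.\<close>
theorem saalschuetz:
  fixes A B C D :: "'a :: field_char_0"
  assumes D: "D = 1 + A + B - C - of_nat n"
    and nz: "pochhammer C n \<noteq> 0" "pochhammer D n \<noteq> 0"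
  shows "(\<Sum>j\<le>n. pochhammer (- of_nat n) j * pochhammer A j * pochhammer B j
             / (fact j * pochhammer C j * pochhammer D j))
         = (- 1) ^ n * pochhammer (C - A) n * pochhammer (C - B) n / (pochhammer C n * pochhammer D n)"
proof -
  have "pochhammer (- of_nat n) j * pochhammer A j * pochhammer B j / (fact j * pochhammer C j * pochhammer D j)
        = (- 1) ^ n / (pochhammer C n * pochhammer D n) * (of_nat (n choose j) * (pochhammer A j * pochhammer B j *
             pochhammer (C + of_nat j) (n - j) * pochhammer (C - A - B) (n - j)))"
    if "j \<le> n" for j
  proof -
    have C: "pochhammer C n = pochhammer C j * pochhammer (C + of_nat j) (n - j)"
      and D': "pochhammer D n = pochhammer D j * pochhammer (D + of_nat j) (n - j)"
      using that by (simp_all add: pochhammer_product)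
    \<comment> \<open>Here C - A - B = 1 - n - D, so reading the product backwards gives the tail of
      (D)_n up to sign.\<close>
    have "pochhammer (C - A - B) (n - j) = (- 1) ^ (n - j) * pochhammer (D + of_nat j) (n - j)"
      using pochhammer_minus[of "A + B - C" "n - j"] that
      by (simp add: D of_nat_diff algebra_simps)
    moreover have "(-1) ^ n = (-1) ^ (n - j) * (-1 :: 'a) ^ j"
      using that by (simp flip: power_add)
    moreover have "(-1) ^ (n - j) * (-1) ^ (n - j) = (1 :: 'a)"
      by (simp flip: power_mult_distrib)
    ultimately show ?thesis
      using nz unfolding C D' pochhammer_minus_of_nat by (simp add: divide_simps)
  qed
  then have "(\<Sum>j\<le>n. pochhammer (- of_nat n) j * pochhammer A j * pochhammer B j
             / (fact j * pochhammer C j * pochhammer D j))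
      = (- 1) ^ n / (pochhammer C n * pochhammer D n) * (\<Sum>j\<le>n. of_nat (n choose j) * (pochhammer A j * pochhammer B j *
             pochhammer (C + of_nat j) (n - j) * pochhammer (C - A - B) (n - j)))"
    unfolding sum_distrib_left by (intro sum.cong) auto
  then show ?thesis
    using saalschuetz_binomial[OF nz(1), of A B] by simp
qed

section \<open>The Wilson integral\<close>

lemma integrable_exp_abs:
  fixes e :: real
  assumes "e > 0"
  shows "integrable lborel (\<lambda>x. exp (- e * \<bar>x\<bar>))"
proof -
  let ?g = "\<lambda>x::real. indicator {0<..} x *\<^sub>R exp (- (x * e))"
  have 1: "integrable lborel ?g"
    using integrable_I0i_exp_mscale[OF assms] by (simp add: set_integrable_def)
  have 2: "integrable lborel (\<lambda>x. ?g (0 + (-1) * x))"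
    using 1 by (subst lborel_integrable_real_affine_iff) auto
  have "integrable lborel (\<lambda>x. ?g x + ?g (0 + (-1) * x))"
    by (rule Bochner_Integration.integrable_add[OF 1 2])
  then show ?thesis
  proof (rule integrable_cong_AE_imp)
    show "AE x in lborel. ?g x + ?g (0 + (-1) * x) = exp (- e * \<bar>x\<bar>)"
      using AE_lborel_singleton[of 0]
      by eventually_elim (auto simp: indicator_def mult.commute)
  qed measurable
qed

lemma integrable_exp_bound:
  fixes f :: "real \<Rightarrow> 'a :: {banach, second_countable_topology}"
  assumes "continuous_on UNIV f" "e > 0" "\<And>x. norm (f x) \<le> C * exp (- e * \<bar>x\<bar>)"
  shows "integrable lborel f"
proof (rule Bochner_Integration.integrable_bound)
  show "integrable lborel (\<lambda>x. C * exp (- e * \<bar>x\<bar>))"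
    by (intro integrable_mult_right integrable_exp_abs assms)
  show "AE x in lborel. norm (f x) \<le> norm (C * exp (- e * \<bar>x\<bar>))"
    by (intro AE_I2) (metis assms(3) abs_ge_self order_trans real_norm_def)
qed (use assms(1) in \<open>simp add: borel_measurable_continuous_onI\<close>)

lemma integral_FTC_UNIV:
  fixes f F :: "real \<Rightarrow> 'a :: euclidean_space"
  assumes "\<And>x. (F has_vector_derivative f x) (at x)" "continuous_on UNIV f" "integrable lborel f"
    and "(F \<longlongrightarrow> A) at_bot" "(F \<longlongrightarrow> B) at_top"
  shows "integral\<^sup>L lborel f = B - A"
proof -
  have "(LBINT x=-\<infinity>..\<infinity>. f x) = B - A"
    using assms
    by (intro interval_integral_FTC_integrable[of _ _ F])
       (auto simp: ereal_tendsto_simps1 set_integrable_def continuous_on_eq_continuous_at)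
  then show ?thesis
    by (simp add: interval_lebesgue_integral_def set_lebesgue_integral_def)
qed

definition gamma_pair :: "complex \<Rightarrow> real \<Rightarrow> complex" where
  "gamma_pair a x = Gamma (a + \<i> * of_real x) * Gamma (a - \<i> * of_real x)"

text \<open>This is \<open>1 / |\<Gamma>(2ix)|\<^sup>2\<close>, written without a Gamma function so that it makes sense at \<open>x = 0\<close>.\<close>
definition wilson_factor :: "real \<Rightarrow> real" where
  "wilson_factor x = 2 * x * sinh (2 * pi * x) / pi"

text \<open>Analytic in the parameters, unlike the weight \<open>w\<close>; the two agree for \<open>x > 0\<close> when the
  non-real parameters come in conjugate pairs.\<close>
definition wilson_kernel :: "complex \<Rightarrow> complex \<Rightarrow> complex \<Rightarrow> complex \<Rightarrow> real \<Rightarrow> complex" where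
  "wilson_kernel a b c d x =
     gamma_pair a x * gamma_pair b x * gamma_pair c x * gamma_pair d x * of_real (wilson_factor x)"

lemma Re_pos_not_nonpos_Int: "Re z > 0 \<Longrightarrow> z \<notin> \<int>\<^sub>\<le>\<^sub>0"
  by (auto simp: nonpos_Ints_def)

lemma continuous_gamma_pair [continuous_intros]:
  "Re a > 0 \<Longrightarrow> continuous_on UNIV (gamma_pair a)"
  unfolding gamma_pair_def[abs_def] by (intro continuous_on_mult continuous_on_compose2[OF continuous_on_Gamma[of "{z. Re z > 0}"]] continuous_intros)
     (auto simp: Re_pos_not_nonpos_Int)

lemma continuous_wilson_factor [continuous_intros]: "continuous_on UNIV wilson_factor"
  unfolding wilson_factor_def by (intro continuous_intros) auto

text \<open>The true rate is pi. The loss pi/6 is small enough for three pairs, of total rate 5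
  pi/2, to dominate \<open>wilson_factor\<close> at its rate 13 pi/6.\<close>

lemma norm_gamma_pair_le:
  assumes "Re a > 0"
  shows "\<exists>C>0. \<forall>x. norm (gamma_pair a x) \<le> C * exp (- (5 * pi / 6) * \<bar>x\<bar>)"
proof -
  obtain C where C: "C > 0" "\<And>x. norm (Gamma (a + \<i> * of_real x)) \<le> C * exp (- (5 * pi / 12) * \<bar>x\<bar>)"
      "\<And>x. norm (Gamma (a - \<i> * of_real x)) \<le> C * exp (- (5 * pi / 12) * \<bar>x\<bar>)"
    using norm_Gamma_decay_line[OF assms, of "5 * pi / 12"] by auto
  have "norm (gamma_pair a x) \<le> (C * C) * exp (- (5 * pi / 6) * \<bar>x\<bar>)" for x
  proof -
    have "norm (gamma_pair a x) \<le> (C * exp (- (5 * pi / 12) * \<bar>x\<bar>)) * (C * exp (- (5 * pi / 12) * \<bar>x\<bar>))"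
      unfolding gamma_pair_def norm_mult using C by (intro mult_mono) auto
    also have "\<dots> = (C * C) * exp (- (5 * pi / 6) * \<bar>x\<bar>)"
      by (simp flip: exp_add)
    finally show ?thesis .
  qed
  with C(1) show ?thesis by (intro exI[of _ "C * C"]) auto
qed

lemma wilson_factor_nonneg: "wilson_factor x \<ge> 0"
  by (cases "x \<ge> 0") (auto simp: wilson_factor_def zero_le_mult_iff mult_nonneg_nonpos)

lemma wilson_factor_pos: "x \<noteq> 0 \<Longrightarrow> wilson_factor x > 0"
  by (cases "x > 0") (auto simp: wilson_factor_def zero_less_mult_iff mult_pos_neg)

lemma abs_sinh_le: "\<bar>sinh x\<bar> \<le> exp \<bar>x::real\<bar>"
proof -
  have "sinh y \<le> exp y" if "y \<ge> 0" for y :: real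
  proof -
    have "sinh y \<le> exp y / 2" "exp y / 2 \<le> exp y" by (simp_all add: sinh_field_def)
    then show ?thesis by (rule order_trans)
  qed
  from this[of "\<bar>x\<bar>"] show ?thesis by (cases "x \<ge> 0") (auto simp: abs_if)
qed

text \<open>13 pi/6 = 2 pi + pi/6: the first part comes from sinh, the second absorbs the factor
  x.\<close>

lemma wilson_factor_le:
  "\<exists>C>0. \<forall>x. \<bar>wilson_factor x\<bar> \<le> C * exp ((13 * pi / 6) * \<bar>x\<bar>)"
proof -
  have "\<bar>wilson_factor x\<bar> \<le> 12 / pi^2 * exp ((13 * pi / 6) * \<bar>x\<bar>)" for x
  proof -
    have "\<bar>wilson_factor x\<bar> = 2 / pi * \<bar>x\<bar> * \<bar>sinh (2 * pi * x)\<bar>"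
      by (simp add: wilson_factor_def abs_mult)
    also have "\<dots> \<le> 2 / pi * (exp (pi/6 * \<bar>x\<bar>) / (pi/6)) * exp \<bar>2 * pi * x\<bar>"
      by (intro mult_mono abs_le_exp abs_sinh_le) auto
    also have "\<dots> = 12 / pi^2 * (exp (pi/6 * \<bar>x\<bar>) * exp \<bar>2 * pi * x\<bar>)"
      by (simp add: power2_eq_square)
    also have "exp (pi/6 * \<bar>x\<bar>) * exp \<bar>2 * pi * x\<bar> = exp ((13 * pi / 6) * \<bar>x\<bar>)"
      by (simp add: abs_mult algebra_simps flip: exp_add)
    finally show ?thesis .
  qed
  then show ?thesis by (intro exI[of _ "12 / pi^2"]) auto
qed

text \<open>Three pairs must be integrable on their own, because the parameter of the fourth is sent
  to infinity when the Wilson integral is evaluated. The rate is 3 * 5 pi/6 - 13 pi/6 =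
  pi/3.\<close>

lemma norm_triple_kernel_le:
  assumes "Re b > 0" "Re c > 0" "Re d > 0"
  shows "\<exists>C>0. \<forall>x. norm (gamma_pair b x * gamma_pair c x * gamma_pair d x * of_real (wilson_factor x))
                   \<le> C * exp (- (pi / 3) * \<bar>x\<bar>)"
proof -
  obtain B C D F where le: "B > 0" "C > 0" "D > 0" "F > 0"
    "\<And>x. norm (gamma_pair b x) \<le> B * exp (- (5 * pi / 6) * \<bar>x\<bar>)"
    "\<And>x. norm (gamma_pair c x) \<le> C * exp (- (5 * pi / 6) * \<bar>x\<bar>)"
    "\<And>x. norm (gamma_pair d x) \<le> D * exp (- (5 * pi / 6) * \<bar>x\<bar>)"
    "\<And>x. \<bar>wilson_factor x\<bar> \<le> F * exp ((13 * pi / 6) * \<bar>x\<bar>)"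
    using norm_gamma_pair_le assms wilson_factor_le by metis
  have "norm (gamma_pair b x * gamma_pair c x * gamma_pair d x * of_real (wilson_factor x))
          \<le> (B * C * D * F) * exp (- (pi / 3) * \<bar>x\<bar>)" for x
  proof -
    have "norm (gamma_pair b x * gamma_pair c x * gamma_pair d x * of_real (wilson_factor x))
       \<le> (B * exp (- (5 * pi / 6) * \<bar>x\<bar>)) * (C * exp (- (5 * pi / 6) * \<bar>x\<bar>)) *
         (D * exp (- (5 * pi / 6) * \<bar>x\<bar>)) * (F * exp ((13 * pi / 6) * \<bar>x\<bar>))"
      unfolding norm_mult norm_of_real using le(1-4)
      by (intro mult_mono le mult_nonneg_nonneg) auto
    also have "\<dots> = (B * C * D * F) * (exp (- (5 * pi / 6) * \<bar>x\<bar>) * exp (- (5 * pi / 6) * \<bar>x\<bar>) *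
         exp (- (5 * pi / 6) * \<bar>x\<bar>) * exp ((13 * pi / 6) * \<bar>x\<bar>))"
      by (simp only: mult_ac)
    also have "(exp (- (5 * pi / 6) * \<bar>x\<bar>) * exp (- (5 * pi / 6) * \<bar>x\<bar>) *
         exp (- (5 * pi / 6) * \<bar>x\<bar>) * exp ((13 * pi / 6) * \<bar>x\<bar>)) = exp (- (pi / 3) * \<bar>x\<bar>)"
      unfolding exp_add[symmetric] by (simp add: field_simps)
    finally show ?thesis .
  qed
  with le(1-4) show ?thesis by (intro exI[of _ "B * C * D * F"]) auto
qed

lemma continuous_wilson_kernel [continuous_intros]:
  assumes "Re a > 0" "Re b > 0" "Re c > 0" "Re d > 0"
  shows "continuous_on UNIV (wilson_kernel a b c d)"
  unfolding wilson_kernel_def[abs_def] using assms by (intro continuous_intros) auto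

lemma norm_wilson_kernel_le:
  assumes "Re a > 0" "Re b > 0" "Re c > 0" "Re d > 0"
  shows "\<exists>C>0. \<forall>x. norm (wilson_kernel a b c d x) \<le> C * exp (- (7 * pi / 6) * \<bar>x\<bar>)"
proof -
  obtain A C where le: "A > 0" "C > 0"
    "\<And>x. norm (gamma_pair a x) \<le> A * exp (- (5 * pi / 6) * \<bar>x\<bar>)"
    "\<And>x. norm (gamma_pair b x * gamma_pair c x * gamma_pair d x * of_real (wilson_factor x)) \<le> C * exp (- (pi / 3) * \<bar>x\<bar>)"
    using norm_gamma_pair_le assms norm_triple_kernel_le by metis
  have "norm (wilson_kernel a b c d x) \<le> (A * C) * exp (- (7 * pi / 6) * \<bar>x\<bar>)" for x
  proof -
    have "norm (wilson_kernel a b c d x) = norm (gamma_pair a x) *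
            norm (gamma_pair b x * gamma_pair c x * gamma_pair d x * of_real (wilson_factor x))"
      by (simp add: wilson_kernel_def norm_mult)
    also have "\<dots> \<le> (A * exp (- (5 * pi / 6) * \<bar>x\<bar>)) * (C * exp (- (pi / 3) * \<bar>x\<bar>))"
      using le(1,2) by (intro mult_mono le) auto
    also have "\<dots> = (A * C) * (exp (- (5 * pi / 6) * \<bar>x\<bar>) * exp (- (pi / 3) * \<bar>x\<bar>))"
      by (simp only: mult_ac)
    also have "exp (- (5 * pi / 6) * \<bar>x\<bar>) * exp (- (pi / 3) * \<bar>x\<bar>) = exp (- (7 * pi / 6) * \<bar>x\<bar>)"
      unfolding exp_add[symmetric] by (simp add: field_simps)
    finally show ?thesis .
  qed
  with le(1,2) show ?thesis by (intro exI[of _ "A * C"]) auto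
qed

lemma integrable_wilson_kernel:
  assumes "Re a > 0" "Re b > 0" "Re c > 0" "Re d > 0"
  shows "integrable lborel (wilson_kernel a b c d)"
proof -
  obtain C where "\<And>x. norm (wilson_kernel a b c d x) \<le> C * exp (- (7 * pi / 6) * \<bar>x\<bar>)"
    using norm_wilson_kernel_le[OF assms] by auto
  then show ?thesis
    by (intro integrable_exp_bound[of _ "7 * pi / 6" C] continuous_wilson_kernel assms) auto
qed

lemma gamma_pair_add_of_nat:
  assumes "Re a > 0"
  shows "gamma_pair (a + of_nat n) x =
    pochhammer (a + \<i> * of_real x) n * pochhammer (a - \<i> * of_real x) n * gamma_pair a x"
proof -
  have "Gamma (z + of_nat n) = pochhammer z n * Gamma z" if "Re z > 0" for z
    using that by (simp add: pochhammer_Gamma Re_pos_not_nonpos_Int Gamma_eq_zero_iff)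
  from this[of "a + \<i> * of_real x"] this[of "a - \<i> * of_real x"] assms show ?thesis
    by (simp add: gamma_pair_def algebra_simps)
qed

lemma gamma_pair_plus1:
  assumes "Re a > 0"
  shows "gamma_pair (a + 1) x = (a\<^sup>2 + (of_real x)\<^sup>2) * gamma_pair a x"
  using gamma_pair_add_of_nat[OF assms, of 1 x]
  by (simp add: power2_eq_square algebra_simps)

lemma wilson_integral_recurrence:
  assumes "Re a > 0" "Re b > 0" "Re c > 0" "Re d > 0"
  shows "(a + b + c + d) * integral\<^sup>L lborel (wilson_kernel (a + 1) b c d)
         = (a + b) * (a + c) * (a + d) * integral\<^sup>L lborel (wilson_kernel a b c d)"
proof -
  \<comment> \<open>The integrals of \<open>H\<close> along the lines \<open>Re u = \<plusminus>1/2\<close> agree; the difference of the integrands is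
     the first Wilson polynomial times the kernel.\<close>
  define pr where "pr p u = Gamma (p + 1/2 + u) * Gamma (p + 1/2 - u)" for p u :: complex
  define H where "H u = pr a u * pr b u * pr c u * pr d u * sin (2 * of_real pi * u)" for u :: complex
  \<comment> \<open>This margin makes \<open>S\<close> an open strip around |Re u| <= 1/2 on which
    all arguments of Gamma keep a positive real part.\<close>
  define r where "r = min (min (Re a) (Re b)) (min (Re c) (Re d))"
  define S where "S = {u. Re u > -(1/2) - r} \<inter> {u. Re u < 1/2 + r}"
  have r: "r > 0" "r \<le> Re a" "r \<le> Re b" "r \<le> Re c" "r \<le> Re d"
    using assms by (auto simp: r_def)
  have S: "convex S" "open S"
    unfolding S_def by (auto intro!: convex_Int convex_halfspace_Re_gt convex_halfspace_Re_lt
        open_Int open_halfspace_Re_gt open_halfspace_Re_lt)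
  have hol_pr: "pr p holomorphic_on S" if "r \<le> Re p" for p
    unfolding pr_def[abs_def] S_def using that
    by (intro holomorphic_intros) (auto intro!: Re_pos_not_nonpos_Int)
  have hol_H: "H holomorphic_on S"
    unfolding H_def[abs_def] by (intro holomorphic_intros hol_pr r)
  \<comment> \<open>A primitive on the convex strip replaces a rectangular contour. The increment of
    \<open>P\<close> across the strip at height x, divided by i, is \<open>Q\<close>; its derivative
    is the difference of the integrands on the two lines, and it vanishes at both ends.\<close>
  obtain P where P: "\<And>u. u \<in> S \<Longrightarrow> (P has_field_derivative H u) (at u within S)"
  proof (rule holomorphic_convex_primitive'[OF S hol_H])
    fix g assume "\<And>u. u \<in> S \<Longrightarrow> (g has_field_derivative H u) (at u within S)"
    then show thesis by (rule that)
  qed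
  have P': "(P has_field_derivative H u) (at u)" if "u \<in> S" for u
    using P[OF that] unfolding at_within_open[OF that S(2)] .
  have Sl: "u \<in> S" if "\<bar>Re u\<bar> \<le> 1/2" for u
    using that r(1) by (auto simp: S_def)
  have bd_pr: "\<exists>C>0. \<forall>u. \<bar>Re u\<bar> \<le> 1/2 \<longrightarrow> norm (pr p u) \<le> C * exp (- (5 * pi / 6) * \<bar>Im u\<bar>)"
    if p: "Re p > 0" for p
  proof -
    define \<delta> where "\<delta> = 5 * pi / 12"
    have \<delta>: "\<delta> < pi / 2" "\<delta> \<ge> 0" by (simp_all add: \<delta>_def)
    obtain C where C: "C > 0" "\<And>z. Re p \<le> Re z \<Longrightarrow> Re z \<le> Re p + 1 \<Longrightarrow> norm (Gamma z) \<le> C * exp (- \<delta> * \<bar>Im z\<bar>)"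
      using norm_Gamma_decay[OF p \<delta>(1), of "Re p + 1"] by blast
    define C' where "C' = C * exp (\<delta> * \<bar>Im p\<bar>)"
    have G: "norm (Gamma w) \<le> C' * exp (- \<delta> * \<bar>Im u\<bar>)"
      if "Re p \<le> Re w" "Re w \<le> Re p + 1" "\<bar>Im u\<bar> \<le> \<bar>Im w\<bar> + \<bar>Im p\<bar>" for w u
    proof -
      have "- \<delta> * \<bar>Im w\<bar> \<le> \<delta> * \<bar>Im p\<bar> + - \<delta> * \<bar>Im u\<bar>"
        using mult_left_mono[OF that(3) \<delta>(2)] by (simp add: algebra_simps)
      then have "C * exp (- \<delta> * \<bar>Im w\<bar>) \<le> C * exp (\<delta> * \<bar>Im p\<bar> + - \<delta> * \<bar>Im u\<bar>)"
        using C(1) by (intro mult_left_mono) auto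
      with C(2)[OF that(1,2)] show ?thesis unfolding C'_def exp_add mult.assoc by linarith
    qed
    have "norm (pr p u) \<le> (C' * C') * exp (- (5 * pi / 6) * \<bar>Im u\<bar>)" if "\<bar>Re u\<bar> \<le> 1/2" for u
    proof -
      have "norm (pr p u) \<le> (C' * exp (- \<delta> * \<bar>Im u\<bar>)) * (C' * exp (- \<delta> * \<bar>Im u\<bar>))"
        unfolding pr_def norm_mult using that C(1) by (intro mult_mono G) (auto simp: C'_def)
      also have "\<dots> = (C' * C') * exp (- (5 * pi / 6) * \<bar>Im u\<bar>)"
        by (simp add: \<delta>_def flip: exp_add)
      finally show ?thesis .
    qed
    moreover have "C' * C' > 0" using C(1) by (simp add: C'_def)
    ultimately show ?thesis by blast
  qed
  obtain A where A: "A > 0" "\<And>u. \<bar>Re u\<bar> \<le> 1/2 \<Longrightarrow> norm (pr a u) \<le> A * exp (- (5 * pi / 6) * \<bar>Im u\<bar>)"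
    using bd_pr[OF assms(1)] by blast
  obtain B where B: "B > 0" "\<And>u. \<bar>Re u\<bar> \<le> 1/2 \<Longrightarrow> norm (pr b u) \<le> B * exp (- (5 * pi / 6) * \<bar>Im u\<bar>)"
    using bd_pr[OF assms(2)] by blast
  obtain C where C: "C > 0" "\<And>u. \<bar>Re u\<bar> \<le> 1/2 \<Longrightarrow> norm (pr c u) \<le> C * exp (- (5 * pi / 6) * \<bar>Im u\<bar>)"
    using bd_pr[OF assms(3)] by blast
  obtain D where D: "D > 0" "\<And>u. \<bar>Re u\<bar> \<le> 1/2 \<Longrightarrow> norm (pr d u) \<le> D * exp (- (5 * pi / 6) * \<bar>Im u\<bar>)"
    using bd_pr[OF assms(4)] by blast
  note le = A(1) B(1) C(1) D(1) A(2) B(2) C(2) D(2)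
  define K where "K = A * B * C * D"
  have K: "K > 0" using le(1-4) by (simp add: K_def)
  \<comment> \<open>Rates: four pairs give 10 pi/3, the sine costs 2 pi, and 4 pi/3 remains.\<close>
  have bd_H: "norm (H u) \<le> K * exp (- (4 * pi / 3) * \<bar>Im u\<bar>)" if "\<bar>Re u\<bar> \<le> 1/2" for u
  proof -
    have s: "norm (sin (2 * of_real pi * u)) \<le> exp (2 * pi * \<bar>Im u\<bar>)"
      using cmod_sin_le_exp[of 1 "2 * of_real pi * u"] by (simp add: abs_mult)
    have "norm (H u) \<le> (A * exp (- (5 * pi / 6) * \<bar>Im u\<bar>)) * (B * exp (- (5 * pi / 6) * \<bar>Im u\<bar>)) *
      (C * exp (- (5 * pi / 6) * \<bar>Im u\<bar>)) * (D * exp (- (5 * pi / 6) * \<bar>Im u\<bar>)) * exp (2 * pi * \<bar>Im u\<bar>)"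
      unfolding H_def norm_mult using le(1-4)
      by (intro mult_mono le(5-8)[OF that] s mult_nonneg_nonneg) auto
    also have "\<dots> = K * (exp (- (5 * pi / 6) * \<bar>Im u\<bar>) * exp (- (5 * pi / 6) * \<bar>Im u\<bar>) *
      exp (- (5 * pi / 6) * \<bar>Im u\<bar>) * exp (- (5 * pi / 6) * \<bar>Im u\<bar>) * exp (2 * pi * \<bar>Im u\<bar>))"
      unfolding K_def by (simp only: mult_ac)
    also have "exp (- (5 * pi / 6) * \<bar>Im u\<bar>) * exp (- (5 * pi / 6) * \<bar>Im u\<bar>) *
      exp (- (5 * pi / 6) * \<bar>Im u\<bar>) * exp (- (5 * pi / 6) * \<bar>Im u\<bar>) * exp (2 * pi * \<bar>Im u\<bar>)
      = exp (- (4 * pi / 3) * \<bar>Im u\<bar>)"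
      unfolding exp_add[symmetric] by (simp add: field_simps)
    finally show ?thesis .
  qed
  define lin where "lin s x = of_real s + \<i> * of_real x" for s x :: real
  have lin: "Re (lin s x) = s" "Im (lin s x) = x" for s x by (simp_all add: lin_def)
  define Q where "Q x = (P (lin (1/2) x) - P (lin (-1/2) x)) / \<i>" for x
  define f where "f x = H (lin (1/2) x) - H (lin (-1/2) x)" for x
  have dlin: "((\<lambda>x. P (lin s x)) has_vector_derivative (\<i> * H (lin s x))) (at x)" if "\<bar>s\<bar> \<le> 1/2" for s x
  proof -
    have 1: "(lin s has_vector_derivative \<i>) (at x)"
      unfolding lin_def[abs_def] by (auto intro!: derivative_eq_intros)
    have 2: "(P has_field_derivative H (lin s x)) (at (lin s x))"
      using that by (intro P' Sl) (simp add: lin)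
    show ?thesis
      using field_vector_diff_chain_at[OF 1 2] by (simp add: o_def)
  qed
  have Q': "(Q has_vector_derivative f x) (at x)" for x
    unfolding Q_def[abs_def]
    by (rule has_vector_derivative_eq_rhs[OF has_vector_derivative_divide[OF has_vector_derivative_diff[OF dlin dlin]]])
       (simp_all add: f_def right_diff_distrib)
  have clin: "continuous_on UNIV (\<lambda>x. H (lin s x))" if "\<bar>s\<bar> \<le> 1/2" for s
  proof -
    have 1: "continuous_on S H" using hol_H by (rule holomorphic_on_imp_continuous_on)
    have 2: "continuous_on UNIV (lin s)" unfolding lin_def[abs_def] by (intro continuous_intros)
    have 3: "lin s ` UNIV \<subseteq> S" using that by (auto intro!: Sl simp: lin)
    show ?thesis by (rule continuous_on_compose2[OF 1 2 3])
  qed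
  have ilin: "integrable lborel (\<lambda>x. H (lin s x))" if "\<bar>s\<bar> \<le> 1/2" for s
  proof (rule integrable_exp_bound[OF clin[OF that]])
    show "norm (H (lin s x)) \<le> K * exp (- (4 * pi / 3) * \<bar>x\<bar>)" for x
      using bd_H[of "lin s x"] that by (simp add: lin)
  qed simp
  have bd_Q: "norm (Q x) \<le> K * exp (- (4 * pi / 3) * \<bar>x\<bar>)" for x
  proof -
    have "norm (P (lin (1/2) x) - P (lin (-1/2) x)) \<le> K * exp (- (4 * pi / 3) * \<bar>x\<bar>) * norm (lin (1/2) x - lin (-1/2) x)"
    proof -
      \<comment> \<open>The horizontal segment of length 1 at height x, as an intersection of half
        planes; on it the bound for \<open>H\<close> becomes one for the increment of
        \<open>P\<close>.\<close>
      define L where "L = ({u. - (1/2) \<le> Re u} \<inter> {u. Re u \<le> 1/2}) \<inter> ({u. Im u \<le> x} \<inter> {u. x \<le> Im u})"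
      have L: "\<bar>Re u\<bar> \<le> 1/2" "Im u = x" if "u \<in> L" for u
        using that by (auto simp: L_def)
      have 1: "convex L"
        unfolding L_def
        by (rule convex_Int[OF convex_Int[OF convex_halfspace_Re_ge convex_halfspace_Re_le]
              convex_Int[OF convex_halfspace_Im_le convex_halfspace_Im_ge]])
      have 2: "(P has_field_derivative H u) (at u within L)" if "u \<in> L" for u
        by (rule has_field_derivative_at_within[OF P'[OF Sl[OF L(1)[OF that]]]])
      have 3: "norm (H u) \<le> K * exp (- (4 * pi / 3) * \<bar>x\<bar>)" if "u \<in> L" for u
        using bd_H[OF L(1)[OF that]] unfolding L(2)[OF that] .
      have 4: "lin (1/2) x \<in> L" "lin (-1/2) x \<in> L" by (simp_all add: L_def lin)
      show ?thesis by (rule field_differentiable_bound[OF 1 2 3 4])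
    qed
    moreover have "lin (1/2) x - lin (-1/2) x = 1" by (simp add: lin_def)
    ultimately show ?thesis unfolding Q_def norm_divide by simp
  qed
  have Q_lim: "(Q \<longlongrightarrow> 0) F" if "filterlim (\<lambda>x::real. \<bar>x\<bar>) at_top F" for F
  proof (rule Lim_null_comparison)
    show "\<forall>\<^sub>F x in F. norm (Q x) \<le> K * exp (- (4 * pi / 3) * \<bar>x\<bar>)" using bd_Q by simp
    have "filterlim (\<lambda>x. - (4 * pi / 3) * \<bar>x\<bar>) at_bot F"
      by (rule filterlim_tendsto_neg_mult_at_bot[OF tendsto_const _ that]) simp
    from filterlim_compose[OF exp_at_bot this]
    show "((\<lambda>x. K * exp (- (4 * pi / 3) * \<bar>x\<bar>)) \<longlongrightarrow> 0) F"
      by (rule tendsto_mult_right_zero)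
  qed
  have f0: "integral\<^sup>L lborel f = 0 - 0"
  proof (rule integral_FTC_UNIV[OF Q'])
    show "continuous_on UNIV f" unfolding f_def[abs_def] by (intro continuous_intros clin) auto
    show "integrable lborel f" unfolding f_def[abs_def] by (intro Bochner_Integration.integrable_diff ilin) auto
    show "(Q \<longlongrightarrow> 0) at_bot"
      by (intro Q_lim, subst filterlim_at_bot_mirror) (simp add: filterlim_abs_real)
    show "(Q \<longlongrightarrow> 0) at_top"
      by (intro Q_lim filterlim_abs_real)
  qed
  have f_eq: "f x = of_real pi * ((a + b) * (a + c) * (a + d) * wilson_kernel a b c d x
                    - (a + b + c + d) * wilson_kernel (a + 1) b c d x) " for x
  proof -
    have pr1: "pr p (lin (1/2) x) = (p + \<i> * of_real x) * gamma_pair p x"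
      and pr2: "pr p (lin (-1/2) x) = (p - \<i> * of_real x) * gamma_pair p x" if "Re p > 0" for p
    proof -
      have e: "p + 1/2 + lin (1/2) x = p + \<i> * of_real x + 1" "p + 1/2 - lin (1/2) x = p - \<i> * of_real x"
        "p + 1/2 + lin (-1/2) x = p + \<i> * of_real x" "p + 1/2 - lin (-1/2) x = p - \<i> * of_real x + 1"
        by (simp_all add: lin_def)
      have G: "Gamma (p + \<i> * of_real x + 1) = (p + \<i> * of_real x) * Gamma (p + \<i> * of_real x)"
        "Gamma (p - \<i> * of_real x + 1) = (p - \<i> * of_real x) * Gamma (p - \<i> * of_real x)"
        using that by (intro Gamma_plus1 Re_pos_not_nonpos_Int; simp)+
      show "pr p (lin (1/2) x) = (p + \<i> * of_real x) * gamma_pair p x"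
        "pr p (lin (-1/2) x) = (p - \<i> * of_real x) * gamma_pair p x"
        unfolding pr_def e G gamma_pair_def by (simp_all only: mult_ac)
    qed
    \<comment> \<open>The arguments on the two lines differ by 2 pi, so the sine has the same value
      on both and factors out of the difference.\<close>
    have sn: "sin (2 * of_real pi * lin (1/2) x) = - sin (\<i> * of_real (2 * pi * x))"
             "sin (2 * of_real pi * lin (-1/2) x) = - sin (\<i> * of_real (2 * pi * x))"
    proof -
      have "2 * of_real pi * lin (1/2) x = \<i> * of_real (2 * pi * x) + of_real pi"
           "2 * of_real pi * lin (-1/2) x = \<i> * of_real (2 * pi * x) - of_real pi"
        by (simp_all add: lin_def algebra_simps)
      then show "sin (2 * of_real pi * lin (1/2) x) = - sin (\<i> * of_real (2 * pi * x))"
             "sin (2 * of_real pi * lin (-1/2) x) = - sin (\<i> * of_real (2 * pi * x))"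
        by (simp_all only: sin_add sin_diff sin_of_real_pi cos_of_real_pi mult_zero_right mult_minus_right mult_1_right add_0_right diff_0_right)
    qed
    have sh: "sin (\<i> * of_real (2 * pi * x)) = \<i> * of_real (sinh (2 * pi * x))"
      using sin_i_times[of "of_real (2 * pi * x)"]
      by (simp add: mult_ac sinh_field_def exp_minus flip: exp_of_real)
    show ?thesis
    proof -
      define g where "g = gamma_pair a x * gamma_pair b x * gamma_pair c x * gamma_pair d x"
      define w where "w = \<i> * of_real x"
      define t where "t = - (\<i> * complex_of_real (sinh (2 * pi * x)))"
      define Y where "Y = (a + b) * (a + c) * (a + d) - (a + b + c + d) * (a\<^sup>2 + (of_real x)\<^sup>2)"
      \<comment> \<open>Only odd powers of w survive, giving 2w (e3 + e1 w^2) with the elementary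
        symmetric functions of a, b, c, d. Then (a + b)(a + c)(a + d) = e3 + e1 a^2 brings in a^2 -
        w^2, the factor between the pairs of a and a + 1.\<close>
      have alg: "(a + w) * (b + w) * (c + w) * (d + w) - (a - w) * (b - w) * (c - w) * (d - w)
                 = 2 * w * ((a + b) * (a + c) * (a + d) - (a + b + c + d) * (a\<^sup>2 - w\<^sup>2))"
        by (simp add: algebra_simps power2_eq_square)
      have w2: "a\<^sup>2 - w\<^sup>2 = a\<^sup>2 + (of_real x)\<^sup>2" by (simp add: w_def power_mult_distrib)
      have gen: "(A*ga) * (B*gb) * (C*gc) * (D*gd) * s = s * (ga * gb * gc * gd) * (A * B * C * D)"
        for A B C D ga gb gc gd s :: complex
        by (simp only: mult_ac)
      have "f x = t * g * ((a + w) * (b + w) * (c + w) * (d + w) - (a - w) * (b - w) * (c - w) * (d - w))"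
        unfolding f_def H_def pr1[OF assms(1)] pr1[OF assms(2)] pr1[OF assms(3)] pr1[OF assms(4)]
          pr2[OF assms(1)] pr2[OF assms(2)] pr2[OF assms(3)] pr2[OF assms(4)] sn sh
        unfolding w_def[symmetric] t_def[symmetric] gen g_def[symmetric] by (rule right_diff_distrib[symmetric])
      also have "\<dots> = (t * (2 * w)) * (g * Y)"
        unfolding alg w2 Y_def by (simp only: mult_ac)
      also have "t * (2 * w) = of_real pi * of_real (wilson_factor x)"
      proof -
        have "t * (2 * w) = - (\<i> * \<i>) * (2 * of_real x * complex_of_real (sinh (2 * pi * x)))"
          unfolding t_def w_def by (simp only: mult_ac mult_minus_left mult_minus_right)
        also have "\<dots> = of_real (2 * x * sinh (2 * pi * x))"
          unfolding i_squared by simp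
        also have "2 * x * sinh (2 * pi * x) = pi * wilson_factor x"
          by (simp add: wilson_factor_def)
        finally show ?thesis by simp
      qed
      also have "of_real pi * of_real (wilson_factor x) * (g * Y)
                 = of_real pi * ((a + b) * (a + c) * (a + d) * wilson_kernel a b c d x
                    - (a + b + c + d) * wilson_kernel (a + 1) b c d x)"
        unfolding wilson_kernel_def gamma_pair_plus1[OF assms(1)] g_def Y_def
        by (simp only: right_diff_distrib mult_ac)
      finally show ?thesis .
    qed
  qed
  have "of_real pi * ((a + b) * (a + c) * (a + d) * integral\<^sup>L lborel (wilson_kernel a b c d)
                    - (a + b + c + d) * integral\<^sup>L lborel (wilson_kernel (a + 1) b c d)) = integral\<^sup>L lborel f"
    unfolding f_eq[abs_def] using assms by (simp add: integrable_wilson_kernel)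
  then show ?thesis using f0 by simp
qed

lemma wilson_kernel_commute:
  "wilson_kernel a b c d = wilson_kernel b a c d"
  "wilson_kernel a b c d = wilson_kernel a c b d"
  "wilson_kernel a b c d = wilson_kernel a b d c"
  by (rule ext; simp add: wilson_kernel_def mult_ac)+

lemma wilson_integral_pochhammer:
  assumes "Re a > 0" "Re b > 0" "Re c > 0" "Re d > 0"
  shows "pochhammer (a + b + c + d) n * integral\<^sup>L lborel (wilson_kernel (a + of_nat n) b c d)
         = pochhammer (a + b) n * pochhammer (a + c) n * pochhammer (a + d) n * integral\<^sup>L lborel (wilson_kernel a b c d)"
proof (induction n)
  case (Suc n)
  let ?I = "\<lambda>n. integral\<^sup>L lborel (wilson_kernel (a + of_nat n) b c d)"
  have 1: "(a + b + c + d + of_nat n) * ?I (Suc n)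
         = (a + b + of_nat n) * (a + c + of_nat n) * (a + d + of_nat n) * ?I n"
    using wilson_integral_recurrence[of "a + of_nat n" b c d] assms by (simp add: add_ac)
  have "pochhammer (a + b + c + d) (Suc n) * ?I (Suc n)
        = pochhammer (a + b + c + d) n * ((a + b + c + d + of_nat n) * ?I (Suc n))"
    by (simp only: pochhammer_Suc mult.assoc)
  also have "\<dots> = (a + b + of_nat n) * (a + c + of_nat n) * (a + d + of_nat n) *
      (pochhammer (a + b + c + d) n * ?I n)"
    unfolding 1 by (simp only: mult_ac)
  finally show ?case unfolding Suc.IH by (simp only: pochhammer_Suc mult_ac)
qed simp

section \<open>The limit of a large parameter\<close>

definition triple_kernel :: "complex \<Rightarrow> complex \<Rightarrow> complex \<Rightarrow> real \<Rightarrow> complex" where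
  "triple_kernel b c d x = gamma_pair b x * gamma_pair c x * gamma_pair d x * of_real (wilson_factor x)"

lemma wilson_kernel_triple: "wilson_kernel a b c d x = gamma_pair a x * triple_kernel b c d x"
  by (simp add: wilson_kernel_def triple_kernel_def)

lemma continuous_triple_kernel:
  assumes "Re b > 0" "Re c > 0" "Re d > 0"
  shows "continuous_on UNIV (triple_kernel b c d)"
  unfolding triple_kernel_def[abs_def] using assms by (intro continuous_intros) auto

lemma integrable_triple_kernel:
  assumes "Re b > 0" "Re c > 0" "Re d > 0"
  shows "integrable lborel (triple_kernel b c d)"
proof -
  obtain C where C: "\<And>x. norm (triple_kernel b c d x) \<le> C * exp (- (pi / 3) * \<bar>x\<bar>)"
    using norm_triple_kernel_le[OF assms] unfolding triple_kernel_def by auto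
  show ?thesis
    by (rule integrable_exp_bound[OF continuous_triple_kernel[OF assms] _ C]) simp
qed

text \<open>This is (n - 1)! n^a, which by Gauss's limit is the growth of (a)_n up to the factor 1 /
  Gamma(a).\<close>

definition gamma_scale :: "complex \<Rightarrow> nat \<Rightarrow> complex" where
  "gamma_scale a n = fact (n - 1) * exp (a * of_real (ln (of_nat n)))"

lemma pochhammer_Re_pos_nonzero: "Re z > 0 \<Longrightarrow> pochhammer z n \<noteq> 0"
  by (simp add: pochhammer_eq_0_iff) (auto simp: complex_eq_iff)

lemma pochhammer_eq_gamma_scale:
  "Re z > 0 \<Longrightarrow> pochhammer z n = gamma_scale z n / Gamma_series' z n"
  by (simp add: gamma_scale_def Gamma_series'_def pochhammer_Re_pos_nonzero)

lemma gamma_scale_nonzero: "gamma_scale z n \<noteq> 0"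
  by (simp add: gamma_scale_def)

lemma gamma_scale_add:
  "gamma_scale (a + b) n * gamma_scale (a - b) n = (gamma_scale a n)\<^sup>2"
  by (simp add: gamma_scale_def power2_eq_square algebra_simps exp_diff exp_add)

lemma Gamma_series'_tendsto_inverse:
  assumes "Re z > 0"
  shows "(\<lambda>n. inverse (Gamma_series' z n)) \<longlonglongrightarrow> inverse (Gamma z)"
  using assms
  by (intro tendsto_inverse Gamma_series'_LIMSEQ) (auto simp: Gamma_eq_zero_iff Re_pos_not_nonpos_Int)

text \<open>Since the limit does not involve \<open>a\<close>, the quotient of the Wilson integral by its claimed value
  is independent of \<open>a\<close>, hence by symmetry of all parameters.\<close>
lemma wilson_integral_limit:
  assumes "Re a > 0" "Re b > 0" "Re c > 0" "Re d > 0"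
  shows "(\<lambda>n. integral\<^sup>L lborel (wilson_kernel (a + of_nat n) b c d) / (gamma_scale a n)\<^sup>2)
         \<longlonglongrightarrow> integral\<^sup>L lborel (triple_kernel b c d)"
proof -
  define \<alpha> where "\<alpha> = Re a"
  have \<alpha>: "\<alpha> > 0" using assms by (simp add: \<alpha>_def)
  \<comment> \<open>Source of the dominating constant: |Gamma(a + n +- ix)| is at most Gamma(Re a +
    n), and after division by the modulus of the scale this is a convergent, hence bounded,
    sequence.\<close>
  define r where "r n = Gamma \<alpha> / Gamma_series' \<alpha> n" for n
  have r: "r n = Gamma (\<alpha> + n) / norm (gamma_scale a n)" for n
  proof -
    have "Gamma (\<alpha> + n) = pochhammer \<alpha> n * Gamma \<alpha>"
    proof -
      have "\<alpha> \<notin> \<int>\<^sub>\<le>\<^sub>0"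
        using \<alpha> by (auto simp: nonpos_Ints_def)
      moreover have "Gamma \<alpha> \<noteq> 0"
        using Gamma_real_pos[OF \<alpha>] by linarith
      ultimately show ?thesis by (simp add: pochhammer_Gamma)
    qed
    moreover have "norm (gamma_scale a n) = fact (n - 1) * exp (\<alpha> * ln (of_nat n))"
      by (simp add: gamma_scale_def norm_mult \<alpha>_def)
    ultimately show ?thesis
      by (simp add: r_def Gamma_series'_def)
  qed
  have "r \<longlonglongrightarrow> Gamma \<alpha> / Gamma \<alpha>"
    unfolding r_def[abs_def] using less_imp_neq[OF Gamma_real_pos[OF \<alpha>], symmetric]
    by (rule tendsto_divide[OF tendsto_const Gamma_series'_LIMSEQ])
  then have "Bseq r" by (rule convergent_imp_Bseq[OF convergentI])
  then obtain B where B: "\<And>n. norm (r n) \<le> B" by (auto simp: Bseq_def)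
  define s where "s n x = wilson_kernel (a + of_nat n) b c d x / (gamma_scale a n)\<^sup>2" for n x
  have "(\<lambda>n. integral\<^sup>L lborel (s n)) \<longlonglongrightarrow> integral\<^sup>L lborel (triple_kernel b c d)"
  proof (rule integral_dominated_convergence)
    show "integrable lborel (\<lambda>x. B * B * norm (triple_kernel b c d x))"
      using assms by (intro integrable_mult_right integrable_norm integrable_triple_kernel)
    show "triple_kernel b c d \<in> borel_measurable lborel"
      using assms by (simp add: borel_measurable_continuous_onI continuous_triple_kernel)
    have "continuous_on UNIV (s n)" for n
      unfolding s_def[abs_def] using assms gamma_scale_nonzero
      by (intro continuous_intros) auto
    then show "s n \<in> borel_measurable lborel" for n
      by (simp add: borel_measurable_continuous_onI)
    show "AE x in lborel. norm (s n x) \<le> B * B * norm (triple_kernel b c d x)" for n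
    proof (rule AE_I2)
      fix x
      have "norm (gamma_pair (a + of_nat n) x) \<le> Gamma (\<alpha> + n) * Gamma (\<alpha> + n)"
        unfolding gamma_pair_def norm_mult
        using norm_Gamma_le_Gamma_Re[of "a + of_nat n + \<i> * of_real x"]
          norm_Gamma_le_Gamma_Re[of "a + of_nat n - \<i> * of_real x"] assms
        by (intro mult_mono) (auto simp: \<alpha>_def intro!: Gamma_real_nonneg)
      then have "norm (gamma_pair (a + of_nat n) x) / norm ((gamma_scale a n)\<^sup>2) \<le> r n * r n"
        unfolding r power2_eq_square norm_mult times_divide_times_eq
        by (rule divide_right_mono) simp
      also have "r n * r n = \<bar>r n\<bar> * \<bar>r n\<bar>" by simp
      also have "\<dots> \<le> B * B"
      proof (rule mult_mono)
        show "\<bar>r n\<bar> \<le> B" "\<bar>r n\<bar> \<le> B" using B[of n] by simp_all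
        then show "0 \<le> B" by linarith
      qed simp
      finally have "norm (gamma_pair (a + of_nat n) x) / norm ((gamma_scale a n)\<^sup>2) * norm (triple_kernel b c d x)
         \<le> B * B * norm (triple_kernel b c d x)"
        by (rule mult_right_mono) simp
      then show "norm (s n x) \<le> B * B * norm (triple_kernel b c d x)"
        unfolding s_def wilson_kernel_triple norm_divide norm_mult by simp
    qed
    show "AE x in lborel. (\<lambda>n. s n x) \<longlonglongrightarrow> triple_kernel b c d x"
    proof (rule AE_I2)
      fix x
      let ?u = "a + \<i> * of_real x" and ?v = "a - \<i> * of_real x"
      have u: "Re ?u > 0" and v: "Re ?v > 0" using assms by auto
      \<comment> \<open>Shifting a by n multiplies the pair by (a + ix)_n (a - ix)_n. Once scaled,
        these symbols tend to the reciprocals of the two Gamma factors of the pair and so remove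
        it.\<close>
      have "s n x = wilson_kernel a b c d x * (inverse (Gamma_series' ?u n) * inverse (Gamma_series' ?v n))" for n
      proof -
        have "s n x = (pochhammer ?u n * pochhammer ?v n / (gamma_scale a n)\<^sup>2) * wilson_kernel a b c d x"
          unfolding s_def wilson_kernel_triple gamma_pair_add_of_nat[OF assms(1)] by simp
        also have "pochhammer ?u n * pochhammer ?v n / (gamma_scale a n)\<^sup>2
                   = inverse (Gamma_series' ?u n) * inverse (Gamma_series' ?v n)"
          unfolding pochhammer_eq_gamma_scale[OF u] pochhammer_eq_gamma_scale[OF v]
            gamma_scale_add[symmetric, where a = a and b = "\<i> * of_real x"]
          using gamma_scale_nonzero[of ?u n] gamma_scale_nonzero[of ?v n] by (simp add: divide_simps)
        finally show ?thesis by (simp only: mult_ac)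
      qed
      moreover have "(\<lambda>n. wilson_kernel a b c d x * (inverse (Gamma_series' ?u n) * inverse (Gamma_series' ?v n)))
         \<longlonglongrightarrow> wilson_kernel a b c d x * (inverse (Gamma ?u) * inverse (Gamma ?v))"
        by (intro tendsto_mult tendsto_const Gamma_series'_tendsto_inverse u v)
      moreover have "wilson_kernel a b c d x * (inverse (Gamma ?u) * inverse (Gamma ?v)) = triple_kernel b c d x"
      proof -
        have "Gamma ?u \<noteq> 0" "Gamma ?v \<noteq> 0"
          using Re_pos_not_nonpos_Int[OF u] Re_pos_not_nonpos_Int[OF v] by (simp_all add: Gamma_eq_zero_iff)
        then show ?thesis by (simp add: wilson_kernel_triple gamma_pair_def divide_simps)
      qed
      ultimately show "(\<lambda>n. s n x) \<longlonglongrightarrow> triple_kernel b c d x" by simp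
    qed
  qed
  moreover have "integral\<^sup>L lborel (s n) = integral\<^sup>L lborel (wilson_kernel (a + of_nat n) b c d) / (gamma_scale a n)\<^sup>2" for n
    unfolding s_def[abs_def] by simp
  ultimately show ?thesis by simp
qed

text \<open>The iterated recurrence writes the same scaled integrals through Pochhammer symbols with
  an explicit limit. Comparing the two limits isolates the dependence on a in Gamma factors.\<close>

lemma wilson_integral_eq_triple:
  assumes "Re a > 0" "Re b > 0" "Re c > 0" "Re d > 0"
  shows "integral\<^sup>L lborel (wilson_kernel a b c d) * Gamma (a + b + c + d)
         = integral\<^sup>L lborel (triple_kernel b c d) * (Gamma (a + b) * Gamma (a + c) * Gamma (a + d))"
proof -
  let ?I = "integral\<^sup>L lborel (wilson_kernel a b c d)"
  let ?s = "a + b + c + d"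
  have re: "Re (a + b) > 0" "Re (a + c) > 0" "Re (a + d) > 0" "Re ?s > 0" using assms by auto
  have "integral\<^sup>L lborel (wilson_kernel (a + of_nat n) b c d) / (gamma_scale a n)\<^sup>2
        = ?I * (inverse (Gamma_series' (a + b) n) * inverse (Gamma_series' (a + c) n)
             * inverse (Gamma_series' (a + d) n) * Gamma_series' ?s n)" for n
  proof -
    have "pochhammer ?s n \<noteq> 0"
      by (rule pochhammer_Re_pos_nonzero[OF re(4)])
    then have "integral\<^sup>L lborel (wilson_kernel (a + of_nat n) b c d)
      = ?I * (pochhammer (a + b) n * pochhammer (a + c) n * pochhammer (a + d) n / pochhammer ?s n)"
      using wilson_integral_pochhammer[OF assms, of n] by (simp add: field_simps)
    \<comment> \<open>Three factorials on each side, and exponents 3a + b + c + d = (a + b + c + d)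
      + 2a.\<close>
    moreover have "gamma_scale (a + b) n * gamma_scale (a + c) n * gamma_scale (a + d) n
         = gamma_scale ?s n * (gamma_scale a n)\<^sup>2"
      by (simp add: gamma_scale_def power2_eq_square distrib_right exp_add)
    moreover have "pochhammer (a + b) n * pochhammer (a + c) n * pochhammer (a + d) n / pochhammer ?s n
      = gamma_scale (a + b) n * gamma_scale (a + c) n * gamma_scale (a + d) n / gamma_scale ?s n
        * (inverse (Gamma_series' (a + b) n) * inverse (Gamma_series' (a + c) n)
             * inverse (Gamma_series' (a + d) n) * Gamma_series' ?s n)"
      unfolding pochhammer_eq_gamma_scale[OF re(1)] pochhammer_eq_gamma_scale[OF re(2)]
        pochhammer_eq_gamma_scale[OF re(3)] pochhammer_eq_gamma_scale[OF re(4)]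
      by (simp only: divide_inverse inverse_mult_distrib inverse_inverse_eq mult_ac)
    ultimately show ?thesis
      using gamma_scale_nonzero[of ?s n] gamma_scale_nonzero[of a n] by simp
  qed
  moreover have "(\<lambda>n. ?I * (inverse (Gamma_series' (a + b) n) * inverse (Gamma_series' (a + c) n)
             * inverse (Gamma_series' (a + d) n) * Gamma_series' ?s n))
       \<longlonglongrightarrow> ?I * (inverse (Gamma (a + b)) * inverse (Gamma (a + c)) * inverse (Gamma (a + d)) * Gamma ?s)"
    by (intro tendsto_mult tendsto_const Gamma_series'_tendsto_inverse Gamma_series'_LIMSEQ re)
  ultimately have "integral\<^sup>L lborel (triple_kernel b c d)
      = ?I * (inverse (Gamma (a + b)) * inverse (Gamma (a + c)) * inverse (Gamma (a + d)) * Gamma ?s)"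
    using wilson_integral_limit[OF assms] by (simp add: LIMSEQ_unique)
  moreover have "Gamma (a + b) \<noteq> 0" "Gamma (a + c) \<noteq> 0" "Gamma (a + d) \<noteq> 0"
    using re by (auto simp: Gamma_eq_zero_iff Re_pos_not_nonpos_Int)
  ultimately show ?thesis by (simp add: field_simps)
qed

text \<open>Since 1/4 + 3/4 = 1, the four Gamma factors group into two reflections. The product of
  the two sines is half a difference of cosines, one of which is cos(pi/2) = 0.\<close>

lemma gamma_pair_quarter:
  "gamma_pair (1/4) x * gamma_pair (3/4) x = of_real (2 * pi\<^sup>2 / cosh (2 * pi * x))"
proof -
  define z where "z = 1/4 + \<i> * of_real x"
  have r: "Gamma z * Gamma (1 - z) = of_real pi / sin (of_real pi * z)"
    "Gamma (cnj z) * Gamma (1 - cnj z) = of_real pi / sin (of_real pi * cnj z)"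
    by (rule Gamma_reflection_complex)+
  have "gamma_pair (1/4) x * gamma_pair (3/4) x = (Gamma z * Gamma (1 - z)) * (Gamma (cnj z) * Gamma (1 - cnj z))"
    by (simp add: gamma_pair_def z_def mult_ac)
  also have "\<dots> = of_real (pi\<^sup>2) / (sin (of_real pi * z) * sin (of_real pi * cnj z))"
    unfolding r by (simp add: power2_eq_square)
  also have "sin (of_real pi * z) * sin (of_real pi * cnj z) =
      (cos (of_real pi * z - of_real pi * cnj z) - cos (of_real pi * z + of_real pi * cnj z)) / 2"
    by (rule sin_times_sin)
  also have "of_real pi * z - of_real pi * cnj z = \<i> * of_real (2 * pi * x)"
    by (simp add: z_def algebra_simps)
  also have "of_real pi * z + of_real pi * cnj z = of_real (pi / 2)"
    by (simp add: z_def algebra_simps)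
  also have "cos (complex_of_real (pi / 2)) = 0"
    unfolding cos_of_real by simp
  also have "cos (\<i> * complex_of_real (2 * pi * x)) = of_real (cosh (2 * pi * x))"
    using cos_i_times[of "of_real (2 * pi * x)"]
    by (simp add: cosh_field_def exp_minus flip: exp_of_real)
  finally show ?thesis by simp
qed

text \<open>At these parameters the integrand has an elementary primitive, which fixes the constant.\<close>
lemma wilson_integral_quarter:
  "integral\<^sup>L lborel (wilson_kernel (1/4) (3/4) (1/4) (3/4)) = of_real (2 * pi\<^sup>2)"
proof -
  define k where "k x = 8 * pi ^ 3 * x * sinh (2 * pi * x) / (cosh (2 * pi * x))\<^sup>2" for x :: real
  have k: "wilson_kernel (1/4) (3/4) (1/4) (3/4) x = of_real (k x)" for x
  proof -
    have "wilson_kernel (1/4) (3/4) (1/4) (3/4) x =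
       of_real (2 * pi\<^sup>2 / cosh (2 * pi * x) * (2 * pi\<^sup>2 / cosh (2 * pi * x)) * wilson_factor x)"
      unfolding of_real_mult[of _ "wilson_factor x"] of_real_mult[of "2 * pi\<^sup>2 / cosh (2 * pi * x)"]
        gamma_pair_quarter[symmetric] wilson_kernel_def by (simp only: mult_ac)
    also have "2 * pi\<^sup>2 / cosh (2 * pi * x) * (2 * pi\<^sup>2 / cosh (2 * pi * x)) * wilson_factor x = k x"
      by (simp add: k_def wilson_factor_def power2_eq_square power3_eq_cube)
    finally show ?thesis .
  qed
  \<comment> \<open>Integration by parts: up to the scaling by 2 pi, sinh / cosh^2 integrates to -1
    / cosh, and 1 / cosh to arctan(sinh).\<close>
  define F where "F x = 2 * pi * (arctan (sinh (2 * pi * x)) - 2 * pi * x / cosh (2 * pi * x))" for x :: real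
  have ch: "cosh y \<noteq> 0" for y :: real by (rule cosh_real_nonzero)
  have "integral\<^sup>L lborel k = 2 * pi * (pi / 2 - 0) - 2 * pi * (- (pi / 2) - 0)"
  proof (rule integral_FTC_UNIV)
    show "(F has_vector_derivative k x) (at x)" for x
    proof -
      have c2: "1 + (sinh (2 * pi * x))\<^sup>2 = (cosh (2 * pi * x))\<^sup>2"
        using cosh_square_eq[of "2 * pi * x"] by simp
      have "(F has_real_derivative 2 * pi * (inverse (1 + (sinh (2 * pi * x))\<^sup>2) * (cosh (2 * pi * x) * (2 * pi))
           - ((2 * pi) * cosh (2 * pi * x) - 2 * pi * x * (sinh (2 * pi * x) * (2 * pi))) / (cosh (2 * pi * x) * cosh (2 * pi * x)))) (at x)"
        unfolding F_def[abs_def] using ch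
        by (auto intro!: derivative_eq_intros)
      also have "2 * pi * (inverse (1 + (sinh (2 * pi * x))\<^sup>2) * (cosh (2 * pi * x) * (2 * pi))
           - ((2 * pi) * cosh (2 * pi * x) - 2 * pi * x * (sinh (2 * pi * x) * (2 * pi))) / (cosh (2 * pi * x) * cosh (2 * pi * x))) = k x"
        unfolding c2 k_def using ch[of "2 * pi * x"]
        by (simp add: divide_simps power2_eq_square power3_eq_cube)
      finally show ?thesis by (simp add: has_real_derivative_iff_has_vector_derivative)
    qed
    show "continuous_on UNIV k" unfolding k_def[abs_def] using ch by (intro continuous_intros) auto
    have "integrable lborel (wilson_kernel (1/4) (3/4) (1/4) (3/4))"
      by (rule integrable_wilson_kernel) auto
    then show "integrable lborel k"
      unfolding k[abs_def] by (simp add: complex_of_real_integrable_eq)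
    have top: "((\<lambda>x::real. 2 * pi * x / cosh (2 * pi * x)) \<longlongrightarrow> 0) at_top"
      by real_asymp
    have s: "filterlim (\<lambda>x::real. sinh (2 * pi * x)) at_top at_top"
      by real_asymp
    have a: "((\<lambda>x. arctan (sinh (2 * pi * x))) \<longlongrightarrow> pi / 2) at_top"
      by (rule filterlim_compose[OF tendsto_arctan_at_top s])
    show "(F \<longlongrightarrow> 2 * pi * (pi / 2 - 0)) at_top"
      unfolding F_def[abs_def] by (intro tendsto_intros top a)
    have "((\<lambda>x. 2 * pi * (- arctan (sinh (2 * pi * x)) - - (2 * pi * x / cosh (2 * pi * x)))) \<longlongrightarrow> 2 * pi * (- (pi / 2) - - 0)) at_top"
      by (intro tendsto_intros top a)
    then show "(F \<longlongrightarrow> 2 * pi * (- (pi / 2) - 0)) at_bot"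
      unfolding F_def[abs_def] filterlim_at_bot_mirror by (simp add: arctan_minus)
  qed
  then show ?thesis
    unfolding k[abs_def] integral_complex_of_real by (simp add: power2_eq_square)
qed

theorem wilson_integral:
  assumes "Re a > 0" "Re b > 0" "Re c > 0" "Re d > 0"
  shows "integral\<^sup>L lborel (wilson_kernel a b c d)
         = 4 * of_real pi * (Gamma (a + b) * Gamma (a + c) * Gamma (a + d) *
             Gamma (b + c) * Gamma (b + d) * Gamma (c + d)) / Gamma (a + b + c + d)"
proof -
  define prods where "prods a b c d = Gamma (a + b) * Gamma (a + c) * Gamma (a + d) *
             Gamma (b + c) * Gamma (b + d) * Gamma (c + d)" for a b c d :: complex
  define R where "R a b c d = integral\<^sup>L lborel (wilson_kernel a b c d) * Gamma (a + b + c + d) / prods a b c d" for a b c d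
  have nz: "Gamma (a + b) \<noteq> 0" if "Re a > 0" "Re b > 0" for a b :: complex
    using that by (auto simp: Gamma_eq_zero_iff intro!: Re_pos_not_nonpos_Int)
  have step: "R a b c d = R a' b c d" if "Re a > 0" "Re b > 0" "Re c > 0" "Re d > 0" "Re a' > 0" for a b c d a'
  proof -
    have "R x b c d = integral\<^sup>L lborel (triple_kernel b c d) / (Gamma (b + c) * Gamma (b + d) * Gamma (c + d))"
      if "Re x > 0" for x
      unfolding R_def prods_def wilson_integral_eq_triple[OF that \<open>Re b > 0\<close> \<open>Re c > 0\<close> \<open>Re d > 0\<close>]
      using nz[OF that \<open>Re b > 0\<close>] nz[OF that \<open>Re c > 0\<close>] nz[OF that \<open>Re d > 0\<close>] by simp
    from this[OF \<open>Re a > 0\<close>] this[OF \<open>Re a' > 0\<close>] show ?thesis by simp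
  qed
  have c: "R a b c d = R b a c d" "R a b c d = R a c b d" "R a b c d = R a b d c" for a b c d
  proof -
    show "R a b c d = R b a c d"
      unfolding R_def prods_def wilson_kernel_commute(1)[of a b c d] by (simp only: add_ac mult_ac)
    show "R a b c d = R a c b d"
      unfolding R_def prods_def wilson_kernel_commute(2)[of a b c d] by (simp only: add_ac mult_ac)
    show "R a b c d = R a b d c"
      unfolding R_def prods_def wilson_kernel_commute(3)[of a b c d] by (simp only: add_ac mult_ac)
  qed
  let ?a = "1/4 :: complex" and ?b = "3/4 :: complex"
  \<comment> \<open>Only the first parameter may be changed freely, so swaps of neighbours bring
    each one to the front in turn, until the case with the elementary primitive is reached. There
    the value is 2 pi^2 / (pi/2) = 4 pi.\<close>
  have "R a b c d = R ?a b c d" by (rule step) (use assms in auto)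
  also have "\<dots> = R b ?a c d" by (rule c)
  also have "\<dots> = R ?b ?a c d" by (rule step) (use assms in auto)
  also have "\<dots> = R ?b c ?a d" by (rule c)
  also have "\<dots> = R c ?b ?a d" by (rule c)
  also have "\<dots> = R ?a ?b ?a d" by (rule step) (use assms in auto)
  also have "\<dots> = R ?a ?b d ?a" by (rule c)
  also have "\<dots> = R ?a d ?b ?a" by (rule c)
  also have "\<dots> = R d ?a ?b ?a" by (rule c)
  also have "\<dots> = R ?b ?a ?b ?a" by (rule step) (use assms in auto)
  also have "\<dots> = R ?a ?b ?b ?a" by (rule c)
  also have "\<dots> = R ?a ?b ?a ?b" by (rule c)
  also have "\<dots> = 4 * of_real pi"
  proof -
    have "Gamma (3/2 :: complex) = of_real (sqrt pi) / 2"
      using Gamma_plus1[of "1/2 :: complex"] by (simp add: Gamma_one_half_complex Re_pos_not_nonpos_Int)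
    moreover have "Gamma (2 :: complex) = 1"
      using Gamma_plus1[of "1 :: complex"] by (simp add: Re_pos_not_nonpos_Int)
    moreover have "complex_of_real (sqrt pi) * complex_of_real (sqrt pi) = of_real pi"
      by (simp flip: of_real_mult)
    ultimately have "complex_of_real (sqrt pi) * Gamma (3/2) = of_real pi / 2" "Gamma (2 :: complex) = 1"
      by (simp_all only: times_divide_eq_right)
    note G = this
    have d: "prods ?a ?b ?a ?b = of_real pi / 2"
      unfolding prods_def using G(1) by (simp add: Gamma_one_half_complex)
    show ?thesis
      unfolding R_def d wilson_integral_quarter using G(2) by (simp add: power2_eq_square)
  qed
  finally have "integral\<^sup>L lborel (wilson_kernel a b c d) * Gamma (a + b + c + d) = 4 * of_real pi * prods a b c d"
    unfolding R_def using nz assms by (simp add: prods_def field_simps)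
  moreover have "Gamma (a + b + c + d) \<noteq> 0"
    using nz[of "a + b + c" d] assms by simp
  ultimately show ?thesis unfolding prods_def by (simp add: field_simps)
qed

section \<open>Moments and orthogonality\<close>

definition pochhammer_pair :: "complex \<Rightarrow> nat \<Rightarrow> real \<Rightarrow> complex" where
  "pochhammer_pair a m x = pochhammer (a + \<i> * of_real x) m * pochhammer (a - \<i> * of_real x) m"

definition wilson_ratio :: "nat \<Rightarrow> complex \<Rightarrow> complex \<Rightarrow> complex \<Rightarrow> complex \<Rightarrow> nat \<Rightarrow> complex" where
  "wilson_ratio n a b c d j =
     pochhammer (- of_nat n) j * pochhammer (of_nat n + a + b + c + d - 1) j /
     (pochhammer (a + b) j * pochhammer (a + c) j * pochhammer (a + d) j * fact j)"

lemma wilson_altdef: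
  "wilson n (of_real x) a b c d = pochhammer (a + b) n * pochhammer (a + c) n * pochhammer (a + d) n *
     (\<Sum>j\<le>n. wilson_ratio n a b c d j * pochhammer_pair a j x)"
proof -
  \<comment> \<open>The point 1 lies on the cut, so \<open>hypergeometric\<close> is the plain
    series there, and the upper parameter -n makes it finite.\<close>
  have "(1 :: complex) \<notin> cut_plane" by (auto simp: cut_plane_def image_iff intro!: bexI[of _ 1])
  then have "hypergeometric [- of_nat n, of_nat n + a + b + c + d - 1, a + \<i> * of_real x, a - \<i> * of_real x]
       [a + b, a + c, a + d] 1
     = (\<Sum>j. wilson_ratio n a b c d j * pochhammer_pair a j x)"
    by (simp add: hypergeometric_def hypergeometric_series_def wilson_ratio_def pochhammer_pair_def mult_ac)
  also have "\<dots> = (\<Sum>j\<le>n. wilson_ratio n a b c d j * pochhammer_pair a j x)"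
    by (rule suminf_finite) (auto simp: wilson_ratio_def pochhammer_of_nat_eq_0_iff)
  finally show ?thesis by (simp add: wilson_def)
qed

lemma Gamma_add_of_nat: "Re z > 0 \<Longrightarrow> Gamma (z + of_nat n) = pochhammer z n * Gamma z"
  by (simp add: pochhammer_Gamma Re_pos_not_nonpos_Int Gamma_eq_zero_iff)

lemma wilson_kernel_shift:
  assumes "Re a > 0" "Re b > 0"
  shows "wilson_kernel (a + of_nat j) (b + of_nat m) c d x = pochhammer_pair a j x * pochhammer_pair b m x * wilson_kernel a b c d x"
  unfolding wilson_kernel_def gamma_pair_add_of_nat[OF assms(1)] gamma_pair_add_of_nat[OF assms(2)] pochhammer_pair_def
  by (simp only: mult_ac)

lemma has_integral_wilson_kernel_shift:
  assumes "Re a > 0" "Re b > 0" "Re c > 0" "Re d > 0"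
  shows "has_bochner_integral lborel
    (\<lambda>x. pochhammer_pair a j x * pochhammer_pair b m x * wilson_kernel a b c d x)
    (4 * of_real pi * (Gamma (a + b + of_nat (j + m)) * Gamma (a + c + of_nat j) * Gamma (a + d + of_nat j) *
             Gamma (b + c + of_nat m) * Gamma (b + d + of_nat m) * Gamma (c + d)) / Gamma (a + b + c + d + of_nat (j + m)))"
proof -
  let ?a = "a + of_nat j" and ?b = "b + of_nat m"
  have re: "Re ?a > 0" "Re ?b > 0" using assms by auto
  have eq: "?a + ?b = a + b + of_nat (j + m)" "?a + c = a + c + of_nat j" "?a + d = a + d + of_nat j"
    "?b + c = b + c + of_nat m" "?b + d = b + d + of_nat m" "a + b + of_nat (j + m) + c + d = a + b + c + d + of_nat (j + m)"
    by simp_all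
  show ?thesis
    unfolding wilson_kernel_shift[OF assms(1,2), symmetric]
    using has_bochner_integral_integrable[OF integrable_wilson_kernel[OF re assms(3,4)]]
    unfolding wilson_integral[OF re assms(3,4)] unfolding eq .
qed

lemma pochhammer_reflect: "pochhammer (1 - of_nat k - z) k = (- 1) ^ k * pochhammer (z :: complex) k"
  using pochhammer_minus[of "z + of_nat k - 1" k] by (simp add: algebra_simps)

text \<open>With W_k expanded at a and the test factor based at b, both only shift parameters of the
  Wilson integral. The factors (a + c)_j and (a + d)_j cancel, and a balanced 3F2 at 1 remains. Its
  value contains (-m)_k, which vanishes for m < k: this is the orthogonality.\<close>

theorem wilson_moment:
  assumes "Re a > 0" "Re b > 0" "Re c > 0" "Re d > 0"
  shows "has_bochner_integral lborel
    (\<lambda>x. wilson k (of_real x) a b c d * pochhammer_pair b m x * wilson_kernel a b c d x)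
    (4 * of_real pi * (pochhammer (- of_nat m) k * Gamma (a + b + of_nat m) * Gamma (b + c + of_nat m) * Gamma (b + d + of_nat m)
       * Gamma (a + c + of_nat k) * Gamma (a + d + of_nat k) * Gamma (c + d + of_nat k)) / Gamma (a + b + c + d + of_nat (m + k)))"
proof -
  define s where "s = a + b + c + d"
  define G where "G j = 4 * of_real pi * (Gamma (a + b + of_nat (j + m)) * Gamma (a + c + of_nat j) * Gamma (a + d + of_nat j) *
             Gamma (b + c + of_nat m) * Gamma (b + d + of_nat m) * Gamma (c + d)) / Gamma (s + of_nat (j + m))" for j
  define p where "p = pochhammer (a + b) k * pochhammer (a + c) k * pochhammer (a + d) k"
  have re: "Re (a + b) > 0" "Re (a + c) > 0" "Re (a + d) > 0" "Re (b + c) > 0" "Re (b + d) > 0" "Re (c + d) > 0" "Re s > 0"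
    "Re (a + b + of_nat m) > 0" "Re (s + of_nat m) > 0"
    using assms by (auto simp: s_def)
  have "has_bochner_integral lborel
    (\<lambda>x. p * (\<Sum>j\<le>k. wilson_ratio k a b c d j * (pochhammer_pair a j x * pochhammer_pair b m x * wilson_kernel a b c d x)))
    (p * (\<Sum>j\<le>k. wilson_ratio k a b c d j * G j))"
  proof -
    have "has_bochner_integral lborel
      (\<lambda>x. wilson_ratio k a b c d j * (pochhammer_pair a j x * pochhammer_pair b m x * wilson_kernel a b c d x))
      (wilson_ratio k a b c d j * G j)" for j
      unfolding G_def s_def by (rule has_bochner_integral_mult_right[OF has_integral_wilson_kernel_shift[OF assms]])
    from has_bochner_integral_mult_right[OF has_bochner_integral_sum[where I = "{..k}", OF this], of p] show ?thesis .
  qed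
  also have "(\<lambda>x. p * (\<Sum>j\<le>k. wilson_ratio k a b c d j * (pochhammer_pair a j x * pochhammer_pair b m x * wilson_kernel a b c d x)))
     = (\<lambda>x. wilson k (of_real x) a b c d * pochhammer_pair b m x * wilson_kernel a b c d x)"
    unfolding wilson_altdef p_def[symmetric] by (simp only: sum_distrib_left sum_distrib_right mult_ac)
  also have "p * (\<Sum>j\<le>k. wilson_ratio k a b c d j * G j) =
      4 * of_real pi * (pochhammer (- of_nat m) k * Gamma (a + b + of_nat m) * Gamma (b + c + of_nat m) * Gamma (b + d + of_nat m)
       * Gamma (a + c + of_nat k) * Gamma (a + d + of_nat k) * Gamma (c + d + of_nat k)) / Gamma (a + b + c + d + of_nat (m + k))"
  proof -
    define Q where "Q = 4 * of_real pi * (Gamma (a + b + of_nat m) * Gamma (a + c) * Gamma (a + d) *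
             Gamma (b + c + of_nat m) * Gamma (b + d + of_nat m) * Gamma (c + d)) / Gamma (s + of_nat m)"
    have t: "wilson_ratio k a b c d j * G j = Q * (pochhammer (- of_nat k) j * pochhammer (of_nat k + s - 1) j
        * pochhammer (a + b + of_nat m) j / (fact j * pochhammer (a + b) j * pochhammer (s + of_nat m) j))" for j
    proof -
      have g: "Gamma (a + b + of_nat (j + m)) = pochhammer (a + b + of_nat m) j * Gamma (a + b + of_nat m)"
        "Gamma (s + of_nat (j + m)) = pochhammer (s + of_nat m) j * Gamma (s + of_nat m)"
        using Gamma_add_of_nat[OF re(8), of j] Gamma_add_of_nat[OF re(9), of j] by (simp_all add: add_ac)
      have w: "wilson_ratio k a b c d j = pochhammer (- of_nat k) j * pochhammer (of_nat k + s - 1) j /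
         (pochhammer (a + b) j * pochhammer (a + c) j * pochhammer (a + d) j * fact j)"
        by (simp add: wilson_ratio_def s_def add_ac)
      show ?thesis
        unfolding w G_def Q_def g Gamma_add_of_nat[OF re(2)] Gamma_add_of_nat[OF re(3)]
        using pochhammer_Re_pos_nonzero[OF re(2), of j] pochhammer_Re_pos_nonzero[OF re(3), of j]
        by (simp add: divide_simps)
    qed
    have S: "(\<Sum>j\<le>k. pochhammer (- of_nat k) j * pochhammer (of_nat k + s - 1) j
        * pochhammer (a + b + of_nat m) j / (fact j * pochhammer (a + b) j * pochhammer (s + of_nat m) j))
       = (- 1) ^ k * pochhammer (a + b - (of_nat k + s - 1)) k * pochhammer (a + b - (a + b + of_nat m)) k
          / (pochhammer (a + b) k * pochhammer (s + of_nat m) k)"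
      by (rule saalschuetz) (use re in \<open>auto simp: pochhammer_Re_pos_nonzero\<close>)
    have r1: "a + b - (of_nat k + s - 1) = 1 - of_nat k - (c + d)" "a + b - (a + b + of_nat m) = - of_nat m"
      by (simp_all add: s_def)
    have gs: "Gamma (a + b + c + d + of_nat (m + k)) = pochhammer (s + of_nat m) k * Gamma (s + of_nat m)"
      using Gamma_add_of_nat[OF re(9), of k] by (simp add: s_def add_ac)
    have m1: "(- 1) ^ k * ((- 1) ^ k * z) = (z :: complex)" for z
      by (simp flip: power_mult_distrib mult.assoc)
    show ?thesis
      unfolding t sum_distrib_left[symmetric] S r1 pochhammer_reflect gs p_def Q_def m1
        Gamma_add_of_nat[OF re(2)] Gamma_add_of_nat[OF re(3)] Gamma_add_of_nat[OF re(6)]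
      using pochhammer_Re_pos_nonzero[OF re(1), of k]
      by (simp add: divide_simps)
  qed
  finally show ?thesis .
qed

text \<open>The variable of these polynomials is \<open>x\<^sup>2\<close>.\<close>
definition pair_poly :: "complex \<Rightarrow> nat \<Rightarrow> complex poly" where
  "pair_poly a m = (\<Prod>i<m. [:(a + of_nat i)\<^sup>2, 1:])"

lemma poly_pair_poly: "poly (pair_poly a m) (of_real (x\<^sup>2)) = pochhammer_pair a m x"
proof -
  have "(a + of_nat i)\<^sup>2 + of_real (x\<^sup>2) = (a + \<i> * of_real x + of_nat i) * (a - \<i> * of_real x + of_nat i)" for i
  proof -
    have "(a + \<i> * of_real x + of_nat i) * (a - \<i> * of_real x + of_nat i) = (a + of_nat i)\<^sup>2 - (\<i> * of_real x)\<^sup>2"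
      by (simp add: algebra_simps power2_eq_square)
    then show ?thesis by (simp only: power_mult_distrib i_squared power2_i mult_minus1 diff_minus_eq_add of_real_power)
  qed
  then have "(\<Prod>i<m. (a + of_nat i)\<^sup>2 + of_real (x\<^sup>2)) = pochhammer_pair a m x"
    unfolding pochhammer_pair_def pochhammer_prod atLeast0LessThan prod.distrib[symmetric]
    by (rule prod.cong[OF refl])
  then show ?thesis
    unfolding pair_poly_def poly_prod by simp
qed

lemma monic_pair_poly: "degree (pair_poly a m) = m" "coeff (pair_poly a m) m = 1"
proof -
  have "degree (pair_poly a m) = m \<and> lead_coeff (pair_poly a m) = 1"
  proof (induction m)
    case (Suc m)
    have step: "pair_poly a (Suc m) = pair_poly a m * [:(a + of_nat m)\<^sup>2, 1:]"
      by (simp add: pair_poly_def)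
    have "pair_poly a m \<noteq> 0" using Suc by auto
    then have "degree (pair_poly a (Suc m)) = Suc m"
      unfolding step using Suc by (subst degree_mult_eq) auto
    moreover have "lead_coeff (pair_poly a (Suc m)) = 1"
      unfolding step lead_coeff_mult conjunct2[OF Suc] by simp
    ultimately show ?case by blast
  qed (simp add: pair_poly_def)
  note h = this
  show d: "degree (pair_poly a m) = m" by (rule conjunct1[OF h])
  show "coeff (pair_poly a m) m = 1" using conjunct2[OF h] unfolding d .
qed

text \<open>The \<open>pair_poly b m\<close> are monic, one of each degree, so subtracting a
  multiple of the top one lowers the degree. A property closed under linear combinations may
  therefore be tested on them.\<close>

lemma pair_poly_induct [consumes 1, case_names basis add smult]:
  assumes "degree p \<le> N"
    and "\<And>m. m \<le> N \<Longrightarrow> P (pair_poly b m)"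
    and "\<And>p q. P p \<Longrightarrow> P q \<Longrightarrow> P (p + q)"
    and "\<And>c p. P p \<Longrightarrow> P (smult c p)"
  shows "P p"
  using assms(1,2)
proof (induction N arbitrary: p)
  case 0
  have "smult (coeff p 0) (pair_poly b 0) = p"
    using 0(1) by (simp add: pair_poly_def degree_0_id)
  then show ?case using assms(4)[OF 0(2)[OF order_refl], of "coeff p 0"] by simp
next
  case (Suc N)
  define r where "r = p - smult (coeff p (Suc N)) (pair_poly b (Suc N))"
  have "degree r \<le> N"
  proof (rule degree_le, intro allI impI)
    fix i assume "N < i"
    show "coeff r i = 0"
    proof (cases "i = Suc N")
      case False
      with \<open>N < i\<close> have "i > Suc N" by simp
      with Suc.prems(1) show ?thesis by (simp add: r_def coeff_eq_0 monic_pair_poly)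
    qed (simp add: r_def monic_pair_poly)
  qed
  then have "P r" by (rule Suc.IH) (rule Suc.prems(2), simp)
  from assms(3)[OF this assms(4)[OF Suc.prems(2)[OF order_refl], of "coeff p (Suc N)"]]
  show ?case by (simp add: r_def)
qed

text \<open>The integral of \<open>W\<^sub>k\<close> against a monic polynomial of degree \<open>k\<close> in \<open>x\<^sup>2\<close>, not the squared norm of \<open>W\<^sub>k\<close>.\<close>
definition wilson_norm :: "nat \<Rightarrow> complex \<Rightarrow> complex \<Rightarrow> complex \<Rightarrow> complex \<Rightarrow> complex" where
  "wilson_norm k a b c d =
    4 * of_real pi * ((- 1) ^ k * fact k * Gamma (a + b + of_nat k) * Gamma (b + c + of_nat k) * Gamma (b + d + of_nat k)
       * Gamma (a + c + of_nat k) * Gamma (a + d + of_nat k) * Gamma (c + d + of_nat k)) / Gamma (a + b + c + d + of_nat (k + k))"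

text \<open>On the basis \<open>pair_poly b m\<close> the factor (-m)_k of the moment vanishes for m
  < k and equals (-1)^k k! for m = k, so only the leading coefficient is seen.\<close>

theorem wilson_orthogonal:
  assumes "Re a > 0" "Re b > 0" "Re c > 0" "Re d > 0" and "degree p \<le> k"
  shows "has_bochner_integral lborel
    (\<lambda>x. wilson k (of_real x) a b c d * poly p (of_real (x\<^sup>2)) * wilson_kernel a b c d x)
    (coeff p k * wilson_norm k a b c d)"
  using assms(5)
proof (induction p rule: pair_poly_induct[where b = b])
  case (basis m)
  have "pochhammer (- of_nat m :: complex) k = (if m = k then (- 1) ^ k * fact k else 0)"
    using basis by (simp add: pochhammer_same pochhammer_of_nat_eq_0_iff)
  moreover have "coeff (pair_poly b m) k = (if m = k then 1 else 0)"
    using basis by (simp add: monic_pair_poly coeff_eq_0)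
  ultimately show ?case
    using wilson_moment[OF assms(1-4), of k m] unfolding poly_pair_poly
    by (cases "m = k") (simp_all add: wilson_norm_def)
next
  case (add p q)
  from has_bochner_integral_add[OF this] show ?case
    by (simp only: poly_add coeff_add distrib_left distrib_right)
next
  case (smult e p)
  from has_bochner_integral_mult_right[OF this, of e] show ?case
    by (simp only: poly_smult coeff_smult mult_ac)
qed

definition wilson_poly :: "nat \<Rightarrow> complex \<Rightarrow> complex \<Rightarrow> complex \<Rightarrow> complex \<Rightarrow> complex poly" where
  "wilson_poly n a b c d = smult (pochhammer (a + b) n * pochhammer (a + c) n * pochhammer (a + d) n)
     (\<Sum>j\<le>n. smult (wilson_ratio n a b c d j) (pair_poly a j))"

lemma poly_wilson_poly: "poly (wilson_poly n a b c d) (of_real (x\<^sup>2)) = wilson n (of_real x) a b c d"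
  by (simp only: wilson_poly_def wilson_altdef poly_smult poly_sum poly_pair_poly)

lemma degree_wilson_poly: "degree (wilson_poly n a b c d) \<le> n"
  unfolding wilson_poly_def
  by (intro order_trans[OF degree_smult_le] degree_sum_le) (auto intro: order_trans[OF degree_smult_le] simp: monic_pair_poly)

text \<open>Only j = n reaches degree n. The value is symmetric in a, b, c, d, which makes the
  leading terms cancel when Wilson polynomials with permuted parameters are compared.\<close>

lemma coeff_wilson_poly:
  assumes "Re a > 0" "Re b > 0" "Re c > 0" "Re d > 0"
  shows "coeff (wilson_poly n a b c d) n = (- 1) ^ n * pochhammer (of_nat n + a + b + c + d - 1) n"
proof -
  have "coeff (\<Sum>j\<le>n. smult (wilson_ratio n a b c d j) (pair_poly a j)) n = (\<Sum>j\<in>{n}. wilson_ratio n a b c d j)"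
    unfolding coeff_sum
    by (intro sum.mono_neutral_cong_right) (auto simp: monic_pair_poly coeff_eq_0)
  then have "coeff (wilson_poly n a b c d) n = pochhammer (a + b) n * pochhammer (a + c) n * pochhammer (a + d) n
      * wilson_ratio n a b c d n"
    by (simp only: wilson_poly_def coeff_smult sum.insert finite.emptyI empty_iff not_False_eq_True sum.empty add_0_right)
  moreover have "wilson_ratio n a b c d n = ((- 1) ^ n * pochhammer (of_nat n + a + b + c + d - 1) n)
      / (pochhammer (a + b) n * pochhammer (a + c) n * pochhammer (a + d) n)"
    unfolding wilson_ratio_def pochhammer_same by simp
  moreover have "pochhammer (a + b) n * pochhammer (a + c) n * pochhammer (a + d) n \<noteq> 0"
    using assms by (auto simp: pochhammer_Re_pos_nonzero)
  ultimately show ?thesis by simp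
qed

section \<open>The generating function\<close>

lemma prod_list_shift_tendsto:
  fixes as :: "'a :: real_normed_field list"
  shows "(\<lambda>n. (\<Prod>a\<leftarrow>as. a + of_nat n) / of_nat n ^ length as) \<longlonglongrightarrow> 1"
proof (induction as)
  case (Cons a as)
  have "(\<lambda>n. a / of_nat n + 1) \<longlonglongrightarrow> 0 + 1"
    by (intro tendsto_add tendsto_const tendsto_divide_0[OF tendsto_const] tendsto_of_nat)
  from tendsto_mult[OF this Cons.IH]
  have "(\<lambda>n. (a / of_nat n + 1) * ((\<Prod>a\<leftarrow>as. a + of_nat n) / of_nat n ^ length as)) \<longlonglongrightarrow> 1"
    by simp
  moreover have "\<forall>\<^sub>F n in sequentially. (a / of_nat n + 1) * ((\<Prod>a\<leftarrow>as. a + of_nat n) / of_nat n ^ length as)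
     = (\<Prod>a\<leftarrow>a#as. a + of_nat n) / of_nat n ^ length (a # as)"
    using eventually_gt_at_top[of 0] by eventually_elim (simp add: divide_simps)
  ultimately show ?case
    by (rule Lim_transform_eventually)
qed simp

lemma summable_pochhammer_ratio:
  fixes as bs :: "'a :: real_normed_field list" and z :: 'a
  assumes len: "length as = length bs" and z: "norm z < 1"
  shows "summable (\<lambda>n. norm ((\<Prod>a\<leftarrow>as. pochhammer a n) / (\<Prod>b\<leftarrow>bs. pochhammer b n) * z ^ n))"
proof -
  define t where "t n = (\<Prod>a\<leftarrow>as. pochhammer a n) / (\<Prod>b\<leftarrow>bs. pochhammer b n) * z ^ n" for n
  define r where "r n = (\<Prod>a\<leftarrow>as. a + of_nat n) / (\<Prod>b\<leftarrow>bs. b + of_nat n) * z" for n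
  have pr: "(\<Prod>a\<leftarrow>as. pochhammer a (Suc n)) = (\<Prod>a\<leftarrow>as. pochhammer a n) * (\<Prod>a\<leftarrow>as. a + of_nat n)" for n and as :: "'a list"
    by (induction as) (simp_all add: pochhammer_Suc mult_ac)
  \<comment> \<open>As x / 0 = 0, this also holds when a lower parameter is a nonpositive integer;
    the terms are then 0 from some point on.\<close>
  have t_Suc: "t (Suc n) = r n * t n" for n
    unfolding t_def r_def pr by (simp add: mult_ac)
  have "(\<lambda>n. ((\<Prod>a\<leftarrow>as. a + of_nat n) / of_nat n ^ length as) / ((\<Prod>b\<leftarrow>bs. b + of_nat n) / of_nat n ^ length bs) * z)
     \<longlonglongrightarrow> 1 / 1 * z"
    by (intro tendsto_intros prod_list_shift_tendsto) simp
  moreover have "\<forall>\<^sub>F n in sequentially.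
     ((\<Prod>a\<leftarrow>as. a + of_nat n) / of_nat n ^ length as) / ((\<Prod>b\<leftarrow>bs. b + of_nat n) / of_nat n ^ length bs) * z = r n"
    using eventually_gt_at_top[of 0] by eventually_elim (simp add: r_def len)
  ultimately have "r \<longlonglongrightarrow> z"
    by (simp add: Lim_transform_eventually)
  then have "(\<lambda>n. norm (r n)) \<longlonglongrightarrow> norm z" by (rule tendsto_norm)
  moreover obtain c where c: "norm z < c" "c < 1" using z dense by blast
  ultimately have "\<forall>\<^sub>F n in sequentially. norm (r n) < c" by (simp add: order_tendsto_iff)
  then obtain N where N: "\<And>n. n \<ge> N \<Longrightarrow> norm (r n) < c" by (auto simp: eventually_at_top_linorder)
  have "summable (\<lambda>n. norm (t n))"
  proof (rule summable_ratio_test[OF c(2)])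
    show "norm (norm (t (Suc n))) \<le> c * norm (norm (t n))" if "n \<ge> N" for n
      using N[OF that] by (simp add: t_Suc norm_mult mult_right_mono less_imp_le)
  qed
  then show ?thesis by (simp add: t_def)
qed

lemma hypergeometric_series_summable:
  fixes z :: complex
  assumes "length as = length bs + 1" "norm z < 1"
  shows "summable (\<lambda>n. norm ((\<Prod>a\<leftarrow>as. pochhammer a n) / (\<Prod>b\<leftarrow>bs. pochhammer b n) * z ^ n / fact n))"
  using summable_pochhammer_ratio[of as "1 # bs" z] assms
  by (simp add: pochhammer_fact[symmetric] mult_ac)

lemma hypergeometric_series_sums:
  assumes "length as = length bs + 1" "norm z < 1"
  shows "(\<lambda>n. (\<Prod>a\<leftarrow>as. pochhammer a n) / (\<Prod>b\<leftarrow>bs. pochhammer b n) * z ^ n / fact n) sums hypergeometric_series as bs z"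
  unfolding hypergeometric_series_def
  by (rule summable_sums[OF summable_norm_cancel[OF hypergeometric_series_summable[OF assms]]])

lemma hypergeometric_series_holomorphic:
  assumes "length as = length bs + 1"
  shows "hypergeometric_series as bs holomorphic_on ball 0 1"
proof (rule power_series_holomorphic)
  fix z :: complex assume "z \<in> ball 0 1"
  then have "norm z < 1" by simp
  from hypergeometric_series_sums[OF assms this]
  show "(\<lambda>n. ((\<Prod>a\<leftarrow>as. pochhammer a n) / (\<Prod>b\<leftarrow>bs. pochhammer b n) / fact n) * (z - 0) ^ n) sums hypergeometric_series as bs z"
    by simp
qed

lemma gbinomial_minus_power:
  fixes \<beta> z :: "'a :: field_char_0"
  shows "(- \<beta> gchoose n) * (- z) ^ n = pochhammer \<beta> n / fact n * z ^ n"
proof -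
  have m: "(- 1) ^ n * ((- 1) ^ n * x) = x" for x :: 'a
    by (simp flip: power_mult_distrib mult.assoc)
  have "(- \<beta> gchoose n) * (- z) ^ n = (- 1) ^ n * ((- 1) ^ n * (pochhammer \<beta> n / fact n * z ^ n))"
    unfolding gbinomial_pochhammer power_minus[of z] minus_minus by (simp only: mult_ac times_divide_eq_left times_divide_eq_right)
  then show ?thesis by (simp only: m)
qed

lemma pochhammer_binomial_sums:
  "norm (z :: complex) < 1 \<Longrightarrow> (\<lambda>n. pochhammer \<beta> n / fact n * z ^ n) sums (1 - z) powr (- \<beta>)"
  using gen_binomial_complex[of "- z" "- \<beta>"] by (simp only: gbinomial_minus_power norm_minus_cancel add_uminus_conv_diff)

lemma pochhammer_binomial_sums_real:
  "\<bar>z :: real\<bar> < 1 \<Longrightarrow> (\<lambda>n. pochhammer \<beta> n / fact n * z ^ n) sums (1 - z) powr (- \<beta>)"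
  using gen_binomial_real[of "- z" "- \<beta>"] by (simp only: gbinomial_minus_power abs_minus_cancel add_uminus_conv_diff)

lemma norm_pochhammer_le: "norm (pochhammer (z :: 'a :: real_normed_field) n) \<le> pochhammer (norm z) n"
  unfolding pochhammer_prod prod_norm[symmetric]
  by (intro prod_mono) (auto intro!: norm_triangle_le)

lemma pochhammer_norm_nonneg: "pochhammer (norm z) n \<ge> (0 :: real)"
  unfolding pochhammer_prod by (intro prod_nonneg) auto

text \<open>Expanding (1 - \<rho>)^(-(\<alpha> + 2m)) binomially gives a double series in (m, j)
  with the symbols (\<alpha>)_(2m + j). Its rows sum to the second series, its diagonals n = m + j
  to the first. The hypothesis is absolute convergence: it sums the rows of the majorant in which
  \<alpha> and \<rho> are replaced by their moduli, up to the factor (1 -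
  |\<rho>|)^(-|\<alpha>|).\<close>

lemma pochhammer_double_series:
  fixes G :: "nat \<Rightarrow> complex" and \<alpha> \<rho> :: complex
  assumes \<rho>: "norm \<rho> < 1"
    and G: "summable (\<lambda>m. norm (G m) * pochhammer (norm \<alpha>) (2 * m) * (norm \<rho> / (1 - norm \<rho>)\<^sup>2) ^ m)"
  shows "\<exists>S. (\<lambda>n. (\<Sum>m\<le>n. G m * pochhammer \<alpha> (n + m) / fact (n - m)) * \<rho> ^ n) sums S \<and>
             (\<lambda>m. G m * pochhammer \<alpha> (2 * m) * \<rho> ^ m * (1 - \<rho>) powr (- (\<alpha> + of_nat (2 * m)))) sums S"
proof -
  define f where "f = (\<lambda>(m, j). G m * pochhammer \<alpha> (2 * m + j) / fact j * \<rho> ^ (m + j))"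
  define r where "r = norm \<rho>"
  define \<sigma> where "\<sigma> = norm \<alpha>"
  define B where "B = (\<lambda>(m, j). norm (G m) * pochhammer \<sigma> (2 * m + j) / fact j * r ^ (m + j))"
  have r: "0 \<le> r" "r < 1" using \<rho> by (auto simp: r_def)
  have B_nonneg: "B x \<ge> 0" for x
    using r pochhammer_norm_nonneg[of \<alpha>] by (auto simp: B_def \<sigma>_def split: prod.split)
  have f_le: "norm (f x) \<le> norm (B x)" for x
    using norm_pochhammer_le[of \<alpha>] r
    by (auto simp: f_def B_def \<sigma>_def r_def norm_mult norm_divide norm_power abs_mult pochhammer_norm_nonneg
             split: prod.split intro!: mult_right_mono divide_right_mono mult_left_mono)
  have B_sum: "((\<lambda>j. B (m, j)) has_sum (norm (G m) * pochhammer \<sigma> (2 * m) * (r / (1 - r)\<^sup>2) ^ m * (1 - r) powr (- \<sigma>))) UNIV" for m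
  proof (rule sums_nonneg_imp_has_sum[OF _ B_nonneg])
    have "(\<lambda>j. norm (G m) * pochhammer \<sigma> (2 * m) * r ^ m * (pochhammer (\<sigma> + of_nat (2 * m)) j / fact j * r ^ j))
        sums (norm (G m) * pochhammer \<sigma> (2 * m) * r ^ m * (1 - r) powr (- (\<sigma> + of_nat (2 * m))))"
      using r by (intro sums_mult pochhammer_binomial_sums_real) auto
    moreover have "norm (G m) * pochhammer \<sigma> (2 * m) * r ^ m * (pochhammer (\<sigma> + of_nat (2 * m)) j / fact j * r ^ j) = B (m, j)" for j
      using pochhammer_product'[of \<sigma> "2 * m" j] by (simp add: B_def power_add mult_ac)
    moreover have "(1 - r) powr (- (\<sigma> + of_nat (2 * m))) = (1 - r) powr (- \<sigma>) / ((1 - r)\<^sup>2) ^ m"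
    proof -
      have "(1 - r) powr (- (\<sigma> + of_nat (2 * m))) = (1 - r) powr (- \<sigma> - of_nat (2 * m))" by simp
      also have "\<dots> = (1 - r) powr (- \<sigma>) / (1 - r) ^ (2 * m)"
        unfolding powr_diff using r powr_realpow[of "1 - r" "2 * m"] by simp
      finally show ?thesis by (simp add: power_mult)
    qed
    ultimately show "(\<lambda>j. B (m, j)) sums (norm (G m) * pochhammer \<sigma> (2 * m) * (r / (1 - r)\<^sup>2) ^ m * (1 - r) powr (- \<sigma>))"
      by (simp add: power_divide mult_ac)
  qed
  have "B summable_on (UNIV \<times> UNIV)"
  proof (rule summable_on_SigmaI[OF B_sum])
    have "summable (\<lambda>m. norm (G m) * pochhammer \<sigma> (2 * m) * (r / (1 - r)\<^sup>2) ^ m * (1 - r) powr (- \<sigma>))"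
      using G unfolding r_def \<sigma>_def by (rule summable_mult2)
    then show "(\<lambda>m. norm (G m) * pochhammer \<sigma> (2 * m) * (r / (1 - r)\<^sup>2) ^ m * (1 - r) powr (- \<sigma>)) summable_on UNIV"
      using r pochhammer_norm_nonneg[of \<alpha>] by (intro summable_nonneg_imp_summable_on) (auto simp: \<sigma>_def)
  qed (rule B_nonneg)
  then have "(\<lambda>x. norm (B x)) summable_on (UNIV \<times> UNIV)" using B_nonneg by simp
  then have "(\<lambda>x. norm (f x)) summable_on (UNIV \<times> UNIV)"
    by (rule Infinite_Sum.abs_summable_on_comparison_test) (rule f_le)
  then have "f summable_on (UNIV \<times> UNIV)" by (rule Infinite_Sum.abs_summable_summable)
  then obtain S where S: "(f has_sum S) (UNIV \<times> UNIV)" by (auto simp: summable_on_def)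
  have "(\<lambda>m. G m * pochhammer \<alpha> (2 * m) * \<rho> ^ m * (1 - \<rho>) powr (- (\<alpha> + of_nat (2 * m)))) sums S"
  proof (rule has_sum_imp_sums, rule has_sum_SigmaD[OF S])
    fix m
    show "((\<lambda>j. f (m, j)) has_sum (G m * pochhammer \<alpha> (2 * m) * \<rho> ^ m * (1 - \<rho>) powr (- (\<alpha> + of_nat (2 * m))))) UNIV"
    proof (rule norm_summable_imp_has_sum)
      have "summable (\<lambda>j. B (m, j))" using has_sum_imp_sums[OF B_sum[of m]] by (rule sums_summable)
      then show "summable (\<lambda>j. norm (f (m, j)))"
      proof (rule summable_comparison_test')
        show "norm (norm (f (m, j))) \<le> B (m, j)" for j
          using f_le[of "(m, j)"] B_nonneg[of "(m, j)"] by simp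
      qed
      have "(\<lambda>j. G m * pochhammer \<alpha> (2 * m) * \<rho> ^ m * (pochhammer (\<alpha> + of_nat (2 * m)) j / fact j * \<rho> ^ j))
        sums (G m * pochhammer \<alpha> (2 * m) * \<rho> ^ m * (1 - \<rho>) powr (- (\<alpha> + of_nat (2 * m))))"
        using \<rho> by (intro sums_mult pochhammer_binomial_sums)
      moreover have "G m * pochhammer \<alpha> (2 * m) * \<rho> ^ m * (pochhammer (\<alpha> + of_nat (2 * m)) j / fact j * \<rho> ^ j) = f (m, j)" for j
        using pochhammer_product'[of \<alpha> "2 * m" j] by (simp add: f_def power_add mult_ac)
      ultimately show "(\<lambda>j. f (m, j)) sums (G m * pochhammer \<alpha> (2 * m) * \<rho> ^ m * (1 - \<rho>) powr (- (\<alpha> + of_nat (2 * m))))"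
        by simp
    qed
  qed
  moreover have "(\<lambda>n. (\<Sum>m\<le>n. G m * pochhammer \<alpha> (n + m) / fact (n - m)) * \<rho> ^ n) sums S"
  proof (rule has_sum_imp_sums, rule has_sum_SigmaD[where B = "\<lambda>n. {..n}"])
    have "bij_betw (\<lambda>(n, m). (m, n - m)) (Sigma UNIV (\<lambda>n. {..n})) (UNIV \<times> (UNIV :: nat set))"
      by (rule bij_betwI[where g = "\<lambda>(m, j). (m + j, m)"]) auto
    from has_sum_reindex_bij_betw[OF this, of f S] S
    show "((\<lambda>x. f (case x of (n, m) \<Rightarrow> (m, n - m))) has_sum S) (Sigma UNIV (\<lambda>n. {..n}))" by simp
    fix n :: nat
    have "(\<Sum>m\<le>n. f (m, n - m)) = (\<Sum>m\<le>n. G m * pochhammer \<alpha> (n + m) / fact (n - m)) * \<rho> ^ n"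
      unfolding sum_distrib_right
    proof (intro sum.cong refl)
      fix m assume "m \<in> {..n}"
      then have "2 * m + (n - m) = n + m" "m + (n - m) = n" by auto
      then show "f (m, n - m) = G m * pochhammer \<alpha> (n + m) / fact (n - m) * \<rho> ^ n" by (simp only: f_def case_prod_conv)
    qed
    then show "((\<lambda>m. f (case (n, m) of (n, m) \<Rightarrow> (m, n - m))) has_sum
        ((\<Sum>m\<le>n. G m * pochhammer \<alpha> (n + m) / fact (n - m)) * \<rho> ^ n)) {..n}"
      by (intro has_sum_finiteI) auto
  qed
  ultimately show ?thesis by blast
qed

text \<open>The inverse of \<open>\<rho> \<mapsto> -4\<rho>/(1 - \<rho>)\<^sup>2\<close> on the cut plane.\<close>
definition unit_disk_coordinate :: "complex \<Rightarrow> complex" where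
  "unit_disk_coordinate z = (csqrt (1 - z) - 1) / (csqrt (1 - z) + 1)"

lemma cut_plane_one_minus: "z \<in> cut_plane \<Longrightarrow> 1 - z \<notin> \<real>\<^sub>\<le>\<^sub>0"
proof
  assume z: "z \<in> cut_plane" and "1 - z \<in> \<real>\<^sub>\<le>\<^sub>0"
  then obtain t where t: "1 - z = of_real t" "t \<le> 0" by (auto simp: nonpos_Reals_def)
  then have "z = of_real (1 - t)" by (simp add: algebra_simps)
  moreover have "1 - t \<in> {1..}" using t by simp
  ultimately have "z \<in> complex_of_real ` {1..}" by (rule image_eqI)
  then show False using z by (simp add: cut_plane_def)
qed

lemma Re_csqrt_pos: "w \<notin> \<real>\<^sub>\<le>\<^sub>0 \<Longrightarrow> Re (csqrt w) > 0"
proof (rule ccontr)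
  assume w: "w \<notin> \<real>\<^sub>\<le>\<^sub>0" and "\<not> Re (csqrt w) > 0"
  then have "Re (csqrt w) = 0" using Re_csqrt[of w] by linarith
  then have c: "csqrt w = \<i> * of_real (Im (csqrt w))" by (simp add: complex_eq_iff)
  have "w = (csqrt w)\<^sup>2" by simp
  also have "\<dots> = of_real (- (Im (csqrt w))\<^sup>2)" by (subst c) (simp add: power_mult_distrib)
  finally have "w \<in> \<real>\<^sub>\<le>\<^sub>0" by (metis neg_le_0_iff_le nonpos_Reals_of_real_iff zero_le_power2)
  with w show False by contradiction
qed

lemma norm_Cayley_less_1:
  assumes "Re w > 0" shows "norm ((w - 1) / (w + 1)) < 1"
proof -
  have "(norm (w - 1))\<^sup>2 < (norm (w + 1))\<^sup>2"
    unfolding cmod_power2 using assms by (simp add: power2_eq_square algebra_simps)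
  then have "norm (w - 1) < norm (w + 1)" by (rule power2_less_imp_less) simp
  then show ?thesis by (simp add: norm_divide divide_less_eq_1)
qed

lemma norm_unit_disk_coordinate: "z \<in> cut_plane \<Longrightarrow> norm (unit_disk_coordinate z) < 1"
  unfolding unit_disk_coordinate_def by (intro norm_Cayley_less_1 Re_csqrt_pos cut_plane_one_minus)

lemma unit_disk_coordinate_eq:
  assumes "z \<in> cut_plane"
  shows "- (4 * unit_disk_coordinate z / (1 - unit_disk_coordinate z)\<^sup>2) = z"
proof -
  define w where "w = csqrt (1 - z)"
  have "Re w > 0" unfolding w_def by (intro Re_csqrt_pos cut_plane_one_minus assms)
  then have w1: "w + 1 \<noteq> 0" by (auto simp: complex_eq_iff)
  have u: "unit_disk_coordinate z = (w - 1) / (w + 1)" by (simp add: unit_disk_coordinate_def w_def)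
  have u1: "1 - unit_disk_coordinate z = 2 / (w + 1)"
    unfolding u using w1 by (simp add: divide_simps)
  have "- (4 * unit_disk_coordinate z / (1 - unit_disk_coordinate z)\<^sup>2) = 1 - w\<^sup>2"
    unfolding u1 unfolding u using w1 by (simp add: divide_simps power2_eq_square) (simp add: algebra_simps)
  then show ?thesis by (simp add: w_def)
qed

text \<open>For z = -4 \<rho> / (1 - \<rho>)^2, 1 - z is the square of w = (1 + \<rho>) / (1 -
  \<rho>). Since Re w = (1 - |\<rho>|^2) / |1 - \<rho>|^2 > 0, w is the principal root and 1 - z
  avoids the negative axis.\<close>

lemma unit_disk_coordinate_inverse:
  assumes "norm \<rho> < 1"
  shows "- (4 * \<rho> / (1 - \<rho>)\<^sup>2) \<in> cut_plane"
    and "unit_disk_coordinate (- (4 * \<rho> / (1 - \<rho>)\<^sup>2)) = \<rho>"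
proof -
  define w where "w = (1 + \<rho>) / (1 - \<rho>)"
  have r1: "1 - \<rho> \<noteq> 0" using assms by auto
  have w: "1 - - (4 * \<rho> / (1 - \<rho>)\<^sup>2) = w\<^sup>2"
    unfolding w_def using r1 by (simp add: divide_simps power2_eq_square) (simp add: algebra_simps)
  have Re_w: "Re w > 0"
  proof -
    have "w = (1 + \<rho>) * cnj (1 - \<rho>) / of_real ((norm (1 - \<rho>))\<^sup>2)"
    proof -
      have "cnj (1 - \<rho>) \<noteq> 0" using r1 by (simp only: complex_cnj_zero_iff not_False_eq_True)
      from nonzero_mult_divide_mult_cancel_right[OF this, of "1 + \<rho>" "1 - \<rho>"] show ?thesis
        unfolding w_def complex_norm_square by (rule sym)
    qed
    then have "Re w = Re ((1 + \<rho>) * cnj (1 - \<rho>)) / (norm (1 - \<rho>))\<^sup>2"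
      by (simp only: Re_divide_of_real)
    also have "Re ((1 + \<rho>) * cnj (1 - \<rho>)) = 1 - (norm \<rho>)\<^sup>2"
      by (simp add: cmod_power2) (simp add: algebra_simps power2_eq_square)
    also have "(1 - (norm \<rho>)\<^sup>2) / (norm (1 - \<rho>))\<^sup>2 > 0"
      using assms r1 by (simp add: power_less_one_iff abs_square_less_1)
    finally show ?thesis .
  qed
  have sq: "csqrt (1 - - (4 * \<rho> / (1 - \<rho>)\<^sup>2)) = w"
    unfolding w using Re_w by (intro csqrt_square) auto
  show "- (4 * \<rho> / (1 - \<rho>)\<^sup>2) \<in> cut_plane"
  proof (rule ccontr)
    assume "\<not> ?thesis"
    then obtain t where t: "t \<ge> 1" "- (4 * \<rho> / (1 - \<rho>)\<^sup>2) = of_real t" by (auto simp: cut_plane_def)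
    then have "w\<^sup>2 = of_real (1 - t)" using w by simp
    then have "Im (w\<^sup>2) = 0" "Re (w\<^sup>2) \<le> 0" using t(1) by simp_all
    then have "2 * (Re w * Im w) = 0" "(Re w)\<^sup>2 - (Im w)\<^sup>2 \<le> 0"
      by (auto simp: power2_eq_square)
    then show False using Re_w by simp
  qed
  have w1: "w + 1 \<noteq> 0" using Re_w by (auto simp: complex_eq_iff)
  have "w + 1 = 2 / (1 - \<rho>)" "w - 1 = 2 * \<rho> / (1 - \<rho>)"
    unfolding w_def using r1 by (simp_all add: divide_simps)
  then show "unit_disk_coordinate (- (4 * \<rho> / (1 - \<rho>)\<^sup>2)) = \<rho>"
    unfolding unit_disk_coordinate_def sq using r1 by simp
qed

lemma unit_disk_coordinate_holomorphic: "unit_disk_coordinate holomorphic_on cut_plane"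
proof -
  have "csqrt (1 - z) + 1 \<noteq> 0" if "z \<in> cut_plane" for z
  proof
    assume "csqrt (1 - z) + 1 = 0"
    then have "csqrt (1 - z) = - 1" by (simp only: eq_neg_iff_add_eq_0)
    then show False using Re_csqrt_pos[OF cut_plane_one_minus[OF that]] by simp
  qed
  then show ?thesis
    unfolding unit_disk_coordinate_def[abs_def]
    by (intro holomorphic_intros holomorphic_on_csqrt') (auto dest: cut_plane_one_minus)
qed

section \<open>The generating function near 0 and on the whole disk\<close>

definition wilson_sum :: "nat \<Rightarrow> complex \<Rightarrow> complex \<Rightarrow> complex \<Rightarrow> complex \<Rightarrow> real \<Rightarrow> complex" where
  "wilson_sum n a b c d x = (\<Sum>j\<le>n. wilson_ratio n a b c d j * pochhammer_pair a j x)"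

definition wilson_gen_coeff :: "complex \<Rightarrow> complex \<Rightarrow> complex \<Rightarrow> complex \<Rightarrow> real \<Rightarrow> nat \<Rightarrow> complex" where
  "wilson_gen_coeff a b c d x n = pochhammer (a + b + c + d - 1) n / fact n * wilson_sum n a b c d x"

text \<open>The exact threshold is 3 - 2 sqrt 2, about 0.17; 1/12 is a simple number below it. It
  keeps the arguments of the 4F3 and of its majorant inside the unit disk.\<close>

lemma quarter_bound:
  assumes "0 \<le> r" "r < 1/12"
  shows "4 * (r / (1 - r)\<^sup>2) < (1::real)"
proof -
  have "(11/12)\<^sup>2 \<le> (1 - r)\<^sup>2" using assms by (intro power_mono) auto
  then have "4 * r < (1 - r)\<^sup>2" using assms by (simp add: power2_eq_square)
  then show ?thesis using assms by (simp add: divide_less_eq)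
qed

text \<open>In the n-th coefficient (\<alpha>)_n (\<alpha> + n)_m merges to (\<alpha>)_(n + m), and
  (-n)_m / n! becomes (-1)^m / (n - m)!, the shape of the double series with \<alpha> = a + b + c +
  d - 1. On the other side the duplication (\<alpha>)_(2m) = 4^m (\<alpha>/2)_m (\<alpha>/2 + 1/2)_m
  yields two upper parameters and the 4 of the argument.\<close>

lemma wilson_generating_small:
  fixes a b c d \<rho> :: complex and x :: real
  assumes \<rho>: "norm \<rho> < 1/12"
  shows "(\<lambda>n. wilson_gen_coeff a b c d x n * \<rho> ^ n) sums
    ((1 - \<rho>) powr (1 - a - b - c - d) *
      hypergeometric_series [(a + b + c + d - 1) / 2, (a + b + c + d) / 2, a + \<i> * of_real x, a - \<i> * of_real x]
        [a + b, a + c, a + d] (- (4 * \<rho> / (1 - \<rho>)\<^sup>2)))"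
proof -
  define \<alpha> where "\<alpha> = a + b + c + d - 1"
  define \<sigma> where "\<sigma> = norm \<alpha>"
  define r where "r = norm \<rho>"
  define q where "q = r / (1 - r)\<^sup>2"
  define z where "z = - (4 * \<rho> / (1 - \<rho>)\<^sup>2)"
  define Q where "Q m = pochhammer (a + b) m * pochhammer (a + c) m * pochhammer (a + d) m" for m
  define G where "G m = (- 1) ^ m * pochhammer_pair a m x / (Q m * fact m)" for m
  have r: "0 \<le> r" "r < 1/12" using \<rho> by (auto simp: r_def)
  have q: "0 \<le> q" "4 * q < 1" unfolding q_def using quarter_bound[OF r] r by auto
  have \<rho>1: "1 - \<rho> \<noteq> 0" using \<rho> by auto
  have "norm z < 1"
  proof -
    have "1 - r \<le> norm (1 - \<rho>)" using norm_triangle_ineq2[of 1 \<rho>] by (simp add: r_def)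
    then have "(1 - r)\<^sup>2 \<le> (norm (1 - \<rho>))\<^sup>2" using r by (intro power_mono) auto
    then have "4 * r / (norm (1 - \<rho>))\<^sup>2 \<le> 4 * r / (1 - r)\<^sup>2"
      using r by (intro divide_left_mono mult_pos_pos) (auto simp: \<rho>1)
    then have "norm z \<le> 4 * q"
      by (simp add: z_def q_def r_def norm_divide norm_mult norm_power)
    with q show ?thesis by simp
  qed
  have coeff: "wilson_gen_coeff a b c d x n = (\<Sum>m\<le>n. G m * pochhammer \<alpha> (n + m) / fact (n - m))" for n
    unfolding wilson_gen_coeff_def wilson_sum_def sum_distrib_left
  proof (rule sum.cong[OF refl])
    fix m assume "m \<in> {..n}"
    then have m: "m \<le> n" by simp
    have e: "of_nat n + a + b + c + d - 1 = \<alpha> + of_nat n" by (simp add: \<alpha>_def)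
    have p: "pochhammer (- of_nat n :: complex) m / fact n = (- 1) ^ m / fact (n - m)"
      using binomial_fact[OF m, where ?'a = complex] by (simp add: pochhammer_minus_of_nat)
    have "pochhammer (a + b + c + d - 1) n / fact n * (wilson_ratio n a b c d m * pochhammer_pair a m x)
        = (pochhammer (- of_nat n) m / fact n) * (pochhammer \<alpha> n * pochhammer (\<alpha> + of_nat n) m) * pochhammer_pair a m x
           / (Q m * fact m)"
      unfolding wilson_ratio_def e Q_def \<alpha>_def[symmetric] by simp
    also have "\<dots> = G m * pochhammer \<alpha> (n + m) / fact (n - m)"
      unfolding p pochhammer_product'[symmetric] G_def by (simp add: mult_ac)
    finally show "pochhammer (a + b + c + d - 1) n / fact n * (wilson_ratio n a b c d m * pochhammer_pair a m x)
        = G m * pochhammer \<alpha> (n + m) / fact (n - m)" .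
  qed
  have "summable (\<lambda>m. norm (G m) * pochhammer (norm \<alpha>) (2 * m) * (norm \<rho> / (1 - norm \<rho>)\<^sup>2) ^ m)"
  proof -
    \<comment> \<open>The majorant is again of hypergeometric type, with |\<alpha>| in place of
      \<alpha> in the first two parameters and argument 4q < 1.\<close>
    let ?as = "[complex_of_real (\<sigma> / 2), complex_of_real (\<sigma> / 2 + 1 / 2), a + \<i> * of_real x, a - \<i> * of_real x]"
      and ?bs = "[a + b, a + c, a + d]"
    have "summable (\<lambda>m. norm ((\<Prod>a\<leftarrow>?as. pochhammer a m) / (\<Prod>b\<leftarrow>?bs. pochhammer b m) * of_real (4 * q) ^ m / fact m))"
      using q by (intro hypergeometric_series_summable) auto
    moreover have "norm ((\<Prod>a\<leftarrow>?as. pochhammer a m) / (\<Prod>b\<leftarrow>?bs. pochhammer b m) * of_real (4 * q) ^ m / fact m)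
      = norm (G m) * pochhammer (norm \<alpha>) (2 * m) * (norm \<rho> / (1 - norm \<rho>)\<^sup>2) ^ m" for m
    proof -
      have n: "norm (pochhammer (complex_of_real y) m) = pochhammer y m" if "y \<ge> 0" for y
      proof -
        have "pochhammer y m \<ge> 0" using pochhammer_norm_nonneg[of y m] that by simp
        then show ?thesis by (simp only: pochhammer_of_real norm_of_real abs_of_nonneg)
      qed
      have s0: "\<sigma> / 2 \<ge> 0" "\<sigma> / 2 + 1 / 2 \<ge> 0" by (simp_all add: \<sigma>_def)
      have d: "pochhammer \<sigma> (2 * m) = 4 ^ m * pochhammer (\<sigma> / 2) m * pochhammer (\<sigma> / 2 + 1 / 2) m"
        using pochhammer_double[of "\<sigma> / 2" m] by (simp add: power_mult)
      have "(\<Prod>a\<leftarrow>?as. pochhammer a m) = pochhammer (of_real (\<sigma> / 2)) m * pochhammer (of_real (\<sigma> / 2 + 1 / 2)) m * pochhammer_pair a m x"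
        by (simp add: pochhammer_pair_def mult_ac)
      moreover have "(\<Prod>b\<leftarrow>?bs. pochhammer b m) = Q m" by (simp add: Q_def mult_ac)
      moreover have "norm (complex_of_real (4 * q) ^ m) = 4 ^ m * q ^ m"
        using q(1) by (simp add: norm_power power_mult_distrib norm_mult)
      ultimately have "norm ((\<Prod>a\<leftarrow>?as. pochhammer a m) / (\<Prod>b\<leftarrow>?bs. pochhammer b m) * of_real (4 * q) ^ m / fact m)
         = pochhammer (\<sigma> / 2) m * pochhammer (\<sigma> / 2 + 1 / 2) m * norm (pochhammer_pair a m x) / norm (Q m) * (4 ^ m * q ^ m) / fact m"
        by (simp only: norm_mult norm_divide n[OF s0(1)] n[OF s0(2)] norm_fact)
      also have "\<dots> = norm (G m) * (4 ^ m * pochhammer (\<sigma> / 2) m * pochhammer (\<sigma> / 2 + 1 / 2) m) * q ^ m"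
        by (simp add: G_def norm_mult norm_divide norm_power)
      finally show ?thesis unfolding d[symmetric] by (simp add: q_def r_def \<sigma>_def)
    qed
    ultimately show ?thesis by simp
  qed
  from pochhammer_double_series[OF _ this] \<rho> obtain S where
    S: "(\<lambda>n. wilson_gen_coeff a b c d x n * \<rho> ^ n) sums S"
       "(\<lambda>m. G m * pochhammer \<alpha> (2 * m) * \<rho> ^ m * (1 - \<rho>) powr (- (\<alpha> + of_nat (2 * m)))) sums S"
    unfolding coeff by auto
  let ?as = "[\<alpha> / 2, \<alpha> / 2 + 1 / 2, a + \<i> * of_real x, a - \<i> * of_real x]" and ?bs = "[a + b, a + c, a + d]"
  have "(\<lambda>m. (1 - \<rho>) powr (- \<alpha>) * ((\<Prod>a\<leftarrow>?as. pochhammer a m) / (\<Prod>b\<leftarrow>?bs. pochhammer b m) * z ^ m / fact m))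
       sums ((1 - \<rho>) powr (- \<alpha>) * hypergeometric_series ?as ?bs z)"
    using \<open>norm z < 1\<close> by (intro sums_mult hypergeometric_series_sums) auto
  moreover have "(1 - \<rho>) powr (- \<alpha>) * ((\<Prod>a\<leftarrow>?as. pochhammer a m) / (\<Prod>b\<leftarrow>?bs. pochhammer b m) * z ^ m / fact m)
     = G m * pochhammer \<alpha> (2 * m) * \<rho> ^ m * (1 - \<rho>) powr (- (\<alpha> + of_nat (2 * m)))" for m
  proof -
    have d: "pochhammer \<alpha> (2 * m) = 4 ^ m * pochhammer (\<alpha> / 2) m * pochhammer (\<alpha> / 2 + 1 / 2) m"
      using pochhammer_double[of "\<alpha> / 2" m] by (simp add: power_mult)
    have "(1 - \<rho>) powr (- (\<alpha> + of_nat (2 * m))) = (1 - \<rho>) powr (- \<alpha> - of_nat (2 * m))" by simp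
    also have "\<dots> = (1 - \<rho>) powr (- \<alpha>) / ((1 - \<rho>)\<^sup>2) ^ m"
      unfolding powr_diff using powr_nat'[of "1 - \<rho>" "2 * m"] \<rho>1 by (simp add: power_mult)
    finally have p: "(1 - \<rho>) powr (- (\<alpha> + of_nat (2 * m))) = (1 - \<rho>) powr (- \<alpha>) / ((1 - \<rho>)\<^sup>2) ^ m" .
    have zm: "z ^ m = (- 1) ^ m * (4 ^ m * \<rho> ^ m / ((1 - \<rho>)\<^sup>2) ^ m)"
      unfolding z_def power_minus[of "4 * \<rho> / (1 - \<rho>)\<^sup>2"] by (simp only: power_divide power_mult_distrib)
    have as: "(\<Prod>a\<leftarrow>?as. pochhammer a m) = pochhammer (\<alpha> / 2) m * pochhammer (\<alpha> / 2 + 1 / 2) m * pochhammer_pair a m x"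
      by (simp add: pochhammer_pair_def mult_ac)
    have bs: "(\<Prod>b\<leftarrow>?bs. pochhammer b m) = Q m" by (simp add: Q_def mult_ac)
    show ?thesis
      unfolding d p zm as bs G_def by (simp add: mult_ac)
  qed
  ultimately have S_eq: "S = (1 - \<rho>) powr (- \<alpha>) * hypergeometric_series ?as ?bs z"
    using S(2) by (simp add: sums_unique2)
  have e: "- \<alpha> = 1 - a - b - c - d" "\<alpha> / 2 + 1 / 2 = (a + b + c + d) / 2" "\<alpha> / 2 = (a + b + c + d - 1) / 2"
    by (simp_all add: \<alpha>_def field_simps)
  show ?thesis using S(1) unfolding S_eq z_def e(1,2) unfolding e(3) .
qed

theorem wilson_generating_function:
  fixes a b c d \<rho> :: complex and x :: real
  assumes summable: "\<And>r. 0 \<le> r \<Longrightarrow> r < 1 \<Longrightarrow> summable (\<lambda>n. norm (wilson_gen_coeff a b c d x n) * r ^ n)"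
    and \<rho>: "norm \<rho> < 1"
  shows "(\<lambda>n. wilson_gen_coeff a b c d x n * \<rho> ^ n) sums
    ((1 - \<rho>) powr (1 - a - b - c - d) *
      hypergeometric [(a + b + c + d - 1) / 2, (a + b + c + d) / 2, a + \<i> * of_real x, a - \<i> * of_real x]
        [a + b, a + c, a + d] (- (4 * \<rho> / (1 - \<rho>)\<^sup>2)))"
proof -
  let ?as = "[(a + b + c + d - 1) / 2, (a + b + c + d) / 2, a + \<i> * of_real x, a - \<i> * of_real x]"
    and ?bs = "[a + b, a + c, a + d]"
  define e where "e = 1 - a - b - c - d"
  define F where "F \<rho> = (\<Sum>n. wilson_gen_coeff a b c d x n * \<rho> ^ n)" for \<rho>
  have F_sums: "(\<lambda>n. wilson_gen_coeff a b c d x n * \<rho> ^ n) sums F \<rho>" if "norm \<rho> < 1" for \<rho>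
    unfolding F_def
    by (rule summable_sums[OF summable_norm_cancel])
       (use summable[of "norm \<rho>"] that in \<open>simp add: norm_mult norm_power\<close>)
  have F_hol: "F holomorphic_on ball 0 1"
  proof (rule power_series_holomorphic)
    fix w :: complex assume "w \<in> ball 0 1"
    then show "(\<lambda>n. wilson_gen_coeff a b c d x n * (w - 0) ^ n) sums F w"
      using F_sums[of w] by simp
  qed
  define f where "f z = (1 - unit_disk_coordinate z) powr (- e) * F (unit_disk_coordinate z)" for z
  have f_hol: "f holomorphic_on cut_plane"
  proof -
    have "(F \<circ> unit_disk_coordinate) holomorphic_on cut_plane"
      using unit_disk_coordinate_holomorphic F_hol norm_unit_disk_coordinate
      by (intro holomorphic_on_compose_gen[of _ _ _ "ball 0 1"]) auto
    \<comment> \<open>Points of the open disk have real part below 1, so the principal power is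
      holomorphic on the whole cut plane.\<close>
    moreover have "1 - unit_disk_coordinate z \<notin> \<real>\<^sub>\<le>\<^sub>0" if "z \<in> cut_plane" for z
    proof
      assume "1 - unit_disk_coordinate z \<in> \<real>\<^sub>\<le>\<^sub>0"
      then obtain t where t: "1 - unit_disk_coordinate z = of_real t" "t \<le> 0" by (auto simp: nonpos_Reals_def)
      from arg_cong[OF t(1), of Re] t(2) have "Re (unit_disk_coordinate z) \<ge> 1" by simp
      then show False
        using norm_unit_disk_coordinate[OF that] complex_Re_le_cmod[of "unit_disk_coordinate z"] by simp
    qed
    ultimately show ?thesis
      unfolding f_def[abs_def] o_def
      by (intro holomorphic_on_mult holomorphic_on_powr holomorphic_on_diff holomorphic_on_const unit_disk_coordinate_holomorphic)
  qed
  have f_eq: "f z = hypergeometric_series ?as ?bs z" if z: "z \<in> cut_plane" "norm (unit_disk_coordinate z) < 1/12" for z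
  proof -
    let ?r = "unit_disk_coordinate z"
    have "F ?r = (1 - ?r) powr e * hypergeometric_series ?as ?bs z"
      using sums_unique2[OF F_sums wilson_generating_small[OF z(2), of a b c d x]] z(2)
      unfolding unit_disk_coordinate_eq[OF z(1)] e_def by simp
    moreover have "1 - ?r \<noteq> 0" using z(2) by auto
    ultimately show ?thesis
      unfolding f_def by (simp add: powr_minus)
  qed
  have "f z = hypergeometric_series ?as ?bs z" if z: "z \<in> ball 0 1" for z
  proof -
    \<comment> \<open>The expansion for small \<rho> is available where the coordinate is below
      1/12. Continuity supplies a ball around 0 of such points, and the identity theorem extends the
      agreement to the unit disk.\<close>
    have "isCont unit_disk_coordinate 0"
      using unit_disk_coordinate_holomorphic open_cut_plane
      by (intro continuous_on_interior[OF holomorphic_on_imp_continuous_on])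
         (auto simp: interior_open intro!: subsetD[OF ball_subset_cut_plane])
    moreover have "unit_disk_coordinate 0 = 0" by (simp add: unit_disk_coordinate_def)
    ultimately obtain \<delta> where \<delta>: "\<delta> > 0" "\<And>z. norm z < \<delta> \<Longrightarrow> norm (unit_disk_coordinate z) < 1/12"
      unfolding continuous_at_eps_delta dist_norm by (metis diff_zero zero_less_divide_1_iff zero_less_numeral)
    show ?thesis
    proof (rule analytic_continuation_open[of "ball 0 (min 1 \<delta>)" "ball 0 1" f "hypergeometric_series ?as ?bs"])
      show "ball 0 (min 1 \<delta>) \<noteq> {}" using \<delta>(1) by simp
      show "ball 0 (min 1 \<delta>) \<subseteq> (ball 0 1 :: complex set)" by auto
      show "f holomorphic_on ball 0 1" by (rule holomorphic_on_subset[OF f_hol ball_subset_cut_plane])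
      show "hypergeometric_series ?as ?bs holomorphic_on ball 0 1"
        by (rule hypergeometric_series_holomorphic) simp
      show "f w = hypergeometric_series ?as ?bs w" if "w \<in> ball 0 (min 1 \<delta>)" for w
        using that by (intro f_eq \<delta>(2) subsetD[OF ball_subset_cut_plane]) auto
    qed (use z in auto)
  qed
  then have "is_hypergeometric_continuation ?as ?bs f"
    using f_hol by (simp add: is_hypergeometric_continuation_def)
  from hypergeometric_eq_continuation[OF _ this unit_disk_coordinate_inverse(1)[OF \<rho>]]
  have "hypergeometric ?as ?bs (- (4 * \<rho> / (1 - \<rho>)\<^sup>2)) = (1 - \<rho>) powr (- e) * F \<rho>"
    by (simp only: f_def unit_disk_coordinate_inverse(2)[OF \<rho>]) simp
  moreover have "1 - \<rho> \<noteq> 0" using \<rho> by auto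
  ultimately have "(1 - \<rho>) powr e * hypergeometric ?as ?bs (- (4 * \<rho> / (1 - \<rho>)\<^sup>2)) = F \<rho>"
    by (simp add: powr_minus)
  then show ?thesis using F_sums[OF \<rho>] unfolding e_def by simp
qed

section \<open>Term-by-term integration\<close>

definition wilson_density :: "complex \<Rightarrow> complex \<Rightarrow> complex \<Rightarrow> complex \<Rightarrow> real \<Rightarrow> real" where
  "wilson_density a b c d x =
     (norm (Gamma (a + \<i> * of_real x) * Gamma (b + \<i> * of_real x) *
            Gamma (c + \<i> * of_real x) * Gamma (d + \<i> * of_real x)))\<^sup>2 * wilson_factor x"

lemma wilson_density_nonneg: "wilson_density a b c d x \<ge> 0"
  unfolding wilson_density_def by (intro mult_nonneg_nonneg wilson_factor_nonneg) simp

lemma Gamma_line_nonzero: "Re z > 0 \<Longrightarrow> Gamma (z + \<i> * of_real x) \<noteq> 0"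
  using Re_pos_not_nonpos_Int[of "z + \<i> * of_real x"] by (simp add: Gamma_eq_zero_iff)

lemma wilson_density_pos:
  assumes "Re a > 0" "Re b > 0" "Re c > 0" "Re d > 0" "x \<noteq> 0"
  shows "wilson_density a b c d x > 0"
  unfolding wilson_density_def using assms
  by (intro mult_pos_pos wilson_factor_pos) (simp_all add: Gamma_line_nonzero)

text \<open>Conjugation permutes the parameters and sends Gamma(z + ix) to Gamma(cnj z - ix), so the
  product of the four factors with -ix is the conjugate of the product with +ix.\<close>

lemma wilson_kernel_eq_density:
  assumes "nonreal_in_conjugate_pairs {#a, b, c, d#}"
  shows "wilson_kernel a b c d x = of_real (wilson_density a b c d x)"
proof -
  let ?M = "{#a, b, c, d#}"
  let ?g = "\<lambda>z. Gamma (z + \<i> * of_real x)"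
  have "(\<Prod>z\<in>#?M. Gamma (z - \<i> * of_real x)) = (\<Prod>z\<in>#image_mset cnj ?M. Gamma (z - \<i> * of_real x))"
    using assms by (simp only: nonreal_in_conjugate_pairs_def)
  also have "\<dots> = cnj (?g a * ?g b * ?g c * ?g d)"
    by (simp add: cnj_Gamma mult_ac)
  finally have "Gamma (a - \<i> * of_real x) * Gamma (b - \<i> * of_real x) * Gamma (c - \<i> * of_real x) * Gamma (d - \<i> * of_real x)
     = cnj (?g a * ?g b * ?g c * ?g d)" by (simp add: mult_ac)
  moreover have "wilson_kernel a b c d x = (?g a * ?g b * ?g c * ?g d) *
     (Gamma (a - \<i> * of_real x) * Gamma (b - \<i> * of_real x) * Gamma (c - \<i> * of_real x) * Gamma (d - \<i> * of_real x)) *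
     of_real (wilson_factor x)"
    unfolding wilson_kernel_def gamma_pair_def by (simp only: mult_ac)
  ultimately show ?thesis
    unfolding wilson_density_def of_real_mult complex_norm_square by simp
qed

lemma wilson_weight_eq_density:
  assumes "x > 0"
  shows "wilson_weight a b c d x = wilson_density a b c d x"
proof -
  have "2 * \<i> * of_real x \<notin> \<int>\<^sub>\<le>\<^sub>0"
    using assms by (auto simp: nonpos_Ints_def complex_eq_iff)
  from Gamma_plus1[OF this] have "Gamma (Complex 1 (2 * x)) = 2 * \<i> * of_real x * Gamma (2 * \<i> * of_real x)"
    by (simp add: complex_eq_iff[of "Complex 1 (2 * x)"] Complex_eq add.commute mult_ac)
  then have "(norm (Gamma (Complex 1 (2 * x))))\<^sup>2 = (2 * x)\<^sup>2 * (norm (Gamma (2 * \<i> * of_real x)))\<^sup>2"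
    using assms by (simp add: norm_mult power_mult_distrib)
  then have "(norm (Gamma (2 * \<i> * of_real x)))\<^sup>2 = pi * (2 * x) / sinh (pi * (2 * x)) / (2 * x)\<^sup>2"
    using assms norm_Gamma_Complex_1[of "2 * x"] by (simp add: field_simps)
  also have "\<dots> = inverse (wilson_factor x)"
    using assms by (simp add: wilson_factor_def field_simps power2_eq_square)
  finally show ?thesis
    unfolding wilson_weight_def wilson_density_def norm_divide power_divide
    by (simp add: divide_inverse)
qed

lemma degree_map_poly_cnj_le: "degree p \<le> n \<Longrightarrow> degree (map_poly cnj p) \<le> n"
  by (rule degree_le) (auto simp: coeff_map_poly coeff_eq_0)

text \<open>The difference of the two polynomials has degree less than \<open>k\<close> in \<open>x\<^sup>2\<close> and is orthogonal to all
  such polynomials, itself included.\<close>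
lemma wilson_symmetric_AE:
  assumes re: "Re a > 0" "Re b > 0" "Re c > 0" "Re d > 0"
    and pairs: "nonreal_in_conjugate_pairs {#a, b, c, d#}"
  shows "AE x in lborel. wilson k (of_real x) a b c d = wilson k (of_real x) b a c d"
proof -
  define D where "D = wilson_poly k a b c d - wilson_poly k b a c d"
  define E where "E = map_poly cnj D"
  define S where "S x = poly D (of_real (x\<^sup>2))" for x :: real
  have E: "degree E \<le> k" "coeff E k = 0"
  proof -
    have "degree D \<le> k"
      unfolding D_def by (rule degree_diff_le[OF degree_wilson_poly degree_wilson_poly])
    then show "degree E \<le> k"
      unfolding E_def by (rule degree_map_poly_cnj_le)
    have "coeff D k = 0"
      unfolding D_def coeff_diff coeff_wilson_poly[OF re] coeff_wilson_poly[OF re(2,1,3,4)] by (simp add: add_ac)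
    then show "coeff E k = 0" by (simp add: E_def coeff_map_poly)
  qed
  \<comment> \<open>The argument x^2 is real, so conjugating the coefficients conjugates the
    value.\<close>
  have pE: "poly E (of_real (x\<^sup>2)) = cnj (S x)" for x
    unfolding E_def S_def using poly_cnj[of D "of_real (x\<^sup>2)"] by (simp only: complex_cnj_complex_of_real)
  have S_eq: "S x = wilson k (of_real x) a b c d - wilson k (of_real x) b a c d" for x
    unfolding S_def D_def poly_diff poly_wilson_poly ..
  have 1: "has_bochner_integral lborel (\<lambda>x. wilson k (of_real x) a b c d * cnj (S x) * wilson_kernel a b c d x) 0"
    using wilson_orthogonal[OF re E(1)] unfolding E(2) pE by simp
  have 2: "has_bochner_integral lborel (\<lambda>x. wilson k (of_real x) b a c d * cnj (S x) * wilson_kernel a b c d x) 0"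
    using wilson_orthogonal[OF re(2,1,3,4) E(1)] unfolding E(2) pE wilson_kernel_commute(1)[of b a] by simp
  have eq: "wilson k (of_real x) a b c d * cnj (S x) * wilson_kernel a b c d x
      - wilson k (of_real x) b a c d * cnj (S x) * wilson_kernel a b c d x
      = of_real ((norm (S x))\<^sup>2 * wilson_density a b c d x)" for x
    unfolding wilson_kernel_eq_density[OF pairs] left_diff_distrib[symmetric] S_eq[symmetric] of_real_mult complex_norm_square ..
  have "has_bochner_integral lborel (\<lambda>x. complex_of_real ((norm (S x))\<^sup>2 * wilson_density a b c d x)) 0"
    using has_bochner_integral_diff[OF 1 2] unfolding eq by simp
  then have i: "integrable lborel (\<lambda>x. (norm (S x))\<^sup>2 * wilson_density a b c d x)"
    and z: "integral\<^sup>L lborel (\<lambda>x. (norm (S x))\<^sup>2 * wilson_density a b c d x) = 0"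
    unfolding has_bochner_integral_iff complex_of_real_integrable_eq integral_complex_of_real by simp_all
  have "AE x in lborel. (norm (S x))\<^sup>2 * wilson_density a b c d x = 0"
    using integral_nonneg_eq_0_iff_AE[OF i] z wilson_density_nonneg by simp
  then show ?thesis
    using AE_lborel_singleton[of 0]
  proof eventually_elim
    case (elim x)
    then have "S x = 0" using wilson_density_pos[OF re elim(2)] by simp
    then show ?case by (simp add: S_eq)
  qed
qed

lemma wilson_eq_sum:
  "wilson n (of_real x) a b c d = pochhammer (a + b) n * pochhammer (a + c) n * pochhammer (a + d) n * wilson_sum n a b c d x"
  by (simp only: wilson_altdef wilson_sum_def)

text \<open>The complex conjugate of \<open>W\<^sub>n\<close> is a polynomial of degree \<open>n\<close> in \<open>x\<^sup>2\<close> as well, so only its leading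
  coefficient matters.\<close>
lemma wilson_sum_square:
  assumes re: "Re a > 0" "Re b > 0" "Re c > 0" "Re d > 0"
    and pairs: "nonreal_in_conjugate_pairs {#a, b, c, d#}"
  shows "integrable lborel (\<lambda>x. (norm (wilson_sum n a b c d x))\<^sup>2 * wilson_density a b c d x)"
    and "integral\<^sup>L lborel (\<lambda>x. (norm (wilson_sum n a b c d x))\<^sup>2 * wilson_density a b c d x)
       = norm (pochhammer (of_nat n + a + b + c + d - 1) n * wilson_norm n a b c d /
           (pochhammer (a + b) n * pochhammer (a + c) n * pochhammer (a + d) n)\<^sup>2)"
proof -
  define P where "P = pochhammer (a + b) n * pochhammer (a + c) n * pochhammer (a + d) n"
  define l where "l = (- 1) ^ n * pochhammer (of_nat n + a + b + c + d - 1) n"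
  have P0: "P \<noteq> 0" using re by (simp add: P_def pochhammer_Re_pos_nonzero)
  let ?E = "map_poly cnj (wilson_poly n a b c d)"
  have d: "degree ?E \<le> n"
    by (rule degree_map_poly_cnj_le[OF degree_wilson_poly])
  have c: "coeff ?E n = cnj l"
    by (simp only: coeff_map_poly complex_cnj_zero coeff_wilson_poly[OF re] l_def)
  have pE: "poly ?E (of_real (x\<^sup>2)) = cnj (wilson n (of_real x) a b c d)" for x
    using poly_cnj[of "wilson_poly n a b c d" "of_real (x\<^sup>2)"]
    by (simp only: complex_cnj_complex_of_real poly_wilson_poly)
  have eq: "wilson n (of_real x) a b c d * cnj (wilson n (of_real x) a b c d) * wilson_kernel a b c d x
     = of_real ((norm P)\<^sup>2 * ((norm (wilson_sum n a b c d x))\<^sup>2 * wilson_density a b c d x))" for x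
    unfolding wilson_kernel_eq_density[OF pairs] complex_norm_square[symmetric]
    unfolding wilson_eq_sum P_def[symmetric] norm_mult[of P] power_mult_distrib by (simp only: of_real_mult mult.assoc)
  have h: "has_bochner_integral lborel
     (\<lambda>x. complex_of_real ((norm P)\<^sup>2 * ((norm (wilson_sum n a b c d x))\<^sup>2 * wilson_density a b c d x)))
     (cnj l * wilson_norm n a b c d)"
    using wilson_orthogonal[OF re d] unfolding c pE eq .
  then have i: "integrable lborel (\<lambda>x. (norm P)\<^sup>2 * ((norm (wilson_sum n a b c d x))\<^sup>2 * wilson_density a b c d x))"
    unfolding has_bochner_integral_iff complex_of_real_integrable_eq by simp
  then show i': "integrable lborel (\<lambda>x. (norm (wilson_sum n a b c d x))\<^sup>2 * wilson_density a b c d x)"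
    using P0 by simp
  let ?I = "integral\<^sup>L lborel (\<lambda>x. (norm (wilson_sum n a b c d x))\<^sup>2 * wilson_density a b c d x)"
  have I: "complex_of_real ((norm P)\<^sup>2 * ?I) = cnj l * wilson_norm n a b c d"
    using h unfolding has_bochner_integral_iff integral_complex_of_real by simp
  have "?I \<ge> 0"
    using wilson_density_nonneg by (intro integral_nonneg_AE AE_I2 mult_nonneg_nonneg) simp_all
  then have "(norm P)\<^sup>2 * ?I \<ge> 0" by (rule mult_nonneg_nonneg[rotated]) simp
  then have "(norm P)\<^sup>2 * ?I = norm (complex_of_real ((norm P)\<^sup>2 * ?I))"
    by (simp only: norm_of_real abs_of_nonneg)
  also have "\<dots> = norm (cnj l * wilson_norm n a b c d)"
    unfolding I ..
  also have "\<dots> = norm (pochhammer (of_nat n + a + b + c + d - 1) n * wilson_norm n a b c d)"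
    unfolding norm_mult complex_mod_cnj l_def by (simp add: norm_power)
  finally have "(norm P)\<^sup>2 * ?I = norm (pochhammer (of_nat n + a + b + c + d - 1) n * wilson_norm n a b c d)" .
  then show "?I = norm (pochhammer (of_nat n + a + b + c + d - 1) n * wilson_norm n a b c d /
           (pochhammer (a + b) n * pochhammer (a + c) n * pochhammer (a + d) n)\<^sup>2)"
    unfolding P_def[symmetric] norm_divide norm_power using P0 by (simp add: field_simps)
qed

text \<open>Put s = a + b + c + d. The factors (s - 1)_n (s - 1 + n)_n make up (s - 1)_(2n), and
  \<open>wilson_norm\<close> divides by (s)_(2n); duplicating both cancels 4^n and (s/2)_n. Up to a
  constant the terms become r^n times a quotient with four Pochhammer symbols above and four below,
  which the ratio test handles.\<close>

lemma wilson_sum_square_summable: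
  assumes re: "Re a > 0" "Re b > 0" "Re c > 0" "Re d > 0"
    and pairs: "nonreal_in_conjugate_pairs {#a, b, c, d#}"
    and r: "0 \<le> r" "r < 1"
  shows "summable (\<lambda>n. norm (pochhammer (a + b + c + d - 1) n / fact n) * r ^ n *
      integral\<^sup>L lborel (\<lambda>x. (norm (wilson_sum n a b c d x))\<^sup>2 * wilson_density a b c d x))"
proof -
  define s where "s = a + b + c + d"
  define C where "C = 4 * of_real pi * (Gamma (a + b) * Gamma (b + c) * Gamma (b + d)
       * Gamma (a + c) * Gamma (a + d) * Gamma (c + d)) / Gamma s"
  let ?as = "[(s - 1) / 2, b + c, b + d, c + d]" and ?bs = "[s / 2 + 1 / 2, a + b, a + c, a + d]"
  have "summable (\<lambda>n. norm C * norm ((\<Prod>a\<leftarrow>?as. pochhammer a n) / (\<Prod>b\<leftarrow>?bs. pochhammer b n) * complex_of_real r ^ n))"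
    using r by (intro summable_mult summable_pochhammer_ratio) auto
  moreover have "norm C * norm ((\<Prod>a\<leftarrow>?as. pochhammer a n) / (\<Prod>b\<leftarrow>?bs. pochhammer b n) * complex_of_real r ^ n)
     = norm (pochhammer (s - 1) n / fact n) * r ^ n *
       norm (pochhammer (of_nat n + a + b + c + d - 1) n * wilson_norm n a b c d /
           (pochhammer (a + b) n * pochhammer (a + c) n * pochhammer (a + d) n)\<^sup>2)" for n
  proof -
    have s: "Re s > 0" using re by (simp add: s_def)
    have re2: "Re (a + b) > 0" "Re (b + c) > 0" "Re (b + d) > 0" "Re (a + c) > 0" "Re (a + d) > 0" "Re (c + d) > 0" "Re s > 0"
      "Re (s / 2) > 0" "Re (s / 2 + 1 / 2) > 0"
      using re s by auto
    define S1 where "S1 = pochhammer ((s - 1) / 2) n"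
    define S2 where "S2 = pochhammer (s / 2) n"
    define S3 where "S3 = pochhammer (s / 2 + 1 / 2) n"
    define P where "P = pochhammer (a + b) n * pochhammer (a + c) n * pochhammer (a + d) n"
    define Q where "Q = pochhammer (b + c) n * pochhammer (b + d) n * pochhammer (c + d) n"
    have nz: "S2 \<noteq> 0" "S3 \<noteq> 0" "P \<noteq> 0"
      using re2 by (auto simp: S2_def S3_def P_def pochhammer_Re_pos_nonzero)
    have nn: "n + n = 2 * n" by simp
    have d1: "pochhammer s (n + n) = 4 ^ n * S2 * S3"
      using pochhammer_double[of "s / 2" n] unfolding nn by (simp add: S2_def S3_def power_mult)
    have e: "(s - 1) / 2 + 1 / 2 = s / 2" and e': "2 * ((s - 1) / 2) = s - 1" by (simp_all add: field_simps)
    have d2: "pochhammer (s - 1) n * pochhammer (s - 1 + of_nat n) n = 4 ^ n * S1 * S2"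
      using pochhammer_double[of "(s - 1) / 2" n] unfolding e e' pochhammer_product'[symmetric] nn
      by (simp add: S1_def S2_def power_mult)
    have e2: "of_nat n + a + b + c + d - 1 = s - 1 + of_nat n" by (simp add: s_def)
    have G: "wilson_norm n a b c d = (- 1) ^ n * fact n * P * Q * C / pochhammer s (n + n)"
      unfolding wilson_norm_def s_def[symmetric] Gamma_add_of_nat[OF re2(1)] Gamma_add_of_nat[OF re2(2)] Gamma_add_of_nat[OF re2(3)]
        Gamma_add_of_nat[OF re2(4)] Gamma_add_of_nat[OF re2(5)] Gamma_add_of_nat[OF re2(6)] Gamma_add_of_nat[OF re2(7)]
        P_def Q_def C_def
      by (simp only: times_divide_eq_left times_divide_eq_right divide_divide_eq_left mult_ac)
    have as: "(\<Prod>a\<leftarrow>?as. pochhammer a n) = S1 * Q" and bs: "(\<Prod>b\<leftarrow>?bs. pochhammer b n) = S3 * P"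
      by (simp_all add: S1_def Q_def S3_def P_def mult_ac)
    have "pochhammer (s - 1) n / fact n * (pochhammer (s - 1 + of_nat n) n * wilson_norm n a b c d / P\<^sup>2)
       = (pochhammer (s - 1) n * pochhammer (s - 1 + of_nat n) n) / fact n * (wilson_norm n a b c d / P\<^sup>2)"
      by (simp only: times_divide_eq_left times_divide_eq_right mult.assoc)
    also have "\<dots> = (- 1) ^ n * (C * (S1 * Q / (S3 * P)))"
    proof -
      have "T * x * y / F * (m * F * p * q * e / (T * y * z) / p\<^sup>2) = m * (e * (x * q / (z * p)))"
        if "T \<noteq> 0" "F \<noteq> 0" "y \<noteq> 0" "z \<noteq> 0" "p \<noteq> 0" for T F x y z m p q e :: complex
        using that by (simp add: divide_simps power2_eq_square)
      from this[OF _ _ nz, of "4 ^ n" "fact n" S1 "(- 1) ^ n" Q C] show ?thesis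
        unfolding d2 G d1 by simp
    qed
    finally have "norm (pochhammer (s - 1) n / fact n) * norm (pochhammer (s - 1 + of_nat n) n * wilson_norm n a b c d / P\<^sup>2)
       = norm ((- 1 :: complex) ^ n) * (norm C * norm (S1 * Q / (S3 * P)))"
      by (simp only: norm_mult[symmetric])
    then have N: "norm (pochhammer (s - 1) n / fact n) * norm (pochhammer (s - 1 + of_nat n) n * wilson_norm n a b c d / P\<^sup>2)
       = norm C * norm (S1 * Q / (S3 * P))"
      by (simp only: norm_power norm_minus_cancel norm_one power_one mult_1_left)
    have R: "norm (complex_of_real r ^ n) = r ^ n" using r by (simp add: norm_power)
    have "norm C * norm (S1 * Q / (S3 * P) * complex_of_real r ^ n) = (norm C * norm (S1 * Q / (S3 * P))) * r ^ n"
      by (simp only: norm_mult[of "S1 * Q / (S3 * P)"] R mult.assoc)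
    also have "\<dots> = norm (pochhammer (s - 1) n / fact n) * r ^ n * norm (pochhammer (s - 1 + of_nat n) n * wilson_norm n a b c d / P\<^sup>2)"
      unfolding N[symmetric] by (simp only: mult_ac)
    finally show ?thesis
      unfolding as bs e2 P_def[symmetric] .
  qed
  ultimately show ?thesis
    unfolding wilson_sum_square(2)[OF re pairs] s_def[symmetric] by (simp only:)
qed

section \<open>Domination of the series\<close>

lemma AE_summable:
  fixes g :: "nat \<Rightarrow> 'a \<Rightarrow> real"
  assumes g: "\<And>n. integrable M (g n)" "\<And>n x. 0 \<le> g n x" and s: "summable (\<lambda>n. integral\<^sup>L M (g n))"
  shows "AE x in M. summable (\<lambda>n. g n x)"
proof -
  have [measurable]: "g n \<in> borel_measurable M" for n using g(1) by (rule borel_measurable_integrable)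
  have "(\<integral>\<^sup>+x. (\<Sum>n. ennreal (g n x)) \<partial>M) = (\<Sum>n. \<integral>\<^sup>+x. ennreal (g n x) \<partial>M)"
    by (rule nn_integral_suminf) measurable
  also have "\<dots> = (\<Sum>n. ennreal (integral\<^sup>L M (g n)))"
    using g by (intro arg_cong[where f = suminf] ext nn_integral_eq_integral) auto
  also have "\<dots> = ennreal (\<Sum>n. integral\<^sup>L M (g n))"
    using g(2) by (intro suminf_ennreal2 s integral_nonneg_AE) auto
  finally have "(\<integral>\<^sup>+x. (\<Sum>n. ennreal (g n x)) \<partial>M) \<noteq> \<infinity>" by simp
  moreover have "(\<lambda>x. \<Sum>n. ennreal (g n x)) \<in> borel_measurable M" by measurable
  ultimately have "AE x in M. (\<Sum>n. ennreal (g n x)) \<noteq> \<infinity>"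
    by (intro nn_integral_noteq_infinite)
  then show ?thesis
    by eventually_elim (rule summable_suminf_not_top, auto simp: g(2))
qed

lemma poly_square_le_exp:
  assumes "e > 0"
  shows "\<exists>C>0. \<forall>x::real. norm (poly p (complex_of_real (x\<^sup>2))) \<le> C * exp (e * \<bar>x\<bar>)"
  using assms
proof (induction p arbitrary: e)
  case 0
  show ?case by (rule exI[of _ 1]) simp
next
  case (pCons a p)
  \<comment> \<open>One third of the exponent for each of the two factors |x|, and one for the
    remaining polynomial.\<close>
  have "e / 3 > 0" using pCons.prems by simp
  from pCons.IH[OF this] obtain C where C: "C > 0" "\<And>x. norm (poly p (complex_of_real (x\<^sup>2))) \<le> C * exp (e / 3 * \<bar>x\<bar>)"
    by blast
  define K where "K = norm a + (3 / e)\<^sup>2 * C"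
  have "norm (poly (pCons a p) (complex_of_real (x\<^sup>2))) \<le> K * exp (e * \<bar>x\<bar>)" for x
  proof -
    have x: "\<bar>x\<bar> \<le> 3 / e * exp (e / 3 * \<bar>x\<bar>)" using abs_le_exp[OF \<open>e / 3 > 0\<close>, of x] by (simp add: mult_ac)
    have "norm (poly (pCons a p) (complex_of_real (x\<^sup>2))) \<le> norm a + \<bar>x\<bar> * \<bar>x\<bar> * norm (poly p (complex_of_real (x\<^sup>2)))"
      unfolding poly_pCons by (rule order_trans[OF norm_triangle_ineq]) (simp add: norm_mult norm_power power2_eq_square)
    also have "\<dots> \<le> norm a * exp (e * \<bar>x\<bar>) + (3 / e * exp (e / 3 * \<bar>x\<bar>)) * (3 / e * exp (e / 3 * \<bar>x\<bar>)) * (C * exp (e / 3 * \<bar>x\<bar>))"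
    proof (rule add_mono)
      have "1 \<le> exp (e * \<bar>x\<bar>)" using pCons.prems by simp
      then show "norm a \<le> norm a * exp (e * \<bar>x\<bar>)" by (simp add: mult_le_cancel_left1)
      show "\<bar>x\<bar> * \<bar>x\<bar> * norm (poly p (complex_of_real (x\<^sup>2)))
         \<le> (3 / e * exp (e / 3 * \<bar>x\<bar>)) * (3 / e * exp (e / 3 * \<bar>x\<bar>)) * (C * exp (e / 3 * \<bar>x\<bar>))"
        using pCons.prems by (intro mult_mono x C(2) mult_nonneg_nonneg) auto
    qed
    also have "(3 / e * exp (e / 3 * \<bar>x\<bar>)) * (3 / e * exp (e / 3 * \<bar>x\<bar>)) * (C * exp (e / 3 * \<bar>x\<bar>))
       = (3 / e)\<^sup>2 * C * (exp (e / 3 * \<bar>x\<bar>) * exp (e / 3 * \<bar>x\<bar>) * exp (e / 3 * \<bar>x\<bar>))"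
      by (simp only: power2_eq_square mult_ac)
    also have "exp (e / 3 * \<bar>x\<bar>) * exp (e / 3 * \<bar>x\<bar>) * exp (e / 3 * \<bar>x\<bar>) = exp (e * \<bar>x\<bar>)"
      unfolding exp_add[symmetric] by simp
    also have "norm a * exp (e * \<bar>x\<bar>) + (3 / e)\<^sup>2 * C * exp (e * \<bar>x\<bar>) = K * exp (e * \<bar>x\<bar>)"
      by (simp only: K_def distrib_right)
    finally show ?thesis .
  qed
  moreover have "K > 0" using C(1) pCons.prems by (simp add: K_def add_nonneg_pos)
  ultimately show ?case by blast
qed

lemma continuous_wilson: "continuous_on UNIV (\<lambda>x::real. wilson k (of_real x) a b c d)"
  unfolding poly_wilson_poly[symmetric] by (intro continuous_intros)

lemma continuous_Gamma_line:
  "Re z > 0 \<Longrightarrow> continuous_on UNIV (\<lambda>x::real. Gamma (z + \<i> * of_real x))"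
  by (intro continuous_on_compose2[OF continuous_on_Gamma[of "{z. Re z > 0}"]] continuous_intros)
     (auto simp: Re_pos_not_nonpos_Int)

text \<open>Exchanging the Gamma factors in d for those in h leaves the exponential rate unchanged,
  so the quotient decays at the rate of a weight, and the polynomial does no harm.\<close>

lemma integrable_wilson_square_ratio:
  assumes re: "Re a > 0" "Re b > 0" "Re c > 0" "Re d > 0" "Re h > 0"
  shows "integrable lborel (\<lambda>x. (norm (wilson k (of_real x) a b c h))\<^sup>2 *
            ((wilson_density a b c h x)\<^sup>2 / wilson_density a b c d x))"
proof -
  define W where "W x = norm (wilson k (of_real x) a b c h)" for x :: real
  define g where "g z x = norm (Gamma (z + \<i> * of_real x))" for z and x :: real
  \<comment> \<open>The quotient after cancellation of the common factors, in particular of one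
    \<open>wilson_factor\<close>, which makes it visibly continuous at 0.\<close>
  define u where "u x = (W x)\<^sup>2 * (g a x * g b x * g c x)\<^sup>2 * (g h x)^4 * (1 / g d x)\<^sup>2 * wilson_factor x" for x
  \<comment> \<open>In units of pi/12 the true rate of Gamma is 6, taken as 5 in upper bounds and 7
    in the lower bound. Ten factors of the first kind give 50, against 14 from the square of
    \<open>1 / g d x\<close>, 26 from \<open>wilson_factor\<close> and 2 from the squared
    polynomial, so 8 remains.\<close>
  define L where "L = pi / 12"
  have L: "L > 0" by (simp add: L_def)
  have gpos: "g z x > 0" if "Re z > 0" for z x
    using Gamma_line_nonzero[OF that, of x] by (simp add: g_def)
  have gle: "\<exists>C>0. \<forall>x. g z x \<le> C * exp (- (5 * L) * \<bar>x\<bar>)" if z: "Re z > 0" for z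
  proof -
    have "5 * L < pi / 2" "5 * L \<ge> 0" by (simp_all add: L_def)
    from norm_Gamma_decay_line[OF z this] show ?thesis unfolding g_def by blast
  qed
  obtain A where A: "A > 0" "\<And>x. g a x \<le> A * exp (- (5 * L) * \<bar>x\<bar>)" using gle[OF re(1)] by blast
  obtain B where B: "B > 0" "\<And>x. g b x \<le> B * exp (- (5 * L) * \<bar>x\<bar>)" using gle[OF re(2)] by blast
  obtain C where C: "C > 0" "\<And>x. g c x \<le> C * exp (- (5 * L) * \<bar>x\<bar>)" using gle[OF re(3)] by blast
  obtain H where H: "H > 0" "\<And>x. g h x \<le> H * exp (- (5 * L) * \<bar>x\<bar>)" using gle[OF re(5)] by blast
  have "7 * L > pi / 2" by (simp add: L_def)
  from norm_Gamma_lower_line[OF re(4) this]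
  obtain D where D: "D > 0" "\<And>x. D * exp (- (7 * L) * \<bar>x\<bar>) \<le> g d x" unfolding g_def by blast
  obtain V where V: "V > 0" "\<And>x. \<bar>wilson_factor x\<bar> \<le> V * exp (26 * L * \<bar>x\<bar>)"
  proof -
    obtain V where "V > 0" "\<And>x. \<bar>wilson_factor x\<bar> \<le> V * exp ((13 * pi / 6) * \<bar>x\<bar>)"
      using wilson_factor_le by blast
    then show thesis by (intro that[of V]) (simp_all add: L_def)
  qed
  obtain P where P: "P > 0" "\<And>x. W x \<le> P * exp (L * \<bar>x\<bar>)"
    using poly_square_le_exp[OF L, of "wilson_poly k a b c h"] unfolding poly_wilson_poly W_def by blast
  have "continuous_on UNIV u"
    unfolding u_def[abs_def] W_def g_def
    using re by (intro continuous_intros continuous_wilson continuous_Gamma_line) (simp_all add: Gamma_line_nonzero)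
  then have int_u: "integrable lborel u"
  proof (rule integrable_exp_bound)
    show "8 * L > 0" using L by simp
    show "norm (u x) \<le> (P\<^sup>2 * (A * B * C)\<^sup>2 * H ^ 4 * (1 / D)\<^sup>2 * V) * exp (- (8 * L) * \<bar>x\<bar>)" for x
    proof -
      define E where "E = exp (L * \<bar>x\<bar>)"
      have E: "E > 0" by (simp add: E_def)
      have pw: "exp (of_nat n * L * \<bar>x\<bar>) = E ^ n" for n
        unfolding E_def exp_of_nat_mult[symmetric] by (simp add: mult.assoc)
      have e5: "exp (- (5 * L) * \<bar>x\<bar>) = 1 / E ^ 5" and e7: "exp (- (7 * L) * \<bar>x\<bar>) = 1 / E ^ 7"
        and e8: "exp (- (8 * L) * \<bar>x\<bar>) = 1 / E ^ 8" and e26: "exp (26 * L * \<bar>x\<bar>) = E ^ 26"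
        using pw[of 5] pw[of 7] pw[of 8] pw[of 26] by (simp_all add: exp_minus inverse_eq_divide)
      have "1 / g d x \<le> 1 / (D / E ^ 7)"
        using D(2)[of x] D(1) E unfolding e7 by (intro divide_left_mono mult_pos_pos) (auto simp: gpos re)
      then have d: "1 / g d x \<le> E ^ 7 / D" by simp
      have "norm (u x) = u x"
        unfolding u_def using wilson_factor_nonneg[of x] by (simp add: abs_mult)
      also have "u x \<le> (P * E)\<^sup>2 * ((A / E ^ 5) * (B / E ^ 5) * (C / E ^ 5))\<^sup>2 * (H / E ^ 5) ^ 4 * (E ^ 7 / D)\<^sup>2 * (V * E ^ 26)"
      proof -
        have "0 \<le> W x" "0 \<le> g a x" "0 \<le> g b x" "0 \<le> g c x" "0 \<le> g h x" "0 \<le> 1 / g d x"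
          by (simp_all add: W_def g_def)
        moreover have "g a x \<le> A / E ^ 5" "g b x \<le> B / E ^ 5" "g c x \<le> C / E ^ 5" "g h x \<le> H / E ^ 5"
          using A(2)[of x] B(2)[of x] C(2)[of x] H(2)[of x] unfolding e5 by simp_all
        moreover have "W x \<le> P * E" using P(2)[of x] by (simp add: E_def)
        moreover have "wilson_factor x \<le> V * E ^ 26" using V(2)[of x] unfolding e26 by simp
        ultimately show ?thesis
          unfolding u_def using d A(1) B(1) C(1) D(1) H(1) P(1) V(1) E wilson_factor_nonneg[of x]
          by (intro mult_mono power_mono mult_nonneg_nonneg zero_le_power divide_nonneg_nonneg) (assumption | simp)+
      qed
      also have "\<dots> = (P\<^sup>2 * (A * B * C)\<^sup>2 * H ^ 4 * (1 / D)\<^sup>2 * V) * exp (- (8 * L) * \<bar>x\<bar>)"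
      proof -
        have alg: "(P * E)\<^sup>2 * ((A * i) * (B * i) * (C * i))\<^sup>2 * (H * i) ^ 4 * (Y * j)\<^sup>2 * (V * Z)
           = (P\<^sup>2 * (A * B * C)\<^sup>2 * H ^ 4 * j\<^sup>2 * V) * (E\<^sup>2 * i ^ 10 * Y\<^sup>2 * Z)" for i j Y Z
          by algebra
        have E50: "E ^ 50 = E ^ 42 * E ^ 8" by (simp flip: power_add)
        have "E\<^sup>2 * (1 / E ^ 5) ^ 10 * (E ^ 7)\<^sup>2 * E ^ 26 = E ^ 42 / E ^ 50"
          by (simp add: power_divide flip: power_mult power_add)
        also have "\<dots> = 1 / E ^ 8"
        proof -
          have "E ^ 42 \<noteq> 0" using E by simp
          from nonzero_mult_divide_mult_cancel_left[OF this, of 1 "E ^ 8"] show ?thesis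
            unfolding E50 by (simp only: mult_1_right)
        qed
        finally have "E\<^sup>2 * (1 / E ^ 5) ^ 10 * (E ^ 7)\<^sup>2 * E ^ 26 = 1 / E ^ 8" .
        with alg[of "1 / E ^ 5" "E ^ 7" "1 / D" "E ^ 26"] show ?thesis
          unfolding e8 by (simp only: times_divide_eq_right mult_1_right)
      qed
      finally show ?thesis .
    qed
  qed
  have u: "u x = (norm (wilson k (of_real x) a b c h))\<^sup>2 * ((wilson_density a b c h x)\<^sup>2 / wilson_density a b c d x)" for x
  \<comment> \<open>Where the factor vanishes, the quotient of densities is 0 / 0 = 0 and agrees
    with \<open>u\<close>.\<close>
  proof (cases "wilson_factor x = 0")
    case False
    have "wilson_density a b c z x = (g a x * g b x * g c x * g z x)\<^sup>2 * wilson_factor x" for z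
      by (simp add: wilson_density_def g_def norm_mult)
    then show ?thesis
      using False gpos[OF re(1), of x] gpos[OF re(2), of x] gpos[OF re(3), of x] gpos[OF re(4), of x]
      by (simp add: u_def W_def[symmetric] field_simps power2_eq_square power4_eq_xxxx)
  qed (simp add: u_def wilson_density_def)
  show ?thesis using int_u unfolding u[abs_def] .
qed

lemma wilson_product_le:
  assumes "Re a > 0" "Re b > 0" "Re c > 0" "Re d > 0" "p \<ge> 0" "w \<ge> 0"
  shows "p * w * wilson_density a b c h x \<le>
    p\<^sup>2 * wilson_density a b c d x + w\<^sup>2 * ((wilson_density a b c h x)\<^sup>2 / wilson_density a b c d x)"
proof (cases "x = 0")
  case True
  then show ?thesis by (simp add: wilson_density_def wilson_factor_def)
next
  case False
  define A where "A = wilson_density a b c d x"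
  define B where "B = wilson_density a b c h x"
  have A: "A > 0" unfolding A_def by (rule wilson_density_pos[OF assms(1-4) False])
  have "B \<ge> 0" unfolding B_def by (rule wilson_density_nonneg)
  \<comment> \<open>Expanding the square of p A - w B; the division by A that follows distributes
    the two weights.\<close>
  have "(p * A) * (w * B) \<le> (p * A)\<^sup>2 + (w * B)\<^sup>2"
  proof -
    have "0 \<le> (p * A - w * B)\<^sup>2" by simp
    moreover have "0 \<le> (p * A) * (w * B)" using assms(5,6) A \<open>B \<ge> 0\<close> by simp
    ultimately show ?thesis by (simp add: power2_diff)
  qed
  then have "(p * A) * (w * B) / A \<le> ((p * A)\<^sup>2 + (w * B)\<^sup>2) / A"
    using A by (intro divide_right_mono) auto
  also have "(p * A) * (w * B) / A = p * w * B" using A by simp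
  also have "((p * A)\<^sup>2 + (w * B)\<^sup>2) / A = p\<^sup>2 * A + w\<^sup>2 * (B\<^sup>2 / A)"
    using A by (simp add: add_divide_distrib power_mult_distrib power2_eq_square)
  finally show ?thesis unfolding A_def B_def .
qed

section \<open>The integral of each term\<close>

definition wilson_pair_moment :: "nat \<Rightarrow> complex \<Rightarrow> complex \<Rightarrow> complex \<Rightarrow> complex \<Rightarrow> nat \<Rightarrow> complex" where
  "wilson_pair_moment k a b c h m =
    4 * of_real pi * (pochhammer (- of_nat m) k * Gamma (a + b + of_nat m) * Gamma (a + c + of_nat m) * Gamma (a + h + of_nat m)
       * Gamma (b + c + of_nat k) * Gamma (b + h + of_nat k) * Gamma (c + h + of_nat k)) / Gamma (a + b + c + h + of_nat (m + k))"

text \<open>\<open>wilson_moment\<close> pairs a polynomial expanded at its first parameter with a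
  factor based at its second. The factor here is based at a, so b is made the first parameter;
  almost everywhere this gives the same W_k.\<close>

lemma has_integral_wilson_pair:
  assumes re: "Re a > 0" "Re b > 0" "Re c > 0" "Re h > 0"
    and pairs: "nonreal_in_conjugate_pairs {#a, b, c, h#}"
  shows "has_bochner_integral lborel
    (\<lambda>x. pochhammer_pair a m x * (wilson k (of_real x) a b c h * wilson_kernel a b c h x)) (wilson_pair_moment k a b c h m)"
proof -
  have "has_bochner_integral lborel
    (\<lambda>x. wilson k (of_real x) b a c h * pochhammer_pair a m x * wilson_kernel b a c h x) (wilson_pair_moment k a b c h m)"
    using wilson_moment[OF re(2,1,3,4), of k m] unfolding wilson_pair_moment_def add.commute[of b a] .
  moreover have "(\<lambda>x. wilson k (of_real x) b a c h * pochhammer_pair a m x * wilson_kernel b a c h x) \<in> borel_measurable lborel"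
    "(\<lambda>x. pochhammer_pair a m x * (wilson k (of_real x) a b c h * wilson_kernel a b c h x)) \<in> borel_measurable lborel"
  proof -
    have "continuous_on UNIV (pochhammer_pair a m)"
      unfolding poly_pair_poly[symmetric, abs_def] by (intro continuous_intros)
    moreover note continuous_wilson[of k a b c h] continuous_wilson[of k b a c h]
      continuous_wilson_kernel[OF re] continuous_wilson_kernel[OF re(2,1,3,4)]
    ultimately have "continuous_on UNIV (\<lambda>x. wilson k (of_real x) b a c h * pochhammer_pair a m x * wilson_kernel b a c h x)"
      "continuous_on UNIV (\<lambda>x. pochhammer_pair a m x * (wilson k (of_real x) a b c h * wilson_kernel a b c h x))"
      by (simp_all add: continuous_on_mult)
    then show "(\<lambda>x. wilson k (of_real x) b a c h * pochhammer_pair a m x * wilson_kernel b a c h x) \<in> borel_measurable lborel"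
      "(\<lambda>x. pochhammer_pair a m x * (wilson k (of_real x) a b c h * wilson_kernel a b c h x)) \<in> borel_measurable lborel"
      by (simp_all add: borel_measurable_continuous_onI)
  qed
  moreover have "AE x in lborel. wilson k (of_real x) b a c h * pochhammer_pair a m x * wilson_kernel b a c h x
     = pochhammer_pair a m x * (wilson k (of_real x) a b c h * wilson_kernel a b c h x)"
    using wilson_symmetric_AE[OF re pairs, of k]
    by eventually_elim (simp add: wilson_kernel_commute(1)[of b a] mult_ac)
  ultimately show ?thesis
    using has_bochner_integral_cong_AE by blast
qed

lemma has_integral_wilson_sum:
  assumes re: "Re a > 0" "Re b > 0" "Re c > 0" "Re h > 0"
    and pairs: "nonreal_in_conjugate_pairs {#a, b, c, h#}"
  shows "has_bochner_integral lborel
    (\<lambda>x. wilson_sum n a b c d x * (wilson k (of_real x) a b c h * wilson_kernel a b c h x))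
    (\<Sum>j\<le>n. wilson_ratio n a b c d j * wilson_pair_moment k a b c h j)"
proof -
  have "has_bochner_integral lborel
    (\<lambda>x. wilson_ratio n a b c d j * (pochhammer_pair a j x * (wilson k (of_real x) a b c h * wilson_kernel a b c h x)))
    (wilson_ratio n a b c d j * wilson_pair_moment k a b c h j)" for j
    by (rule has_bochner_integral_mult_right[OF has_integral_wilson_pair[OF re pairs]])
  from has_bochner_integral_sum[where I = "{..n}", OF this]
  show ?thesis unfolding wilson_sum_def sum_distrib_right mult.assoc .
qed

text \<open>The moments contain (-j)_k, so the sum starts at j = k. After the shift j = i + k the
  factors (a + b)_j and (a + c)_j cancel and a balanced 3F2 remains, the second use of Saalschuetz's
  theorem. With N = n - k as the index, the result is a constant times the N-th coefficient of the
  final 3F2.\<close>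

lemma wilson_sum_moment:
  assumes re: "Re a > 0" "Re b > 0" "Re c > 0" "Re d > 0" "Re h > 0"
  shows "pochhammer (a + b + c + d - 1) (N + k) / fact (N + k) *
     (\<Sum>j\<le>N + k. wilson_ratio (N + k) a b c d j * wilson_pair_moment k a b c h j)
   = 4 * of_real pi * Gamma (a + b) * Gamma (a + c) *
       Gamma (of_nat k + a + h) * Gamma (of_nat k + b + c) *
       Gamma (of_nat k + b + h) * Gamma (of_nat k + c + h) *
       pochhammer (of_nat k + a + b + c + d - 1) k * pochhammer (a + b + c + d - 1) k /
       (Gamma (2 * of_nat k + a + b + c + h) * pochhammer (a + d) k) *
     (pochhammer (2 * of_nat k + a + b + c + d - 1) N * pochhammer (d - h) N * pochhammer (of_nat k + b + c) N /
       (pochhammer (2 * of_nat k + a + b + c + h) N * pochhammer (a + d + of_nat k) N * fact N))"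
proof -
  define n where "n = N + k"
  define s where "s = a + b + c + d"
  define t where "t = a + b + c + h"
  define \<gamma> where "\<gamma> = 4 * of_real pi * Gamma (b + c + of_nat k) * Gamma (b + h + of_nat k) * Gamma (c + h + of_nat k) *
     Gamma (a + b) * Gamma (a + c)"
  define T where "T = t + of_nat (k + k)"
  \<comment> \<open>The part of the shifted term that does not depend on i.\<close>
  define \<kappa> where "\<kappa> = \<gamma> * ((- 1) ^ k * pochhammer (- of_nat n) k) * pochhammer (s - 1 + of_nat n) k
      * Gamma (a + h + of_nat k) / (pochhammer (a + d) k * Gamma T)"
  have rp: "Re (a + b) > 0" "Re (a + c) > 0" "Re (a + d) > 0" "Re (a + h + of_nat k) > 0" "Re T > 0" "Re (a + d + of_nat k) > 0"
    using re by (auto simp: T_def t_def intro!: add_pos_nonneg)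
  have zero: "wilson_ratio n a b c d j * wilson_pair_moment k a b c h j = 0" if "j < k" for j
    using that by (simp add: wilson_pair_moment_def pochhammer_of_nat_eq_0_iff)
  have shift: "wilson_ratio n a b c d (i + k) * wilson_pair_moment k a b c h (i + k)
     = \<kappa> * (pochhammer (- of_nat N) i * pochhammer (s - 1 + of_nat n + of_nat k) i * pochhammer (a + h + of_nat k) i
        / (fact i * pochhammer (a + d + of_nat k) i * pochhammer T i))" for i
  proof -
    have e: "of_nat n + a + b + c + d - 1 = s - 1 + of_nat n" "- of_nat n + of_nat k = (- of_nat N :: complex)"
      by (simp_all add: s_def n_def)
    have p: "pochhammer z (i + k) = pochhammer z k * pochhammer (z + of_nat k) i" for z :: complex
      using pochhammer_product'[of z k i] by (simp add: add.commute)
    have f: "pochhammer (- of_nat (i + k) :: complex) k = (- 1) ^ k * (fact (i + k) / fact i)"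
      unfolding pochhammer_minus_of_nat using binomial_fact[of k "i + k", where ?'a = complex] by simp
    have G1: "Gamma (a + h + of_nat (i + k)) = pochhammer (a + h + of_nat k) i * Gamma (a + h + of_nat k)"
      using Gamma_add_of_nat[OF rp(4), of i] by (simp add: add_ac)
    have G2: "Gamma (a + b + c + h + of_nat (i + k + k)) = pochhammer T i * Gamma T"
      using Gamma_add_of_nat[OF rp(5), of i] by (simp add: T_def t_def add_ac)
    have nz: "pochhammer (a + b) (i + k) \<noteq> 0" "pochhammer (a + c) (i + k) \<noteq> 0" "fact (i + k) \<noteq> (0 :: complex)"
      using rp by (simp_all add: pochhammer_Re_pos_nonzero)
    have alg: "p1 * p2 / (q1 * q2 * q3 * F) * (4 * w * (m * (F / f) * (q1 * g1) * (q2 * g2) * g3 * g4 * g5 * g6) / g7)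
         = 4 * w * g4 * g5 * g6 * g1 * g2 * m * p1 * p2 * g3 / (f * q3 * g7)"
      if "q1 \<noteq> 0" "q2 \<noteq> 0" "F \<noteq> 0" for p1 p2 q1 q2 q3 F f w m g1 g2 g3 g4 g5 g6 g7 :: complex
      using that by (simp add: divide_simps)
    have "wilson_ratio n a b c d (i + k) * wilson_pair_moment k a b c h (i + k)
       = 4 * of_real pi * Gamma (b + c + of_nat k) * Gamma (b + h + of_nat k) * Gamma (c + h + of_nat k) *
         Gamma (a + b) * Gamma (a + c) * (- 1) ^ k * pochhammer (- of_nat n) (i + k) * pochhammer (s - 1 + of_nat n) (i + k)
         * Gamma (a + h + of_nat (i + k)) / (fact i * pochhammer (a + d) (i + k) * Gamma (a + b + c + h + of_nat (i + k + k)))"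
      unfolding wilson_ratio_def wilson_pair_moment_def e(1) f Gamma_add_of_nat[OF rp(1)] Gamma_add_of_nat[OF rp(2)]
      by (rule alg[OF nz])
    also have "\<dots> = \<kappa> * (pochhammer (- of_nat N) i * pochhammer (s - 1 + of_nat n + of_nat k) i * pochhammer (a + h + of_nat k) i
        / (fact i * pochhammer (a + d + of_nat k) i * pochhammer T i))"
      unfolding p G1 G2 e(2) \<kappa>_def \<gamma>_def
      by (simp only: times_divide_eq_left times_divide_eq_right divide_divide_eq_left mult_ac)
    finally show ?thesis .
  qed
  have "(\<Sum>j\<le>n. wilson_ratio n a b c d j * wilson_pair_moment k a b c h j)
      = (\<Sum>j\<in>{k..n}. wilson_ratio n a b c d j * wilson_pair_moment k a b c h j)"
  proof (rule sum.mono_neutral_right)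
    show "\<forall>j\<in>{..n} - {k..n}. wilson_ratio n a b c d j * wilson_pair_moment k a b c h j = 0"
    proof
      fix j assume "j \<in> {..n} - {k..n}"
      then have "j < k" by auto
      then show "wilson_ratio n a b c d j * wilson_pair_moment k a b c h j = 0" by (rule zero)
    qed
  qed auto
  also have "\<dots> = (\<Sum>i\<le>N. wilson_ratio n a b c d (i + k) * wilson_pair_moment k a b c h (i + k))"
    using sum.shift_bounds_cl_nat_ivl[of "\<lambda>j. wilson_ratio n a b c d j * wilson_pair_moment k a b c h j" 0 k N]
    by (simp add: n_def atLeast0AtMost)
  also have "\<dots> = \<kappa> * (\<Sum>i\<le>N. pochhammer (- of_nat N) i * pochhammer (s - 1 + of_nat n + of_nat k) i * pochhammer (a + h + of_nat k) i
        / (fact i * pochhammer (a + d + of_nat k) i * pochhammer T i))"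
    unfolding shift sum_distrib_left ..
  also have "(\<Sum>i\<le>N. pochhammer (- of_nat N) i * pochhammer (s - 1 + of_nat n + of_nat k) i * pochhammer (a + h + of_nat k) i
        / (fact i * pochhammer (a + d + of_nat k) i * pochhammer T i))
     = (- 1) ^ N * pochhammer (a + d + of_nat k - (s - 1 + of_nat n + of_nat k)) N * pochhammer (a + d + of_nat k - (a + h + of_nat k)) N
        / (pochhammer (a + d + of_nat k) N * pochhammer T N)"
    by (rule saalschuetz) (use rp in \<open>simp_all add: pochhammer_Re_pos_nonzero T_def t_def s_def n_def\<close>)
  also have "a + d + of_nat k - (s - 1 + of_nat n + of_nat k) = 1 - of_nat N - (of_nat k + b + c)"
    by (simp add: s_def n_def)
  also have "a + d + of_nat k - (a + h + of_nat k) = d - h" by simp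
  also have "pochhammer (1 - of_nat N - (of_nat k + b + c)) N = (- 1) ^ N * pochhammer (of_nat k + b + c) N"
    by (rule pochhammer_reflect)
  also have "(- 1) ^ N * ((- 1) ^ N * pochhammer (of_nat k + b + c) N) = pochhammer (of_nat k + b + c) N"
    by (simp flip: power_mult_distrib mult.assoc)
  finally have sum: "(\<Sum>j\<le>n. wilson_ratio n a b c d j * wilson_pair_moment k a b c h j)
     = \<kappa> * (pochhammer (of_nat k + b + c) N * pochhammer (d - h) N / (pochhammer (a + d + of_nat k) N * pochhammer T N))" .
  have sgn: "(- 1) ^ k * pochhammer (- of_nat n) k = (fact n / fact N :: complex)"
  proof -
    have "(- 1) ^ k * ((- 1) ^ k * x) = x" for x :: complex by (simp flip: power_mult_distrib mult.assoc)
    then show ?thesis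
      unfolding n_def pochhammer_minus_of_nat mult.assoc
      using binomial_fact[of k "N + k", where ?'a = complex] by simp
  qed
  \<comment> \<open>Both sides are (s - 1)_(N + 2k), cut once at n = N + k and once at k and
    2k.\<close>
  have ps: "pochhammer (s - 1) n * pochhammer (s - 1 + of_nat n) k
     = pochhammer (s - 1) k * pochhammer (s - 1 + of_nat k) k * pochhammer (s - 1 + of_nat (k + k)) N"
    unfolding pochhammer_product'[symmetric] by (simp add: n_def add_ac)
  have alg2: "y / F * (g * (F / f) * z * g' / (p * u) * (v / w)) = g * (y * z) * g' / (p * u) * (v / (w * f))"
    if "F \<noteq> 0" for y F g f z g' p u v w :: complex
    using that by (simp add: mult_ac)
  have "pochhammer (s - 1) n / fact n * (\<Sum>j\<le>n. wilson_ratio n a b c d j * wilson_pair_moment k a b c h j)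
     = \<gamma> * (pochhammer (s - 1) n * pochhammer (s - 1 + of_nat n) k) * Gamma (a + h + of_nat k) / (pochhammer (a + d) k * Gamma T) *
       (pochhammer (of_nat k + b + c) N * pochhammer (d - h) N / (pochhammer (a + d + of_nat k) N * pochhammer T N * fact N))"
    unfolding sum \<kappa>_def sgn by (rule alg2) simp
  moreover have "a + h + of_nat k = of_nat k + a + h" "b + c + of_nat k = of_nat k + b + c" "b + h + of_nat k = of_nat k + b + h"
    "c + h + of_nat k = of_nat k + c + h" "T = 2 * of_nat k + a + b + c + h" "s - 1 + of_nat k = of_nat k + a + b + c + d - 1"
    "s - 1 + of_nat (k + k) = 2 * of_nat k + a + b + c + d - 1" "s - 1 = a + b + c + d - 1"
    by (simp_all add: T_def t_def s_def)
  ultimately show ?thesis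
    unfolding ps unfolding \<gamma>_def n_def by (simp only: times_divide_eq_left times_divide_eq_right divide_divide_eq_left mult_ac)
qed

section \<open>Summation and passage to the half line\<close>

lemma has_bochner_integral_even_half:
  fixes f :: "real \<Rightarrow> 'a :: {banach, second_countable_topology}"
  assumes f: "has_bochner_integral lborel f (2 *\<^sub>R I)" and even: "\<And>x. f (- x) = f x"
  shows "has_bochner_integral lborel (\<lambda>x. indicator {0<..} x *\<^sub>R f x) I"
proof -
  define g where "g x = indicator {0<..} x *\<^sub>R f x" for x
  have g: "integrable lborel g"
    unfolding g_def using integrable.intros[OF f] by (intro integrable_mult_indicator) auto
  have g': "integrable lborel (\<lambda>x. g (0 + (-1) * x))"
    using g by (subst lborel_integrable_real_affine_iff) auto
  have eq: "integral\<^sup>L lborel g = integral\<^sup>L lborel (\<lambda>x. g (0 + (-1) * x))"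
    using lborel_integral_real_affine[of "-1" g 0] by simp
  have "AE x in lborel. f x = g x + g (0 + (-1) * x)"
    using AE_lborel_singleton[of 0] by eventually_elim (auto simp: g_def indicator_def even)
  then have "integral\<^sup>L lborel f = integral\<^sup>L lborel (\<lambda>x. g x + g (0 + (-1) * x))"
    using integrable.intros[OF f] g g' by (intro integral_cong_AE) auto
  also have "\<dots> = integral\<^sup>L lborel g + integral\<^sup>L lborel g"
    unfolding Bochner_Integration.integral_add[OF g g'] eq[symmetric] ..
  also have "\<dots> = 2 *\<^sub>R integral\<^sup>L lborel g" by (simp add: scaleR_2)
  finally have "integral\<^sup>L lborel g = I"
    using has_bochner_integral_integral_eq[OF f] by simp
  with g have "has_bochner_integral lborel g I" by (simp add: has_bochner_integral_iff)
  then show ?thesis unfolding g_def[abs_def] .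
qed

text \<open>One null set must serve all radii, so the square integrals are used along the countable
  sequence \<open>r' m\<close>, which tends to 1. Then |p| <= 1 + |p|^2 leads from squares back to
  moduli.\<close>

lemma wilson_gen_coeff_summable_AE:
  assumes re: "Re a > 0" "Re b > 0" "Re c > 0" "Re d > 0"
    and pairs: "nonreal_in_conjugate_pairs {#a, b, c, d#}"
  shows "AE x in lborel. \<forall>r. 0 \<le> r \<and> r < 1 \<longrightarrow> summable (\<lambda>n. norm (wilson_gen_coeff a b c d x n) * r ^ n)"
proof -
  define c' where "c' n = norm (pochhammer (a + b + c + d - 1) n / fact n)" for n
  define r' where "r' m = real (Suc m) / real (Suc (Suc m))" for m
  have r': "0 \<le> r' m" "r' m < 1" for m by (simp_all add: r'_def)
  have c'_sum: "summable (\<lambda>n. c' n * r' m ^ n)" for m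
  proof -
    have "summable (\<lambda>n. norm ((\<Prod>a\<leftarrow>[a + b + c + d - 1]. pochhammer a n) / (\<Prod>b\<leftarrow>[1]. pochhammer b n) * complex_of_real (r' m) ^ n))"
      using r'[of m] by (intro summable_pochhammer_ratio) auto
    moreover have "norm (complex_of_real (r' m) ^ n) = r' m ^ n" for n
      using r'(1)[of m] by (simp add: norm_power)
    ultimately show ?thesis by (simp only: c'_def norm_mult list.map prod_list.Cons prod_list.Nil mult_1_right pochhammer_fact)
  qed
  have "AE x in lborel. summable (\<lambda>n. c' n * r' m ^ n * ((norm (wilson_sum n a b c d x))\<^sup>2 * wilson_density a b c d x))" for m
  proof (rule AE_summable)
    show "integrable lborel (\<lambda>x. c' n * r' m ^ n * ((norm (wilson_sum n a b c d x))\<^sup>2 * wilson_density a b c d x))" for n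
      by (intro integrable_mult_right wilson_sum_square re pairs)
    show "0 \<le> c' n * r' m ^ n * ((norm (wilson_sum n a b c d x))\<^sup>2 * wilson_density a b c d x)" for n x
      using r'(1)[of m] wilson_density_nonneg by (simp add: c'_def)
    show "summable (\<lambda>n. integral\<^sup>L lborel (\<lambda>x. c' n * r' m ^ n * ((norm (wilson_sum n a b c d x))\<^sup>2 * wilson_density a b c d x)))"
      using wilson_sum_square_summable[OF re pairs r'] unfolding c'_def integral_mult_right_zero .
  qed
  then have "AE x in lborel. \<forall>m. summable (\<lambda>n. c' n * r' m ^ n * ((norm (wilson_sum n a b c d x))\<^sup>2 * wilson_density a b c d x))"
    by (simp add: AE_all_countable)
  then show ?thesis
    using AE_lborel_singleton[of 0]
  proof eventually_elim
    case (elim x)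
    have w: "wilson_density a b c d x > 0" by (rule wilson_density_pos[OF re elim(2)])
    show ?case
    proof (intro allI impI)
      fix r :: real assume r: "0 \<le> r \<and> r < 1"
      obtain m where m: "inverse (real (Suc m)) < 1 - r" using reals_Archimedean[of "1 - r"] r by auto
      have "1 - r' m \<le> inverse (real (Suc m))" by (simp add: r'_def field_simps)
      then have rm: "r \<le> r' m" using m by linarith
      let ?p = "\<lambda>n. norm (wilson_sum n a b c d x)"
      have "summable (\<lambda>n. c' n * r' m ^ n * ((?p n)\<^sup>2 * wilson_density a b c d x) / wilson_density a b c d x)"
        using elim(1) by (intro summable_divide) blast
      then have "summable (\<lambda>n. c' n * r' m ^ n * (?p n)\<^sup>2)" using w by (simp add: mult.assoc)
      from summable_add[OF c'_sum this] have S: "summable (\<lambda>n. c' n * r' m ^ n + c' n * r' m ^ n * (?p n)\<^sup>2)" .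
      show "summable (\<lambda>n. norm (wilson_gen_coeff a b c d x n) * r ^ n)"
      proof (rule summable_comparison_test'[OF S])
        fix n
        have "?p n \<le> 1 + (?p n)\<^sup>2"
          using sum_squares_bound[of "?p n" 1] norm_ge_zero[of "wilson_sum n a b c d x"]
          by (simp only: mult_1_right power_one)
        moreover have "0 \<le> c' n" by (simp add: c'_def)
        moreover have "r ^ n \<le> r' m ^ n" using r rm by (intro power_mono) auto
        ultimately have "c' n * ?p n * r ^ n \<le> c' n * (1 + (?p n)\<^sup>2) * r' m ^ n"
          using r by (intro mult_mono mult_nonneg_nonneg) auto
        also have "c' n * (1 + (?p n)\<^sup>2) * r' m ^ n = c' n * r' m ^ n + c' n * r' m ^ n * (?p n)\<^sup>2"
          by (simp only: distrib_left distrib_right mult_1_right mult_ac)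
        also have "c' n * ?p n = norm (wilson_gen_coeff a b c d x n)"
          unfolding wilson_gen_coeff_def c'_def by (rule norm_mult[symmetric])
        finally show "norm (norm (wilson_gen_coeff a b c d x n) * r ^ n) \<le> c' n * r' m ^ n + c' n * r' m ^ n * (?p n)\<^sup>2"
          using r by simp
      qed
    qed
  qed
qed

lemma pochhammer_pair_minus: "pochhammer_pair a m (- x) = pochhammer_pair a m x"
  by (simp add: pochhammer_pair_def mult.commute)

lemma wilson_kernel_minus: "wilson_kernel a b c d (- x) = wilson_kernel a b c d x"
proof -
  have "gamma_pair z (- x) = gamma_pair z x" for z by (simp add: gamma_pair_def mult.commute)
  moreover have "wilson_factor (- x) = wilson_factor x" by (simp add: wilson_factor_def)
  ultimately show ?thesis by (simp add: wilson_kernel_def)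
qed

text \<open>The series stays as it is inside the integral; it is identified with the 4F3 only
  afterwards, and almost everywhere. The outer factor 2 comes from integrating over the whole
  line.\<close>

lemma has_integral_wilson_generating:
  assumes \<rho>: "norm \<rho> < 1"
    and re: "Re a > 0" "Re b > 0" "Re c > 0" "Re d > 0" "Re h > 0"
    and pairs: "nonreal_in_conjugate_pairs {#a, b, c, d#}" "nonreal_in_conjugate_pairs {#a, b, c, h#}"
  shows "has_bochner_integral lborel
     (\<lambda>x. \<Sum>n. wilson_gen_coeff a b c d x n * \<rho> ^ n * (wilson k (of_real x) a b c h * wilson_kernel a b c h x))
     (2 *\<^sub>R (2 * complex_of_real pi * Gamma (a + b) * Gamma (a + c) *
       Gamma (of_nat k + a + h) * Gamma (of_nat k + b + c) *
       Gamma (of_nat k + b + h) * Gamma (of_nat k + c + h) *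
       pochhammer (of_nat k + a + b + c + d - 1) k * pochhammer (a + b + c + d - 1) k /
       (Gamma (2 * of_nat k + a + b + c + h) * pochhammer (a + d) k) *
     hypergeometric
       [2 * of_nat k + a + b + c + d - 1, d - h, of_nat k + b + c]
       [2 * of_nat k + a + b + c + h, a + d + of_nat k] \<rho> * \<rho> ^ k))"
proof -
  note reh = re(1-3,5) and red = re(1-4)
  define F where "F n x = wilson_gen_coeff a b c d x n * \<rho> ^ n * (wilson k (of_real x) a b c h * wilson_kernel a b c h x)" for n x
  define c' where "c' n = pochhammer (a + b + c + d - 1) n / fact n" for n
  define M where "M n = (\<Sum>j\<le>n. wilson_ratio n a b c d j * wilson_pair_moment k a b c h j)" for n
  define U where "U x = (norm (wilson k (of_real x) a b c h))\<^sup>2 *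
            ((wilson_density a b c h x)\<^sup>2 / wilson_density a b c d x)" for x :: real
  define p where "p n x = (norm (wilson_sum n a b c d x))\<^sup>2 * wilson_density a b c d x" for n x
  define r where "r = norm \<rho>"
  have r: "0 \<le> r" "r < 1" using \<rho> by (auto simp: r_def)
  have U: "integrable lborel U" unfolding U_def by (rule integrable_wilson_square_ratio[OF re])
  have p: "integrable lborel (p n)" for n unfolding p_def by (rule wilson_sum_square(1)[OF red pairs(1)])
  have F_int: "has_bochner_integral lborel (F n) (c' n * \<rho> ^ n * M n)" for n
  proof -
    have "F n = (\<lambda>x. c' n * \<rho> ^ n * (wilson_sum n a b c d x * (wilson k (of_real x) a b c h * wilson_kernel a b c h x)))"
      by (simp add: fun_eq_iff F_def c'_def wilson_gen_coeff_def mult_ac)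
    then show ?thesis
      unfolding M_def using has_bochner_integral_mult_right[OF has_integral_wilson_sum[OF reh pairs(2)]] by simp
  qed
  \<comment> \<open>The summand \<open>U\<close> does not depend on n, so summability has to be
    checked only for the square integrals and for the bare coefficients.\<close>
  have F_le: "norm (F n x) \<le> norm (c' n) * r ^ n * (p n x + U x)" for n x
  proof -
    have "norm (F n x) = norm (c' n) * r ^ n * (norm (wilson_sum n a b c d x) * norm (wilson k (of_real x) a b c h) * wilson_density a b c h x)"
      unfolding F_def wilson_gen_coeff_def c'_def[symmetric] wilson_kernel_eq_density[OF pairs(2)]
      using wilson_density_nonneg[of a b c h x] by (simp add: norm_mult norm_power r_def)
    also have "\<dots> \<le> norm (c' n) * r ^ n * (p n x + U x)"
      unfolding p_def U_def using r by (intro mult_left_mono wilson_product_le red) auto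
    finally show ?thesis .
  qed
  have c'_sum: "summable (\<lambda>n. norm (c' n) * r ^ n)"
  proof -
    have "summable (\<lambda>n. norm ((\<Prod>a\<leftarrow>[a + b + c + d - 1]. pochhammer a n) / (\<Prod>b\<leftarrow>[1]. pochhammer b n) * \<rho> ^ n))"
      using \<rho> by (intro summable_pochhammer_ratio) auto
    then show ?thesis by (simp only: c'_def r_def norm_mult norm_power list.map prod_list.Cons prod_list.Nil mult_1_right pochhammer_fact)
  qed
  have bound_sum: "summable (\<lambda>n. integral\<^sup>L lborel (\<lambda>x. norm (c' n) * r ^ n * (p n x + U x)))"
  proof -
    have "integral\<^sup>L lborel (\<lambda>x. norm (c' n) * r ^ n * (p n x + U x))
       = norm (c' n) * r ^ n * integral\<^sup>L lborel (p n) + norm (c' n) * r ^ n * integral\<^sup>L lborel U" for n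
      unfolding integral_mult_right_zero Bochner_Integration.integral_add[OF p U] by (simp only: distrib_left)
    moreover have "summable (\<lambda>n. norm (c' n) * r ^ n * integral\<^sup>L lborel (p n) + norm (c' n) * r ^ n * integral\<^sup>L lborel U)"
      using wilson_sum_square_summable[OF red pairs(1) r] unfolding c'_def[symmetric] p_def[symmetric, abs_def]
      by (rule summable_add[OF _ summable_mult2[OF c'_sum]])
    ultimately show ?thesis by simp
  qed
  have F_integrable: "integrable lborel (F n)" for n by (rule integrable.intros[OF F_int])
  have norm_sum: "summable (\<lambda>n. integral\<^sup>L lborel (\<lambda>x. norm (F n x)))"
  proof (rule summable_comparison_test'[OF bound_sum])
    fix n
    have "integral\<^sup>L lborel (\<lambda>x. norm (F n x)) \<le> integral\<^sup>L lborel (\<lambda>x. norm (c' n) * r ^ n * (p n x + U x))"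
      by (intro integral_mono F_le integrable_norm F_integrable integrable_mult_right Bochner_Integration.integrable_add p U)
    moreover have "integral\<^sup>L lborel (\<lambda>x. norm (F n x)) \<ge> 0" by (rule integral_nonneg_AE) simp
    ultimately show "norm (integral\<^sup>L lborel (\<lambda>x. norm (F n x))) \<le> integral\<^sup>L lborel (\<lambda>x. norm (c' n) * r ^ n * (p n x + U x))"
      by simp
  qed
  have AE_sum: "AE x in lborel. summable (\<lambda>n. norm (F n x))"
    by (rule AE_summable[OF _ _ norm_sum]) (auto intro: F_integrable)
  have "(\<lambda>n. integral\<^sup>L lborel (F n)) sums integral\<^sup>L lborel (\<lambda>x. \<Sum>n. F n x)"
    by (rule sums_integral[OF F_integrable AE_sum norm_sum])
  then have S1: "(\<lambda>n. c' n * \<rho> ^ n * M n) sums integral\<^sup>L lborel (\<lambda>x. \<Sum>n. F n x)"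
    unfolding has_bochner_integral_integral_eq[OF F_int] .
  define R where "R = 4 * of_real pi * Gamma (a + b) * Gamma (a + c) *
       Gamma (of_nat k + a + h) * Gamma (of_nat k + b + c) *
       Gamma (of_nat k + b + h) * Gamma (of_nat k + c + h) *
       pochhammer (of_nat k + a + b + c + d - 1) k * pochhammer (a + b + c + d - 1) k /
       (Gamma (2 * of_nat k + a + b + c + h) * pochhammer (a + d) k)"
  let ?as = "[2 * of_nat k + a + b + c + d - 1, d - h, of_nat k + b + c]"
    and ?bs = "[2 * of_nat k + a + b + c + h, a + d + of_nat k]"
  have "(\<lambda>N. R * \<rho> ^ k * ((\<Prod>a\<leftarrow>?as. pochhammer a N) / (\<Prod>b\<leftarrow>?bs. pochhammer b N) * \<rho> ^ N / fact N))
     sums (R * \<rho> ^ k * hypergeometric_series ?as ?bs \<rho>)"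
    using \<rho> by (intro sums_mult hypergeometric_series_sums) auto
  moreover have "c' (N + k) * \<rho> ^ (N + k) * M (N + k)
     = R * \<rho> ^ k * ((\<Prod>a\<leftarrow>?as. pochhammer a N) / (\<Prod>b\<leftarrow>?bs. pochhammer b N) * \<rho> ^ N / fact N)" for N
  proof -
    have l: "(\<Prod>a\<leftarrow>?as. pochhammer a N) = pochhammer (2 * of_nat k + a + b + c + d - 1) N * pochhammer (d - h) N * pochhammer (of_nat k + b + c) N"
      "(\<Prod>b\<leftarrow>?bs. pochhammer b N) = pochhammer (2 * of_nat k + a + b + c + h) N * pochhammer (a + d + of_nat k) N"
      by (simp_all only: list.map prod_list.Cons prod_list.Nil mult_1_right mult.assoc)
    have "c' (N + k) * \<rho> ^ (N + k) * M (N + k) = \<rho> ^ (N + k) * (c' (N + k) * M (N + k))" by (simp only: mult_ac)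
    also have "c' (N + k) * M (N + k) = R * ((\<Prod>a\<leftarrow>?as. pochhammer a N) / ((\<Prod>b\<leftarrow>?bs. pochhammer b N) * fact N))"
      unfolding c'_def M_def l R_def by (rule wilson_sum_moment[OF re])
    finally show ?thesis by (simp only: power_add times_divide_eq_left times_divide_eq_right divide_divide_eq_left mult_ac)
  qed
  ultimately have "(\<lambda>N. c' (N + k) * \<rho> ^ (N + k) * M (N + k)) sums (R * \<rho> ^ k * hypergeometric_series ?as ?bs \<rho>)"
    by (simp only:)
  \<comment> \<open>Orthogonality: p_n has degree at most n < k in x^2. This is the origin of the
    factor \<rho>^k.\<close>
  moreover have "c' n * \<rho> ^ n * M n = 0" if "n < k" for n
  proof -
    have "wilson_pair_moment k a b c h j = 0" if "j \<le> n" for j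
      using that \<open>n < k\<close> by (simp add: wilson_pair_moment_def pochhammer_of_nat_eq_0_iff)
    then show ?thesis by (simp add: M_def)
  qed
  ultimately have "(\<lambda>n. c' n * \<rho> ^ n * M n) sums (R * \<rho> ^ k * hypergeometric_series ?as ?bs \<rho>)"
    by (subst (asm) sums_iff_shift) simp
  then have I: "integral\<^sup>L lborel (\<lambda>x. \<Sum>n. F n x) = R * \<rho> ^ k * hypergeometric_series ?as ?bs \<rho>"
    by (rule sums_unique2[OF S1])
  have hyp: "hypergeometric ?as ?bs \<rho> = hypergeometric_series ?as ?bs \<rho>"
    using \<rho> by (simp add: hypergeometric_def)
  have "integrable lborel (\<lambda>x. \<Sum>n. F n x)"
    by (rule integrable_suminf[OF F_integrable AE_sum norm_sum])
  with I have "has_bochner_integral lborel (\<lambda>x. \<Sum>n. F n x) (R * \<rho> ^ k * hypergeometric ?as ?bs \<rho>)"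
    by (simp only: has_bochner_integral_iff hyp)
  moreover have "2 *\<^sub>R (2 * complex_of_real pi * Gamma (a + b) * Gamma (a + c) *
       Gamma (of_nat k + a + h) * Gamma (of_nat k + b + c) *
       Gamma (of_nat k + b + h) * Gamma (of_nat k + c + h) *
       pochhammer (of_nat k + a + b + c + d - 1) k * pochhammer (a + b + c + d - 1) k /
       (Gamma (2 * of_nat k + a + b + c + h) * pochhammer (a + d) k) * hypergeometric ?as ?bs \<rho> * \<rho> ^ k)
     = R * \<rho> ^ k * hypergeometric ?as ?bs \<rho>"
    by (simp add: R_def scaleR_conv_of_real)
  ultimately show ?thesis
    unfolding F_def by (simp only:)
qed

theorem corollary6p2:
  fixes k :: nat and \<rho> a b c d h :: complex
  assumes "norm \<rho> < 1"
    and "Re a > 0" "Re b > 0" "Re c > 0" "Re d > 0" "Re h > 0"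
    and "nonreal_in_conjugate_pairs {#a, b, c, d#}"
    and "nonreal_in_conjugate_pairs {#a, b, c, h#}"
  shows "has_bochner_integral (lebesgue_on {0<..})
    (\<lambda>x::real.
      (1 - \<rho>) powr (1 - a - b - c - d) *
      hypergeometric
        [(a + b + c + d - 1) / 2, (a + b + c + d) / 2, a + \<i> * complex_of_real x, a - \<i> * complex_of_real x]
        [a + b, a + c, a + d] (- (4 * \<rho> / (1 - \<rho>)\<^sup>2)) *
      wilson k (complex_of_real x) a b c h * complex_of_real (wilson_weight a b c h x))
    (2 * complex_of_real pi * Gamma (a + b) * Gamma (a + c) *
       Gamma (of_nat k + a + h) * Gamma (of_nat k + b + c) *
       Gamma (of_nat k + b + h) * Gamma (of_nat k + c + h) *
       pochhammer (of_nat k + a + b + c + d - 1) k * pochhammer (a + b + c + d - 1) k /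
       (Gamma (2 * of_nat k + a + b + c + h) * pochhammer (a + d) k) *
     hypergeometric
       [2 * of_nat k + a + b + c + d - 1, d - h, of_nat k + b + c]
       [2 * of_nat k + a + b + c + h, a + d + of_nat k] \<rho> *
     \<rho> ^ k)"
    (is "has_bochner_integral _ ?T ?I")
proof -
  define \<Phi> where "\<Phi> x = (\<Sum>n. wilson_gen_coeff a b c d x n * \<rho> ^ n * (wilson k (of_real x) a b c h * wilson_kernel a b c h x))" for x
  define g where "g x = indicator {0<..} x *\<^sub>R \<Phi> x" for x :: real
  have "\<Phi> (- x) = \<Phi> x" for x
    unfolding \<Phi>_def wilson_gen_coeff_def wilson_sum_def wilson_altdef pochhammer_pair_minus wilson_kernel_minus ..
  then have "has_bochner_integral lborel g ?I"
    unfolding g_def[abs_def]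
    using has_integral_wilson_generating[OF assms, of k, folded \<Phi>_def]
    by (intro has_bochner_integral_even_half)
  \<comment> \<open>The integrand \<open>?T\<close> contains a continuation chosen separately for
    each x, so its Borel measurability is not evident. In the completed measure, agreement almost
    everywhere with \<open>g\<close> is enough.\<close>
  then have g: "has_bochner_integral lebesgue g ?I"
    using borel_measurable_has_bochner_integral[of lborel g ?I]
    by (simp add: has_bochner_integral_iff integrable_completion integral_completion)
  have "AE x in lborel. g x = indicator {0<..} x *\<^sub>R ?T x"
    using wilson_gen_coeff_summable_AE[OF assms(2-5,7)]
  proof eventually_elim
    case (elim x)
    show ?case
    proof (cases "x > 0")
      case True
      let ?H = "(1 - \<rho>) powr (1 - a - b - c - d) *
      hypergeometric
        [(a + b + c + d - 1) / 2, (a + b + c + d) / 2, a + \<i> * complex_of_real x, a - \<i> * complex_of_real x]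
        [a + b, a + c, a + d] (- (4 * \<rho> / (1 - \<rho>)\<^sup>2))"
      have "(\<lambda>n. wilson_gen_coeff a b c d x n * \<rho> ^ n) sums ?H"
        by (rule wilson_generating_function[OF _ assms(1)]) (use elim in blast)
      from sums_unique[OF sums_mult2[OF this]]
      have "\<Phi> x = ?H * (wilson k (of_real x) a b c h * wilson_kernel a b c h x)"
        unfolding \<Phi>_def by (rule sym)
      also have "\<dots> = ?T x"
        unfolding wilson_kernel_eq_density[OF assms(8)] wilson_weight_eq_density[OF True] by (simp only: mult.assoc)
      finally show ?thesis using True by (simp only: g_def)
    qed (simp add: g_def)
  qed
  then have AE: "AE x in lebesgue. g x = indicator {0<..} x *\<^sub>R ?T x"
    by (rule AE_completion)
  have m: "g \<in> borel_measurable lebesgue" by (rule borel_measurable_has_bochner_integral[OF g])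
  have "has_bochner_integral lebesgue (\<lambda>x. indicator {0<..} x *\<^sub>R ?T x) ?I"
    using has_bochner_integral_cong_AE[OF m borel_measurable_AE[OF m AE] AE] g by blast
  then show ?thesis
    by (subst has_bochner_integral_restrict_space) simp_all
qed

end
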